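(* Let $\bm{z}_1,\dots,\bm{z}_n\in\mathbb{R}^d$ arrive one at a time in a stream. There exists a streaming algorithm that, for every timestep $t$, maintains an ellipsoid $\mathcal{E}_t$ (origin-centered), a center $\bm{c}_t\in\mathbb{R}^d$ and an approximation factor $\alpha_t\in(0,1]$ such that \[\bm{c}_t+\alpha_t\cdot\mathcal{E}_t\subseteq \mathrm{conv}\{\bm{z}_1,\dots,\bm{z}_t\}\subseteq \bm{c}_t+\mathcal{E}_t.\] Moreover, let $r_t$ and $R_t$ be the largest and smallest parameters, respectively, for which there exists $\bm{c}^\star_t\in\mathbb{R}^d$ such that \[\bm{c}^\star_t+r_t\cdot\big(B_2^d\cap \mathrm{span}\{\bm{z}_1-\bm{c}^\star_t,\dots,\bm{z}_t-\bm{c}^\star_t\}\big)\subseteq \mathrm{conv}\{\bm{z}_1,\dots,\bm{z}_t\}\subseteq \bm{c}^\star_t+R_t\cdot B_2^d,\] and let $d_t=\dim\big(\mathrm{aff}\{\bm{z}_1,\dots,\bm{z}_t\}\big)$. Then for all timesteps $t$, \[\frac{1}{\alpha_t}=O\!\left(d_t\log\!\left(d_t\cdot\max_{t'\le t}\frac{R_t}{r_{t'}}\right)\right).\] The algorithm runs in time $\widetilde{O}(nd^2)$ and stores $O(d^2)$ floating point numbers.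
   Context: $B_2^d$ is the Euclidean unit ball in $\mathbb{R}^d$; $\mathrm{span}$ denotes linear span and $\mathrm{aff}$ denotes affine span. An origin-centered ellipsoid is the image of a Euclidean ball (possibly of a lower-dimensional subspace) under a linear map, i.e. a set of the form $\{\bm{x}\in H:\|\mathbf{A}\bm{x}\|_2\le1\}$ for a linear subspace $H$ and a matrix $\mathbf{A}$ nonsingular on $H$. In the streaming model the algorithm receives the points one at a time and updates its output after each point, without knowing $n$ in advance. $O(\cdot)$ hides absolute constants; $\widetilde{O}$ also hides logarithmic factors.
   Formalization: The bound on 1/α_t is O(max(1, d_t log(...))), since the stated expression vanishes when d_t = 0, or d_t = 1 with ratio 1, while 1/α_t ≥ 1; when all points so far coincide no largest r_t exists, so r_t is taken as +∞ and that t' contributes ratio 0. *)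

theory Defs
  imports "HOL-Analysis.Analysis" "HOL-Analysis.Finite_Function_Topology"
begin

section \<open>The spaces of points\<close>

text \<open>
  One program has to work for every dimension, with absolute constants, so the dimension cannot be
  a type. All spaces live in the type of finitely supported real sequences, the space of dimension
  \<open>d\<close> being the sequences supported on the first \<open>d\<close> coordinates. Convex hulls, spans, affine
  hulls and \<^const>\<open>dim\<close> are those of the real vector space structure of this type. Its library
  norm is the 1-norm, so the Euclidean norm is defined separately.
\<close>

type_synonym point = "nat \<Rightarrow>\<^sub>0 real"

definition Rd :: "nat \<Rightarrow> point set" where
  "Rd d = {x. Poly_Mapping.keys x \<subseteq> {..<d}}"

definition vec_of :: "nat \<Rightarrow> (nat \<Rightarrow> real) \<Rightarrow> point" where
  "vec_of d f = Abs_poly_mapping (\<lambda>i. if i < d then f i else 0)"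

lemma lookup_vec_of: "Poly_Mapping.lookup (vec_of d f) = (\<lambda>i. if i < d then f i else 0)"
  unfolding vec_of_def
  by (rule Abs_poly_mapping_inverse) (auto intro: finite_subset[of _ "{..<d}"])

lemma vec_of_in_Rd: "vec_of d f \<in> Rd d"
  by (auto simp: Rd_def in_keys_iff lookup_vec_of split: if_splits)

definition enorm :: "point \<Rightarrow> real" where
  "enorm x = L2_set (Poly_Mapping.lookup x) (Poly_Mapping.keys x)"

definition unit_ball :: "nat \<Rightarrow> point set" where
  "unit_ball d = {x \<in> Rd d. enorm x \<le> 1}"

definition affine_dim :: "point set \<Rightarrow> nat" where
  "affine_dim X = dim {x - y | x y. x \<in> affine hull X \<and> y \<in> affine hull X}"


section \<open>Inner and outer radii\<close>

definition sandwiched :: "nat \<Rightarrow> point set \<Rightarrow> point \<Rightarrow> real \<Rightarrow> real \<Rightarrow> bool" where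
  "sandwiched d X c r R \<longleftrightarrow> c \<in> Rd d \<and> 0 \<le> r \<and> 0 \<le> R \<and>
     (\<lambda>x. c + r *\<^sub>R x) ` (unit_ball d \<inter> span ((\<lambda>x. x - c) ` X)) \<subseteq> convex hull X \<and>
     convex hull X \<subseteq> (\<lambda>x. c + R *\<^sub>R x) ` unit_ball d"

text \<open>
  For a single point every \<open>r\<close> is admissible, hence the extended reals: the inner parameter is then
  infinite, and a quotient by it is 0.
\<close>

definition inner_par :: "nat \<Rightarrow> point set \<Rightarrow> ereal" where
  "inner_par d X = Sup {ereal r | r. \<exists>c R. sandwiched d X c r R}"

definition outer_par :: "nat \<Rightarrow> point set \<Rightarrow> ereal" where
  "outer_par d X = Inf {ereal R | R. \<exists>c r. sandwiched d X c r R}"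

definition max_ratio :: "nat \<Rightarrow> (nat \<Rightarrow> point) \<Rightarrow> nat \<Rightarrow> real" where
  "max_ratio d z t = real_of_ereal
     (Max ((\<lambda>t'. outer_par d (z ` {1..t}) / inner_par d (z ` {1..t'})) ` {1..t}))"


section \<open>Real random access machine\<close>

text \<open>
  A program manipulates index registers, holding natural numbers, and an array of cells, holding
  real numbers, addressed indirectly through index expressions. Reals influence indices
  only through branching. In a machine of size \<open>S\<close>, only cells with address below \<open>S\<close> can be
  accessed and a register can only be assigned values up to \<open>S\<close>; as the program names finitely many
  registers, these hold only a constant number of addresses. Execution is stuck
  on a violation, on division by zero and on the square root of a negative number.
  The cost is the number of operations.
\<close>

datatype iexp = INum nat | Dimension | Reg nat
  | IPlus iexp iexp | IMinus iexp iexp | ITimes iexp iexp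

datatype rexp = RNum int | Cell iexp
  | RPlus rexp rexp | RMinus rexp rexp | RTimes rexp rexp | RDivide rexp rexp | RSqrt rexp

datatype bexp = ILess iexp iexp | RLess rexp rexp | Neg bexp | Conj bexp bexp

datatype com = Skip | SetReg nat iexp | SetCell iexp rexp
  | Then com com | Cond bexp com com | Loop bexp com

type_synonym state = "(nat \<Rightarrow> nat) \<times> (nat \<Rightarrow> real)"

primrec ival :: "nat \<Rightarrow> state \<Rightarrow> iexp \<Rightarrow> nat" where
  "ival d s (INum m) = m"
| "ival d s Dimension = d"
| "ival d s (Reg x) = fst s x"
| "ival d s (IPlus a b) = ival d s a + ival d s b"
| "ival d s (IMinus a b) = ival d s a - ival d s b"
| "ival d s (ITimes a b) = ival d s a * ival d s b"

primrec rval :: "nat \<Rightarrow> state \<Rightarrow> rexp \<Rightarrow> real" where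
  "rval d s (RNum m) = of_int m"
| "rval d s (Cell a) = snd s (ival d s a)"
| "rval d s (RPlus e f) = rval d s e + rval d s f"
| "rval d s (RMinus e f) = rval d s e - rval d s f"
| "rval d s (RTimes e f) = rval d s e * rval d s f"
| "rval d s (RDivide e f) = rval d s e / rval d s f"
| "rval d s (RSqrt e) = sqrt (rval d s e)"

primrec rsafe :: "nat \<Rightarrow> nat \<Rightarrow> state \<Rightarrow> rexp \<Rightarrow> bool" where
  "rsafe S d s (RNum m) = True"
| "rsafe S d s (Cell a) = (ival d s a < S)"
| "rsafe S d s (RPlus e f) = (rsafe S d s e \<and> rsafe S d s f)"
| "rsafe S d s (RMinus e f) = (rsafe S d s e \<and> rsafe S d s f)"
| "rsafe S d s (RTimes e f) = (rsafe S d s e \<and> rsafe S d s f)"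
| "rsafe S d s (RDivide e f) = (rsafe S d s e \<and> rsafe S d s f \<and> rval d s f \<noteq> 0)"
| "rsafe S d s (RSqrt e) = (rsafe S d s e \<and> 0 \<le> rval d s e)"

primrec bval :: "nat \<Rightarrow> state \<Rightarrow> bexp \<Rightarrow> bool" where
  "bval d s (ILess a b) = (ival d s a < ival d s b)"
| "bval d s (RLess e f) = (rval d s e < rval d s f)"
| "bval d s (Neg p) = (\<not> bval d s p)"
| "bval d s (Conj p q) = (bval d s p \<and> bval d s q)"

primrec bsafe :: "nat \<Rightarrow> nat \<Rightarrow> state \<Rightarrow> bexp \<Rightarrow> bool" where
  "bsafe S d s (ILess a b) = True"
| "bsafe S d s (RLess e f) = (rsafe S d s e \<and> rsafe S d s f)"
| "bsafe S d s (Neg p) = bsafe S d s p"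
| "bsafe S d s (Conj p q) = (bsafe S d s p \<and> bsafe S d s q)"

primrec icost :: "iexp \<Rightarrow> nat" where
  "icost (INum m) = 1"
| "icost Dimension = 1"
| "icost (Reg x) = 1"
| "icost (IPlus a b) = icost a + icost b + 1"
| "icost (IMinus a b) = icost a + icost b + 1"
| "icost (ITimes a b) = icost a + icost b + 1"

primrec rcost :: "rexp \<Rightarrow> nat" where
  "rcost (RNum m) = 1"
| "rcost (Cell a) = icost a + 1"
| "rcost (RPlus e f) = rcost e + rcost f + 1"
| "rcost (RMinus e f) = rcost e + rcost f + 1"
| "rcost (RTimes e f) = rcost e + rcost f + 1"
| "rcost (RDivide e f) = rcost e + rcost f + 1"
| "rcost (RSqrt e) = rcost e + 1"

primrec bcost :: "bexp \<Rightarrow> nat" where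
  "bcost (ILess a b) = icost a + icost b + 1"
| "bcost (RLess e f) = rcost e + rcost f + 1"
| "bcost (Neg p) = bcost p + 1"
| "bcost (Conj p q) = bcost p + bcost q + 1"

text \<open>
  \<open>exec S d P s k s'\<close>: on a machine of size \<open>S\<close>, in dimension \<open>d\<close>, program \<open>P\<close> started in state \<open>s\<close>
  terminates in state \<open>s'\<close> at cost \<open>k\<close>.
\<close>

inductive exec :: "nat \<Rightarrow> nat \<Rightarrow> com \<Rightarrow> state \<Rightarrow> nat \<Rightarrow> state \<Rightarrow> bool" for S d where
  Skip: "exec S d Skip s 1 s"
| SetReg: "ival d s a \<le> S \<Longrightarrow>
    exec S d (SetReg x a) s (icost a + 1) ((fst s)(x := ival d s a), snd s)"
| SetCell: "ival d s a < S \<Longrightarrow> rsafe S d s e \<Longrightarrow>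
    exec S d (SetCell a e) s (icost a + rcost e + 1) (fst s, (snd s)(ival d s a := rval d s e))"
| Then: "exec S d P s k s' \<Longrightarrow> exec S d Q s' l s'' \<Longrightarrow> exec S d (Then P Q) s (k + l) s''"
| CondTrue: "bsafe S d s p \<Longrightarrow> bval d s p \<Longrightarrow> exec S d P s k s' \<Longrightarrow>
    exec S d (Cond p P Q) s (bcost p + 1 + k) s'"
| CondFalse: "bsafe S d s p \<Longrightarrow> \<not> bval d s p \<Longrightarrow> exec S d Q s k s' \<Longrightarrow>
    exec S d (Cond p P Q) s (bcost p + 1 + k) s'"
| LoopFalse: "bsafe S d s p \<Longrightarrow> \<not> bval d s p \<Longrightarrow> exec S d (Loop p P) s (bcost p + 1) s"
| LoopTrue: "bsafe S d s p \<Longrightarrow> bval d s p \<Longrightarrow> exec S d P s k s' \<Longrightarrow>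
    exec S d (Loop p P) s' l s'' \<Longrightarrow> exec S d (Loop p P) s (bcost p + 1 + k + l) s''"

lemma exec_deterministic:
  "exec S d P s k s' \<Longrightarrow> exec S d P s l s'' \<Longrightarrow> k = l \<and> s' = s''"
proof (induction arbitrary: l s'' rule: exec.induct)
  case (Skip s)
  from Skip.prems show ?case by cases simp
next
  case (SetReg s a x)
  from SetReg.prems show ?case by cases simp
next
  case (SetCell s a e)
  from SetCell.prems show ?case by cases simp
next
  case (Then P s k s' Q m t)
  from Then.prems show ?case
    by cases (use Then.IH in blast)
next
  case (CondTrue s p P k s' Q)
  from CondTrue.prems show ?case
    by cases (use CondTrue.IH CondTrue.hyps in blast)+
next
  case (CondFalse s p Q k s' P)
  from CondFalse.prems show ?case
    by cases (use CondFalse.IH CondFalse.hyps in blast)+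
next
  case (LoopFalse s p P)
  from LoopFalse.prems show ?case
    by cases (use LoopFalse.hyps in blast)+
next
  case (LoopTrue s p P k s' m t)
  from LoopTrue.prems show ?case
    by cases (use LoopTrue.IH LoopTrue.hyps in blast)+
qed


section \<open>Streaming\<close>

text \<open>
  Each arriving point overwrites the first \<open>d\<close> cells, at cost \<open>d\<close>; then the program is run on the
  state left from the previous step. The points are \<open>z 1\<close>, \<open>z 2\<close>, and so on.
  \<open>run S d P z t s T\<close>: after \<open>t\<close> points the state is \<open>s\<close> and the total cost so far is \<open>T\<close>.
\<close>

definition receive :: "nat \<Rightarrow> point \<Rightarrow> state \<Rightarrow> state" where
  "receive d x s = (fst s, \<lambda>i. if i < d then Poly_Mapping.lookup x i else snd s i)"

inductive run :: "nat \<Rightarrow> nat \<Rightarrow> com \<Rightarrow> (nat \<Rightarrow> point) \<Rightarrow> nat \<Rightarrow> state \<Rightarrow> nat \<Rightarrow> bool"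
  for S d P z where
  start: "run S d P z 0 (\<lambda>_. 0, \<lambda>_. 0) 0"
| step: "run S d P z t s T \<Longrightarrow> exec S d P (receive d (z (Suc t)) s) k s' \<Longrightarrow>
    run S d P z (Suc t) s' (T + d + k)"

text \<open>
  The output is read off the cells following the input: \<open>d\<close> cells for the center, one cell for the
  approximation factor, and then, row by row, a \<open>d \<times> d\<close> matrix, possibly singular. The ellipsoid is
  the image of the unit ball under this matrix.
\<close>

definition out_center :: "nat \<Rightarrow> state \<Rightarrow> point" where
  "out_center d s = vec_of d (\<lambda>i. snd s (d + i))"

definition out_factor :: "nat \<Rightarrow> state \<Rightarrow> real" where
  "out_factor d s = snd s (2 * d)"

definition out_ellipsoid :: "nat \<Rightarrow> state \<Rightarrow> point set" where
  "out_ellipsoid d s =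
     (\<lambda>x. vec_of d (\<lambda>i. \<Sum>j<d. snd s (2 * d + 1 + i * d + j) * Poly_Mapping.lookup x j)) ` unit_ball d"

end

theory Submission
  imports Defs
begin

text \<open>
  The algorithm keeps a center \<open>c\<close>, a factor \<open>\<alpha>\<close> and a matrix \<open>A\<close> with
  \<open>c + \<alpha> A B \<subseteq> conv \<subseteq> c + A B\<close> for the unit ball \<open>B\<close>, together with a matrix \<open>N\<close> inverting \<open>A\<close> on its
  range. A new point \<open>c + u\<close> outside \<open>c + A B\<close> replaces \<open>\<alpha>\<close> by \<open>\<alpha> / (1 + 2 \<alpha>)\<close>, that is, \<open>1 / \<alpha>\<close> grows
  by 2, moves the center by \<open>\<alpha> u\<close>, stretches the ellipsoid by \<open>1 + \<alpha> / 4\<close> in all directions and, if \<open>u\<close>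
  is in the range of \<open>A\<close>, by a factor at least 2 in direction \<open>u\<close>; otherwise \<open>u\<close> becomes a
  new axis. Both are rank one updates of \<open>A\<close> and \<open>N\<close>, of cost \<open>O(d\<^sup>2)\<close>.

  Each enlargement within the affine hull at least doubles the volume of the ellipsoid. A dimension
  jump multiplies it by at least the height \<open>\<eta>\<close> of the new point above the old affine hull, and
  \<open>\<eta> \<ge> 2 r\<close> for the inner radius \<open>r\<close> at that time. As the ellipsoid shrunk by \<open>\<alpha>\<close> fits in a ball of
  radius \<open>R\<close>, after \<open>U\<close> enlargements and \<open>k\<close> jumps \<open>2\<^sup>U \<le> (max R / r / (2 \<alpha>))\<^sup>k\<close>, while
  \<open>1 / \<alpha> = 8 + 2 (U + k)\<close>; solving for \<open>1 / \<alpha>\<close> gives the bound.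
\<close>

section \<open>Linear algebra on finitely supported sequences\<close>

text \<open>\<open>N\<close> is kept invertible on the whole space, not only on the range of
  \<open>A\<close>. Hence one product \<open>y = N u\<close> decides everything: \<open>u\<close>
  lies in the range iff \<open>y\<close> is supported on the active columns, it lies in the
  ellipsoid iff moreover \<open>|y| \<le> 1\<close>, and a nonzero coordinate of \<open>y\<close>
  outside them names the column to open. The half axes are chosen for the inner ellipsoid: along
  \<open>u\<close> the new one reaches back exactly to the far pole of the old one, or to the old
  center if \<open>u\<close> is a new axis. The other axes must grow because moving the center would
  cut off part of the old outer ellipsoid. That loss is of order \<open>\<alpha>^2\<close>, so a
  growth of order \<open>\<alpha>\<close> suffices, while the shrinking of \<open>\<alpha>\<close>
  still makes the inner axes shorter. A volume in a subspace of varying dimension is not a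
  determinant of \<open>A\<close>. The factorization replaces it; it occurs in the invariant only
  and is never computed. As the bound on \<open>U\<close> contains \<open>\<alpha>\<close>, which
  itself depends on \<open>U\<close>, the last inequality is implicit and is solved with a tangent
  to the logarithm.\<close>

abbreviation co :: "point \<Rightarrow> nat \<Rightarrow> real" where
  "co \<equiv> Poly_Mapping.lookup"

text \<open>Only the first \<open>d\<close> coordinates count, so this is definite on
  \<open>Rd d\<close> but degenerate on the whole type; hence the \<open>Rd d\<close> hypotheses
  wherever definiteness is used.\<close>

definition ip :: "nat \<Rightarrow> point \<Rightarrow> point \<Rightarrow> real" where
  "ip d x y = (\<Sum>i<d. co x i * co y i)"

text \<open>The result lies in \<open>Rd d\<close> and only coordinates below \<open>d\<close> are
  read, so linearity and the adjoint rule hold for arbitrary arguments.\<close>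

definition app :: "nat \<Rightarrow> (nat \<Rightarrow> nat \<Rightarrow> real) \<Rightarrow> point \<Rightarrow> point" where
  "app d A x = vec_of d (\<lambda>i. \<Sum>j<d. A i j * co x j)"

abbreviation (input) transp :: "(nat \<Rightarrow> nat \<Rightarrow> real) \<Rightarrow> nat \<Rightarrow> nat \<Rightarrow> real" where
  "transp A \<equiv> \<lambda>i j. A j i"

definition unit_vec :: "nat \<Rightarrow> nat \<Rightarrow> point" where
  "unit_vec d k = vec_of d (\<lambda>i. if i = k then 1 else 0)"

lemma co_scaleR [simp]: "co (r *\<^sub>R x) i = r * co x i"
  by (simp add: scaleR_poly_mapping_def)

lemmas co_simps [simp] = lookup_add lookup_minus lookup_uminus lookup_vec_of

lemma Rd_iff: "x \<in> Rd d \<longleftrightarrow> (\<forall>i\<ge>d. co x i = 0)"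
  unfolding Rd_def subset_iff in_keys_iff lessThan_iff mem_Collect_eq by (meson not_le)

lemma Rd_eqI: "x \<in> Rd d \<Longrightarrow> y \<in> Rd d \<Longrightarrow> (\<And>i. i < d \<Longrightarrow> co x i = co y i) \<Longrightarrow> x = y"
  by (rule poly_mapping_eqI) (case_tac "k < d"; simp add: Rd_iff)

lemma subspace_Rd: "subspace (Rd d)"
  by (auto simp: subspace_def Rd_iff)

lemma Rd_closed [simp, intro]:
  "0 \<in> Rd d" "x \<in> Rd d \<Longrightarrow> y \<in> Rd d \<Longrightarrow> x + y \<in> Rd d"
  "x \<in> Rd d \<Longrightarrow> y \<in> Rd d \<Longrightarrow> x - y \<in> Rd d"
  "x \<in> Rd d \<Longrightarrow> r *\<^sub>R x \<in> Rd d" "x \<in> Rd d \<Longrightarrow> - x \<in> Rd d" "vec_of d f \<in> Rd d"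
  "app d A x \<in> Rd d" "unit_vec d k \<in> Rd d"
  by (auto simp: Rd_iff app_def unit_vec_def)

lemma ip_commute: "ip d x y = ip d y x"
  by (simp add: ip_def mult.commute)

lemma ip_simps [simp]:
  "ip d (x + y) v = ip d x v + ip d y v" "ip d v (x + y) = ip d v x + ip d v y"
  "ip d (x - y) v = ip d x v - ip d y v" "ip d v (x - y) = ip d v x - ip d v y"
  "ip d (r *\<^sub>R x) v = r * ip d x v" "ip d v (r *\<^sub>R x) = r * ip d v x"
  "ip d 0 v = 0" "ip d v 0 = 0" "ip d (- x) v = - ip d x v" "ip d v (- x) = - ip d v x"
  by (simp_all add: ip_def algebra_simps sum.distrib sum_subtractf sum_distrib_left sum_negf)

lemma ip_nonneg [simp]: "0 \<le> ip d x x"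
  by (simp add: ip_def sum_nonneg)

lemma ip_eq_0_iff: "x \<in> Rd d \<Longrightarrow> ip d x x = 0 \<longleftrightarrow> x = 0"
  by (auto simp: ip_def sum_nonneg_eq_0_iff intro!: Rd_eqI[of x d 0])

lemma ip_pos: "x \<in> Rd d \<Longrightarrow> x \<noteq> 0 \<Longrightarrow> 0 < ip d x x"
  using ip_nonneg[of d x] ip_eq_0_iff[of x d] by linarith

lemma ip_extensional:
  assumes "x \<in> Rd d" "y \<in> Rd d" "\<And>v. v \<in> Rd d \<Longrightarrow> ip d v x = ip d v y"
  shows "x = y"
proof -
  have "ip d (x - y) (x - y) = 0"
    using assms(3)[of "x - y"] assms(1,2) by (subst ip_simps(4)) (auto simp del: ip_simps)
  then have "x - y = 0"
    using ip_eq_0_iff[of "x - y" d] assms(1,2) by blast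
  then show ?thesis by simp
qed

lemma ip_unit_vec [simp]: "i < d \<Longrightarrow> ip d (unit_vec d i) x = co x i" "i < d \<Longrightarrow> ip d x (unit_vec d i) = co x i"
  by (simp_all add: ip_def unit_vec_def if_distrib if_distribR sum.delta cong: if_cong)

lemma co_unit_vec: "i < d \<Longrightarrow> co (unit_vec d k) i = (if i = k then 1 else 0)"
  by (simp add: unit_vec_def)

lemma enorm_ip: "x \<in> Rd d \<Longrightarrow> enorm x = sqrt (ip d x x)"
  unfolding enorm_def L2_set_def ip_def power2_eq_square
  by (intro arg_cong[of _ _ sqrt] sum.mono_neutral_left) (auto simp: Rd_def in_keys_iff)

lemma unit_ball_ip: "unit_ball d = {x \<in> Rd d. ip d x x \<le> 1}"
  by (auto simp: unit_ball_def enorm_ip)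

lemma ip_Cauchy: "(ip d x y)\<^sup>2 \<le> ip d x x * ip d y y"
  using Cauchy_Schwarz_ineq_sum[of "co x" "co y" "{..<d}"]
  by (simp add: ip_def power2_eq_square)

lemma convex_unit_ball: "convex (unit_ball d)"
proof (rule convexI)
  fix x y :: point and u v :: real
  assume x: "x \<in> unit_ball d" and y: "y \<in> unit_ball d" and uv: "0 \<le> u" "0 \<le> v" "u + v = 1"
  have "ip d x x \<le> 1" "ip d y y \<le> 1"
    using x y by (auto simp: unit_ball_ip)
  then have "(ip d x y)\<^sup>2 \<le> 1\<^sup>2"
    using ip_Cauchy[of d x y] mult_mono[of "ip d x x" 1 "ip d y y" 1] by simp
  then have "ip d x y \<le> 1"
    by (rule power2_le_imp_le) simp
  then have "u * u * ip d x x + 2 * (u * v) * ip d x y + v * v * ip d y y \<le> u * u * 1 + 2 * (u * v) * 1 + v * v * 1"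
    using \<open>ip d x x \<le> 1\<close> \<open>ip d y y \<le> 1\<close> uv by (intro add_mono mult_left_mono) auto
  also have "\<dots> = (u + v)\<^sup>2"
    by (simp add: power2_eq_square algebra_simps)
  finally show "u *\<^sub>R x + v *\<^sub>R y \<in> unit_ball d"
    using x y uv by (auto simp: unit_ball_ip algebra_simps ip_commute[of d y x])
qed

lemma uminus_unit_ball: "x \<in> unit_ball d \<Longrightarrow> - x \<in> unit_ball d"
  by (auto simp: unit_ball_ip)

lemma app_linear:
  "app d A (x + y) = app d A x + app d A y" "app d A (x - y) = app d A x - app d A y"
  "app d A (r *\<^sub>R x) = r *\<^sub>R app d A x"
  "app d A 0 = 0" "app d A (- x) = - app d A x"
proof -
  show "app d A (x + y) = app d A x + app d A y"
    by (rule poly_mapping_eqI) (simp add: app_def distrib_left sum.distrib)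
  show "app d A (x - y) = app d A x - app d A y"
    by (rule poly_mapping_eqI) (simp add: app_def right_diff_distrib sum_subtractf)
  show "app d A (r *\<^sub>R x) = r *\<^sub>R app d A x"
    by (rule poly_mapping_eqI) (simp add: app_def sum_distrib_left mult.left_commute)
  show "app d A 0 = 0"
    by (rule poly_mapping_eqI) (simp add: app_def)
  show "app d A (- x) = - app d A x"
    by (rule poly_mapping_eqI) (simp add: app_def sum_negf)
qed

lemma ip_app: "ip d (app d A x) y = ip d x (app d (transp A) y)"
proof -
  have "ip d (app d A x) y = (\<Sum>i<d. \<Sum>j<d. A i j * co x j * co y i)"
    unfolding ip_def app_def by (intro sum.cong refl) (simp add: sum_distrib_right)
  also have "\<dots> = (\<Sum>j<d. \<Sum>i<d. A i j * co x j * co y i)"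
    by (rule sum.swap)
  also have "\<dots> = (\<Sum>j<d. co x j * (\<Sum>i<d. A i j * co y i))"
    unfolding sum_distrib_left by (intro sum.cong refl) (simp only: mult_ac)
  also have "\<dots> = ip d x (app d (transp A) y)"
    unfolding ip_def app_def by (intro sum.cong refl) simp
  finally show ?thesis .
qed

lemma ip_app': "ip d y (app d A x) = ip d (app d (transp A) y) x"
  by (subst (1 2) ip_commute) (rule ip_app)

lemma app_unit_vec: "j < d \<Longrightarrow> app d A (unit_vec d j) = vec_of d (\<lambda>i. A i j)"
  by (rule Rd_eqI[of _ d])
    (auto simp: app_def unit_vec_def if_distrib[where f = "(*) _"] sum.delta cong: if_cong)

lemma app_expand:
  "app d A x = (\<Sum>j<d. co x j *\<^sub>R vec_of d (\<lambda>i. A i j))"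
proof (rule Rd_eqI[of _ d])
  show "(\<Sum>j<d. co x j *\<^sub>R vec_of d (\<lambda>i. A i j)) \<in> Rd d"
    by (intro subspace_sum[OF subspace_Rd]) auto
  show "co (app d A x) i = co (\<Sum>j<d. co x j *\<^sub>R vec_of d (\<lambda>i. A i j)) i" if "i < d" for i
    using that by (simp add: app_def lookup_sum mult.commute)
qed auto

text \<open>Both updates of the matrix have this shape \<open>b A + u f^T\<close>: \<open>f\<close>
  is \<open>\<kappa> y\<close> for a stretch and \<open>1 + 2 \<alpha>\<close> times a unit vector
  for a new axis. The transposed form below serves the volume.\<close>

lemma app_rank_one:
  assumes "u \<in> Rd d" "\<And>i j. i < d \<Longrightarrow> j < d \<Longrightarrow> B i j = b * A i j + co u i * co f j"
  shows "app d B x = b *\<^sub>R app d A x + ip d f x *\<^sub>R u"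
  using assms
  by (intro Rd_eqI[of _ d])
    (auto simp: app_def ip_def algebra_simps sum.distrib sum_distrib_left)

lemma app_rank_one_transp:
  assumes "f \<in> Rd d" "\<And>i j. i < d \<Longrightarrow> j < d \<Longrightarrow> B i j = b * A i j + co u i * co f j"
  shows "app d (transp B) x = b *\<^sub>R app d (transp A) x + ip d u x *\<^sub>R f"
  using assms by (intro app_rank_one) (auto simp: mult.commute)

lemma in_span_columns:
  assumes "\<And>j. j < d \<Longrightarrow> vec_of d (\<lambda>i. A i j) \<in> span S"
  shows "app d A x \<in> span S"
  unfolding app_expand by (intro span_sum span_scale assms) auto

text \<open>Gram-Schmidt along the list, for existence only. The induction generalizes over
  \<open>u\<close> because the head \<open>b\<close> is itself projected onto the span of the
  tail.\<close>

lemma orthogonal_projection_exists: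
  assumes "set B \<subseteq> Rd d" "u \<in> Rd d"
  shows "\<exists>p\<in>span (set B). \<forall>b\<in>set B. ip d (u - p) b = 0"
  using assms
proof (induction B arbitrary: u)
  case (Cons b B)
  obtain pb where pb: "pb \<in> span (set B)" "\<forall>x\<in>set B. ip d (b - pb) x = 0"
    using Cons.IH[of b] Cons.prems by auto
  obtain pu where pu: "pu \<in> span (set B)" "\<forall>x\<in>set B. ip d (u - pu) x = 0"
    using Cons.IH[of u] Cons.prems by auto
  have sub: "span (set B) \<subseteq> span (set (b # B))"
    by (intro span_mono) auto
  have orth: "ip d v y = 0" if "\<forall>x\<in>set B. ip d v x = 0" "y \<in> span (set B)" for v y
    using that(2)
    by (induction rule: span_induct_alt) (use that(1) in auto)
  have bb: "b - pb \<in> Rd d"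
    using pb(1) Cons.prems(1) span_minimal[OF _ subspace_Rd[of d], of "set B"] by auto
  define th where "th = ip d (u - pu) (b - pb) / ip d (b - pb) (b - pb)"
  define p where "p = pu + th *\<^sub>R (b - pb)"
  have "p \<in> span (set (b # B))"
    unfolding p_def using subsetD[OF sub pu(1)] subsetD[OF sub pb(1)]
    by (intro span_add span_scale span_diff) (auto intro: span_base)
  moreover have "ip d (u - p) x = 0" if "x \<in> set B" for x
    using that pu(2) pb(2) by (simp add: p_def)
  moreover have "ip d (u - p) b = 0"
  proof -
    have 0: "ip d (u - p) pb = 0"
      using calculation(2) pb(1) by (intro orth) auto
    have "ip d (u - p) (b - pb) = 0"
    \<comment> \<open>The list may be linearly dependent; then the residual of \<open>b\<close> is 0
      and the value of \<open>th\<close> is irrelevant.\<close>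
    proof (cases "b - pb = 0")
      case False
      then have "ip d (b - pb) (b - pb) \<noteq> 0"
        using bb ip_eq_0_iff by blast
      then have "th * ip d (b - pb) (b - pb) = ip d (u - pu) (b - pb)"
        by (simp add: th_def)
      moreover have "ip d (u - p) (b - pb) = ip d (u - pu) (b - pb) - th * ip d (b - pb) (b - pb)"
        by (simp add: p_def algebra_simps)
      ultimately show ?thesis by simp
    next
      case True then show ?thesis by (metis ip_simps(8))
    qed
    then show ?thesis
      using 0 by simp
  qed
  ultimately show ?case by auto
qed (auto intro!: bexI[of _ 0])

section \<open>Enlarging the ellipsoid\<close>

lemma quadratic_combination:
  "ip d (p *\<^sub>R g + r *\<^sub>R y) (p *\<^sub>R g + r *\<^sub>R y)
     = p\<^sup>2 * ip d g g + 2 * p * r * ip d y g + r\<^sup>2 * ip d y y"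
  by (simp add: ip_commute[of d g y] power2_eq_square algebra_simps)

text \<open>
  In the coordinates of the old ellipsoid, with first axis in direction of the new point, the new
  ellipsoid has center \<open>\<alpha> \<rho>\<close> and half axes \<open>a\<close>, \<open>b\<close>. A point of the unit ball has coordinate
  \<open>C\<close> on the first axis and norm square \<open>G\<close>.
\<close>

lemma outer_inequality:
  fixes \<alpha> \<rho> C G :: real
  assumes \<alpha>: "0 < \<alpha>" "\<alpha> \<le> 1/8" and \<rho>: "1 < \<rho>" and G: "C\<^sup>2 \<le> G" "G \<le> 1"
    and b: "b = 1 + \<alpha>/4" and a: "a = (1 + 2*\<alpha>) * (\<rho> + 1)"
  shows "(C - \<alpha>*\<rho>)\<^sup>2 / a\<^sup>2 + (G - C\<^sup>2) / b\<^sup>2 \<le> 1"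
proof -
  have b1: "0 < b" "1 \<le> b" "b \<le> 33/32" using \<alpha> by (auto simp: b)
  have bb: "b\<^sup>2 \<le> 33/32 * (33/32)" unfolding power2_eq_square
    using b1 by (intro mult_mono) auto
  have "0 \<le> \<alpha> * \<rho>" using \<alpha> \<rho> by simp
  then have ab: "\<rho> + b \<le> a" using \<alpha> by (simp add: a b algebra_simps)
  have "(\<rho> + b)\<^sup>2 \<le> a\<^sup>2" using ab b1 \<rho> by (intro power_mono) auto
  moreover have "0 \<le> \<rho> * b" using b1 \<rho> by simp
  ultimately have D: "\<rho>\<^sup>2 + b\<^sup>2 \<le> a\<^sup>2"
    by (simp add: power2_eq_square algebra_simps)
  have b2: "\<alpha>/2 \<le> b\<^sup>2 - 1" by (simp add: b power2_eq_square algebra_simps)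
  have "b\<^sup>2 * \<alpha> \<le> 33/32 * (33/32) * (1/8)" using bb \<alpha> by (intro mult_mono) auto
  then have h: "b\<^sup>2 * \<alpha> \<le> 1/2" by simp
  \<comment> \<open>With denominators cleared and \<open>G\<close> replaced by 1 the goal is
    quadratic in \<open>C\<close>. Bounding its leading coefficient by \<open>D\<close> and
    completing the square to \<open>3\<close> leaves exactly \<open>1\<close>: a term of order
    \<open>\<alpha>^2\<close> on the left against \<open>b^2 - 1\<close>, which is of order
    \<open>\<alpha>\<close>.\<close>
  have "(\<rho>\<^sup>2 + b\<^sup>2) * (b\<^sup>2 * \<alpha> * \<alpha>) \<le> (\<rho>\<^sup>2 + b\<^sup>2) * (1/2 * \<alpha>)"
    using h \<alpha> by (intro mult_left_mono mult_right_mono) auto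
  also have "\<dots> \<le> a\<^sup>2 * (b\<^sup>2 - 1)"
    using D b2 \<alpha> by (intro mult_mono) auto
  finally have 1: "(\<rho>\<^sup>2 + b\<^sup>2) * (b\<^sup>2 * \<alpha> * \<alpha>) \<le> a\<^sup>2 * (b\<^sup>2 - 1)" .
  have 2: "(\<rho>\<^sup>2) * C\<^sup>2 \<le> (a\<^sup>2 - b\<^sup>2) * C\<^sup>2"
    using D by (intro mult_right_mono) auto
  have 3: "0 \<le> (\<rho> * C + b\<^sup>2 * \<alpha>)\<^sup>2" by simp
  have "b\<^sup>2 * (C - \<alpha>*\<rho>)\<^sup>2 + a\<^sup>2 * (1 - C\<^sup>2) \<le> a\<^sup>2 * b\<^sup>2"
    using 1 2 3 by (simp add: power2_eq_square algebra_simps)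
  moreover have "a\<^sup>2 * (G - C\<^sup>2) \<le> a\<^sup>2 * (1 - C\<^sup>2)"
    using G by (intro mult_left_mono) auto
  ultimately have "b\<^sup>2 * (C - \<alpha>*\<rho>)\<^sup>2 + a\<^sup>2 * (G - C\<^sup>2) \<le> a\<^sup>2 * b\<^sup>2" by linarith
  moreover have "0 < a" using ab b1 \<rho> by linarith
  ultimately show ?thesis
    using b1 by (simp add: field_simps)
qed

text \<open>The difference \<open>(1 - l (1 + C))^2 - (C - l (1 + C))^2\<close> factors as
  \<open>(1 - 2 l) (1 - C^2)\<close>. The left side is the norm square of a vector with first
  coordinate \<open>C - l (1 + C)\<close> and the other components scaled by
  \<open>\<beta>\<close>.\<close>

lemma inner_inequality:
  fixes C G \<beta> l :: real
  assumes "C\<^sup>2 \<le> G" "G \<le> 1" "0 \<le> l" "l < 1/2" "\<beta>\<^sup>2 \<le> 1 - 2*l"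
  shows "\<beta>\<^sup>2 * (G - C\<^sup>2) + (C - l*(1+C))\<^sup>2 \<le> (1 - l*(1+C))\<^sup>2"
proof -
  have "\<beta>\<^sup>2 * (G - C\<^sup>2) \<le> (1 - 2*l) * (1 - C\<^sup>2)"
    using assms by (intro mult_mono) auto
  then show ?thesis by (simp add: power2_eq_square algebra_simps)
qed

text \<open>\<open>l (1 + C)\<close> will be the weight of the new point in a convex combination; it
  vanishes at the pole \<open>C = -1\<close> facing away from that point.\<close>

lemma weight_bounds:
  fixes C G l :: real
  assumes "C\<^sup>2 \<le> G" "G \<le> 1" "0 \<le> l" "l < 1/2"
  shows "0 \<le> l * (1 + C)" "l * (1 + C) < 1"
proof -
  have "\<bar>C\<bar> \<le> 1" using assms by (simp add: abs_square_le_1[symmetric])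
  then have C: "0 \<le> 1 + C" "1 + C \<le> 2" by auto
  then show "0 \<le> l * (1 + C)" using assms by simp
  have "l * (1 + C) \<le> l * 2" using C assms by (intro mult_left_mono) auto
  then show "l * (1 + C) < 1" using assms by simp
qed

text \<open>\<open>K\<close> stands for the convex hull after the arrival of \<open>c + u\<close>.
  The new inner ellipsoid will be placed in it by writing each of its points as a convex combination
  of \<open>c + u\<close> and a point of the old one.\<close>

locale enlargement =
  fixes d :: nat and A A' :: "nat \<Rightarrow> nat \<Rightarrow> real" and c u :: point and \<alpha> b :: real and K :: "point set"
  assumes \<alpha>: "0 < \<alpha>" "\<alpha> \<le> 1/8"
    and b_def: "b = 1 + \<alpha>/4"
    and K: "convex K" "\<And>x. x \<in> unit_ball d \<Longrightarrow> c + \<alpha> *\<^sub>R app d A x \<in> K" "c + u \<in> K"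
begin

lemma combination_in_K:
  assumes "ip d v v \<le> (1 - l)\<^sup>2" "v \<in> Rd d" "0 \<le> l" "l < 1"
  shows "c + \<alpha> *\<^sub>R app d A v + l *\<^sub>R u \<in> K"
proof -
  define x where "x = (1 / (1 - l)) *\<^sub>R v"
  have "x \<in> unit_ball d"
    using assms by (auto simp: unit_ball_ip x_def power2_eq_square divide_simps)
  then have "(1 - l) *\<^sub>R (c + \<alpha> *\<^sub>R app d A x) + l *\<^sub>R (c + u) \<in> K"
    using K assms(3,4) by (intro convexD) auto
  moreover have eq: "(1 - l) *\<^sub>R app d A x = app d A v"
    unfolding x_def using assms(4) by (simp add: app_linear)
  then have "(1 - l) *\<^sub>R (c + \<alpha> *\<^sub>R app d A x) + l *\<^sub>R (c + u) = c + \<alpha> *\<^sub>R app d A v + l *\<^sub>R u"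
    unfolding eq[symmetric] by (simp add: algebra_simps)
  ultimately show ?thesis by simp
qed

end

text \<open>Here \<open>A' = A (b I + \<kappa> y y^T)\<close>, which scales \<open>y\<close> by
  \<open>a\<close> and its orthogonal complement by \<open>b\<close>. The value of \<open>a\<close>
  makes the inner half axis along \<open>y\<close> equal to \<open>\<alpha> (\<rho> + 1)\<close>:
  from the center \<open>\<alpha> \<rho>\<close> it reaches back exactly to
  \<open>- \<alpha>\<close>, the far pole of the old inner ellipsoid.\<close>

locale stretch = enlargement +
  fixes y :: point and \<rho> a \<kappa> :: real
  assumes y: "y \<in> Rd d" "u = app d A y" and \<rho>: "\<rho>\<^sup>2 = ip d y y" "1 < \<rho>"
    and a_def: "a = (1 + 2*\<alpha>) * (\<rho> + 1)" and \<kappa>_def: "\<kappa> = (a - b) / \<rho>\<^sup>2"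
    and A': "\<And>x. app d A' x = b *\<^sub>R app d A x + (\<kappa> * ip d y x) *\<^sub>R u"
begin

lemma a_eq: "b + \<kappa> * \<rho>\<^sup>2 = a"
  using \<rho>(2) by (simp add: \<kappa>_def)

lemma \<kappa>_eq: "\<kappa> * \<rho>\<^sup>2 = a - b"
  using a_eq by simp

lemma b_pos: "0 < b"
  using \<alpha> by (simp add: b_def)

lemma a_ge: "2 * b \<le> a"
proof -
  have "(1 + 2*\<alpha>) * 2 \<le> a"
    unfolding a_def using \<alpha> \<rho> by (intro mult_left_mono) auto
  then show ?thesis using \<alpha> by (simp add: b_def)
qed

lemma coordinate:
  assumes "x \<in> unit_ball d"
  shows "(ip d y x / \<rho>)\<^sup>2 \<le> ip d x x" "ip d x x \<le> 1"
  using assms ip_Cauchy[of d y x] \<rho>(2) unfolding \<rho>(1)[symmetric]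
  by (auto simp: unit_ball_ip power_divide pos_divide_le_eq mult.commute)

lemma outer_old:
  assumes "x \<in> unit_ball d"
  shows "\<exists>x'\<in>unit_ball d. c + app d A x = (c + \<alpha> *\<^sub>R u) + app d A' x'"
proof
  define C where "C = ip d y x / \<rho>"
  have C: "ip d y x = C * \<rho>" using \<rho> by (simp add: C_def)
  have pos: "0 < a" "0 < \<rho>" "0 < b" using a_ge b_pos \<rho> by auto
  \<comment> \<open>Seen from the new center the point is \<open>A x - \<alpha> u\<close>. Dividing
    \<open>x\<close> by \<open>b\<close> recovers \<open>A x\<close>; \<open>r\<close> solves the
    remaining linear equation for the coefficient of \<open>u\<close>.\<close>
  define r where "r = - (\<alpha> + \<kappa> * (C * \<rho>) / b) / a"
  define x' where "x' = (1/b) *\<^sub>R x + r *\<^sub>R y"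
  have "r * \<rho> = - (\<alpha>*\<rho> + (\<kappa> * \<rho>\<^sup>2) * C / b) / a"
    using pos by (simp add: r_def field_simps power2_eq_square)
  also have "\<dots> = - (\<alpha>*\<rho> + (a - b) * C / b) / a"
    by (simp only: \<kappa>_eq)
  also have "\<dots> = (C - \<alpha>*\<rho>) / a - C / b"
    using pos by (simp add: field_simps)
  finally have r: "r * \<rho> = (C - \<alpha>*\<rho>) / a - C / b" .
  have "ip d x' x' = (1/b)\<^sup>2 * ip d x x + 2 * (1/b) * (r * \<rho>) * C + (r * \<rho>)\<^sup>2"
    unfolding x'_def quadratic_combination by (simp add: C \<rho>(1)[symmetric] power_mult_distrib)
  also have "\<dots> = (C - \<alpha>*\<rho>)\<^sup>2 / a\<^sup>2 + (ip d x x - C\<^sup>2) / b\<^sup>2"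
    using pos unfolding r by (simp add: field_simps power2_eq_square)
  also have "\<dots> \<le> 1"
    using coordinate[OF assms] \<alpha> \<rho> by (intro outer_inequality) (auto simp: b_def a_def C_def)
  finally show "x' \<in> unit_ball d"
    using assms y by (auto simp: unit_ball_ip x'_def)
  have "r * b + \<kappa> * (C * \<rho> / b + r * \<rho>\<^sup>2) = r * (b + \<kappa> * \<rho>\<^sup>2) + \<kappa> * (C * \<rho>) / b"
    by (simp add: algebra_simps)
  also have "\<dots> = - \<alpha>"
    unfolding a_eq using pos by (simp add: r_def)
  finally have eq: "r * b + \<kappa> * (C * \<rho> / b + r * \<rho>\<^sup>2) = - \<alpha>" .
  have "app d A' x' = app d A x + (r * b + \<kappa> * (C * \<rho> / b + r * \<rho>\<^sup>2)) *\<^sub>R u"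
    unfolding A' x'_def using pos
    by (simp add: app_linear y(2)[symmetric] C \<rho>(1)[symmetric] algebra_simps)
  then show "c + app d A x = (c + \<alpha> *\<^sub>R u) + app d A' x'"
    unfolding eq by simp
qed

lemma outer_new: "\<exists>x'\<in>unit_ball d. c + u = (c + \<alpha> *\<^sub>R u) + app d A' x'"
proof
  have pos: "0 < a" "0 < \<rho>" "0 < b" using a_ge b_pos \<rho> by auto
  define x' where "x' = ((1 - \<alpha>) / a) *\<^sub>R y"
  have "0 \<le> \<alpha> * \<rho>" using \<alpha> \<rho> by simp
  then have "(1 - \<alpha>) * \<rho> \<le> a"
    using \<alpha> by (simp add: a_def algebra_simps)
  then have "((1 - \<alpha>) * \<rho> / a)\<^sup>2 \<le> 1"
    using pos \<alpha> by (intro power_le_one) auto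
  then show "x' \<in> unit_ball d"
    using y by (auto simp: unit_ball_ip x'_def \<rho>(1)[symmetric] power2_eq_square field_simps)
  have "app d A' x' = ((1 - \<alpha>) / a * (b + \<kappa> * \<rho>\<^sup>2)) *\<^sub>R u"
    unfolding A' x'_def by (simp add: app_linear y(2)[symmetric] \<rho>(1)[symmetric] algebra_simps)
  also have "\<dots> = (1 - \<alpha>) *\<^sub>R u"
    unfolding a_eq using pos by simp
  finally show "c + u = (c + \<alpha> *\<^sub>R u) + app d A' x'"
    by (simp add: algebra_simps)
qed

lemma inner:
  assumes "x \<in> unit_ball d"
  shows "(c + \<alpha> *\<^sub>R u) + (\<alpha> / (1 + 2*\<alpha>)) *\<^sub>R app d A' x \<in> K"
proof -
  define C where "C = ip d y x / \<rho>"
  have C: "ip d y x = C * \<rho>" using \<rho> by (simp add: C_def)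
  have pos: "0 < a" "0 < \<rho>" "0 < b" using a_ge b_pos \<rho> by auto
  \<comment> \<open>The target has first coordinate
    \<open>\<alpha> \<rho> + \<alpha> (\<rho> + 1) C\<close>. Giving the new point the weight
    \<open>w = l (1 + C)\<close> and the old vector the first coordinate \<open>C - w\<close> turns
    this into \<open>\<alpha> (C - w) + w \<rho>\<close>, which forces \<open>l\<close>. The
    multiple \<open>\<mu>\<close> of \<open>y\<close> then produces the first coordinate
    \<open>C - w\<close>.\<close>
  define l where "l = \<alpha> * \<rho> / (\<rho> - \<alpha>)"
  define \<beta> where "\<beta> = b / (1 + 2*\<alpha>)"
  define \<mu> where "\<mu> = (C - l * (1 + C) - \<beta> * C) / \<rho>"
  have ra: "0 < \<rho> - \<alpha>" using \<alpha> \<rho> by simp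
  have l0: "0 \<le> l" using \<alpha> pos ra by (simp add: l_def)
  have "\<alpha> * \<rho> * 7 \<le> 8 * \<alpha> * (\<rho> - \<alpha>)"
    using mult_left_mono[of "8*\<alpha>" \<rho> \<alpha>] \<alpha> \<rho> by (simp add: algebra_simps)
  then have l1: "l \<le> 8/7 * \<alpha>"
    using ra by (simp add: l_def field_simps)
  \<comment> \<open>In the coefficients of \<open>\<alpha>\<close> this reads
    \<open>1/2 \<le> 12/7\<close>; the bound \<open>\<alpha> \<le> 1/8\<close> absorbs the higher
    powers.\<close>
  have "b\<^sup>2 \<le> (1 + 2*\<alpha>)\<^sup>2 * (1 - 2 * (8/7 * \<alpha>))"
  proof -
    have "\<alpha> * \<alpha> \<le> \<alpha> * (1/8)" "\<alpha> * \<alpha> * \<alpha> \<le> \<alpha> * \<alpha> * (1/8)"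
      using \<alpha> by (intro mult_left_mono; simp)+
    moreover have "b\<^sup>2 = 1 + \<alpha>/2 + \<alpha> * \<alpha> / 16"
      by (simp add: b_def power2_eq_square algebra_simps)
    moreover have "(1 + 2*\<alpha>)\<^sup>2 * (1 - 2 * (8/7 * \<alpha>)) = 1 + 12/7 * \<alpha> - 36/7 * (\<alpha> * \<alpha>) - 64/7 * (\<alpha> * \<alpha> * \<alpha>)"
      by (simp add: power2_eq_square algebra_simps)
    ultimately show ?thesis using \<alpha> by linarith
  qed
  also have "\<dots> \<le> (1 + 2*\<alpha>)\<^sup>2 * (1 - 2 * l)"
    using l1 by (intro mult_left_mono) auto
  finally have \<beta>: "\<beta>\<^sup>2 \<le> 1 - 2 * l"
    using \<alpha> by (simp add: \<beta>_def power_divide field_simps)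
  have l2: "l < 1/2" using l1 \<alpha> by simp
  have w: "0 \<le> l * (1 + C)" "l * (1 + C) < 1"
    using weight_bounds[OF coordinate[OF assms] l0 l2] by (simp_all add: C_def)
  have \<mu>: "\<mu> * \<rho> = C - l * (1 + C) - \<beta> * C"
    using pos by (simp add: \<mu>_def)
  then have sq: "(\<beta> * C + \<mu> * \<rho>)\<^sup>2 = (C - l * (1 + C))\<^sup>2" by simp
  have "ip d (\<beta> *\<^sub>R x + \<mu> *\<^sub>R y) (\<beta> *\<^sub>R x + \<mu> *\<^sub>R y) = \<beta>\<^sup>2 * (ip d x x - C\<^sup>2) + (\<beta> * C + \<mu> * \<rho>)\<^sup>2"
    unfolding quadratic_combination by (simp add: C \<rho>(1)[symmetric] power2_eq_square algebra_simps)
  also have "\<dots> \<le> (1 - l * (1 + C))\<^sup>2"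
    unfolding sq using inner_inequality[OF coordinate[OF assms] l0 l2 \<beta>] by (simp add: C_def)
  finally have "c + \<alpha> *\<^sub>R app d A (\<beta> *\<^sub>R x + \<mu> *\<^sub>R y) + (l * (1 + C)) *\<^sub>R u \<in> K"
    using w assms y by (intro combination_in_K) (auto simp: unit_ball_ip)
  moreover have "\<alpha> * \<mu> + l * (1 + C) = \<alpha> + \<alpha> / (1 + 2*\<alpha>) * (\<kappa> * (C * \<rho>))"
  proof -
    have "(\<alpha> * \<mu> + l * (1 + C)) * \<rho> = \<alpha> * (\<mu> * \<rho>) + l * (1 + C) * \<rho>"
      by (simp add: algebra_simps)
    also have "\<dots> = \<alpha> * (C - \<beta> * C) + l * (\<rho> - \<alpha>) * (1 + C)"
      unfolding \<mu> by (simp add: algebra_simps)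
    also have "l * (\<rho> - \<alpha>) = \<alpha> * \<rho>" using ra by (simp add: l_def)
    also have "\<alpha> * (C - \<beta> * C) + \<alpha> * \<rho> * (1 + C) = \<alpha> * \<rho> + \<alpha> / (1 + 2*\<alpha>) * (a - b) * C"
      using \<alpha> by (simp add: a_def \<beta>_def field_simps)
    also have "\<dots> = (\<alpha> + \<alpha> / (1 + 2*\<alpha>) * (\<kappa> * (C * \<rho>))) * \<rho>"
      unfolding \<kappa>_eq[symmetric] by (simp add: algebra_simps power2_eq_square)
    finally show ?thesis using pos by simp
  qed
  then have "\<alpha> *\<^sub>R app d A (\<beta> *\<^sub>R x + \<mu> *\<^sub>R y) + (l * (1 + C)) *\<^sub>R u
      = \<alpha> *\<^sub>R u + (\<alpha> / (1 + 2*\<alpha>)) *\<^sub>R app d A' x"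
    unfolding A' C by (simp add: app_linear y(2)[symmetric] scaleR_add_right \<beta>_def
        flip: scaleR_add_left add.assoc)
  ultimately show ?thesis
    by (simp add: add.assoc)
qed

end

text \<open>Column \<open>i\<close> is still zero and becomes \<open>(1 + 2 \<alpha>) u\<close>. The
  new inner half axis is thus \<open>\<alpha> u\<close> around the center
  \<open>c + \<alpha> u\<close>, so that its pole is the old center \<open>c\<close>.\<close>

locale extend = enlargement +
  fixes i :: nat
  assumes i: "i < d" "app d A (unit_vec d i) = 0"
    and A': "\<And>x. app d A' x = b *\<^sub>R app d A x + ((1 + 2*\<alpha>) * co x i) *\<^sub>R u"
begin

definition drop_i :: "point \<Rightarrow> point" where
  "drop_i x = x - co x i *\<^sub>R unit_vec d i"

lemma drop_i: "x \<in> Rd d \<Longrightarrow> drop_i x \<in> Rd d" "app d A (drop_i x) = app d A x" "co (drop_i x) i = 0"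
  "ip d (drop_i x) (drop_i x) = ip d x x - (co x i)\<^sup>2"
  using i by (auto simp: drop_i_def app_linear co_unit_vec power2_eq_square)

lemma outer_old:
  assumes "x \<in> unit_ball d"
  shows "\<exists>x'\<in>unit_ball d. c + app d A x = (c + \<alpha> *\<^sub>R u) + app d A' x'"
proof
  have b0: "0 < b" using \<alpha> by (simp add: b_def)
  define s where "s = \<alpha> / (1 + 2*\<alpha>)"
  \<comment> \<open>Coordinate \<open>i\<close> does not affect \<open>A x\<close> and is free: the
    value \<open>- s\<close> produces the shift by \<open>- \<alpha> u\<close>, as
    \<open>s (1 + 2 \<alpha>) = \<alpha>\<close>.\<close>
  define x' where "x' = (1/b) *\<^sub>R drop_i x + (-s) *\<^sub>R unit_vec d i"
  have s: "0 \<le> s" "s \<le> \<alpha>" using \<alpha> by (auto simp: s_def field_simps)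
  have "b\<^sup>2 * (1 - \<alpha>\<^sup>2) \<ge> 1"
  proof -
    have "b\<^sup>2 \<ge> 1 + \<alpha>/2" by (simp add: b_def power2_eq_square algebra_simps)
    moreover have "\<alpha>\<^sup>2 \<le> \<alpha> * (1/8)" "\<alpha>\<^sup>2 \<le> 1"
      using \<alpha> by (auto simp: power2_eq_square intro!: mult_mono mult_le_one)
    ultimately have "b\<^sup>2 * (1 - \<alpha>\<^sup>2) \<ge> (1 + \<alpha>/2) * (1 - \<alpha> * (1/8))"
      using \<alpha> by (intro mult_mono) auto
    moreover have "\<alpha> * \<alpha> \<le> \<alpha> * (1/8)" using \<alpha> by (intro mult_left_mono) auto
    moreover have "(1 + \<alpha>/2) * (1 - \<alpha> * (1/8)) = 1 + 3/8 * \<alpha> - \<alpha> * \<alpha> / 16"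
      by (simp add: field_simps)
    ultimately show ?thesis using \<alpha> by linarith
  qed
  then have bs: "1 / b\<^sup>2 + \<alpha>\<^sup>2 \<le> 1" using b0 by (simp add: field_simps)
  have "ip d (drop_i x) (drop_i x) \<le> 1"
    using assms unfolding drop_i(4) by (auto simp: unit_ball_ip intro: order_trans[of _ "ip d x x"])
  then have "ip d (drop_i x) (drop_i x) / b\<^sup>2 + s\<^sup>2 \<le> 1 / b\<^sup>2 + \<alpha>\<^sup>2"
    using s by (intro add_mono divide_right_mono power_mono) auto
  moreover have "ip d x' x' = ip d (drop_i x) (drop_i x) / b\<^sup>2 + s\<^sup>2"
    unfolding x'_def quadratic_combination using i
    by (simp add: drop_i(3) co_unit_vec power_divide)
  ultimately have "ip d x' x' \<le> 1" using bs by simp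
  then show "x' \<in> unit_ball d"
    using assms by (auto simp: unit_ball_ip x'_def drop_i)
  have "app d A' x' = app d A x - \<alpha> *\<^sub>R u"
    unfolding A' x'_def using i b0 \<alpha>
    by (simp add: app_linear drop_i co_unit_vec s_def)
  then show "c + app d A x = (c + \<alpha> *\<^sub>R u) + app d A' x'" by simp
qed

lemma outer_new: "\<exists>x'\<in>unit_ball d. c + u = (c + \<alpha> *\<^sub>R u) + app d A' x'"
proof
  define x' where "x' = ((1 - \<alpha>) / (1 + 2*\<alpha>)) *\<^sub>R unit_vec d i"
  have "((1 - \<alpha>) / (1 + 2*\<alpha>))\<^sup>2 \<le> 1"
    using \<alpha> by (intro power_le_one) auto
  then show "x' \<in> unit_ball d"
    using i by (auto simp: unit_ball_ip x'_def co_unit_vec power2_eq_square)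
  have "app d A' x' = ((1 + 2*\<alpha>) * ((1 - \<alpha>) / (1 + 2*\<alpha>))) *\<^sub>R u"
    unfolding A' x'_def using i by (simp add: app_linear co_unit_vec)
  also have "\<dots> = (1 - \<alpha>) *\<^sub>R u"
    using \<alpha> by simp
  finally show "c + u = (c + \<alpha> *\<^sub>R u) + app d A' x'"
    by (simp add: algebra_simps)
qed

lemma inner:
  assumes "x \<in> unit_ball d"
  shows "(c + \<alpha> *\<^sub>R u) + (\<alpha> / (1 + 2*\<alpha>)) *\<^sub>R app d A' x \<in> K"
proof -
  define C where "C = co x i"
  define \<beta> where "\<beta> = b / (1 + 2*\<alpha>)"
  have G: "ip d x x \<le> 1" "C\<^sup>2 \<le> ip d x x"
    using assms drop_i(4)[of x] ip_nonneg[of d "drop_i x"] unfolding C_def by (auto simp: unit_ball_ip)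
  \<comment> \<open>The weight of the new point is now \<open>\<alpha> (1 + C)\<close>, so
    \<open>\<alpha>\<close> itself takes the place of \<open>l\<close>.\<close>
  have "b\<^sup>2 \<le> (1 + 2*\<alpha>)\<^sup>2 * (1 - 2*\<alpha>)"
  proof -
    have "\<alpha> * \<alpha> \<le> \<alpha> * (1/8)" "\<alpha> * \<alpha> * \<alpha> \<le> \<alpha> * \<alpha> * (1/8)"
      using \<alpha> by (intro mult_left_mono; simp)+
    moreover have "b\<^sup>2 = 1 + \<alpha>/2 + \<alpha> * \<alpha> / 16"
      by (simp add: b_def power2_eq_square algebra_simps)
    moreover have "(1 + 2*\<alpha>)\<^sup>2 * (1 - 2*\<alpha>) = 1 + 2 * \<alpha> - 4 * (\<alpha> * \<alpha>) - 8 * (\<alpha> * \<alpha> * \<alpha>)"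
      by (simp add: power2_eq_square algebra_simps)
    ultimately show ?thesis using \<alpha> by linarith
  qed
  then have \<beta>: "\<beta>\<^sup>2 \<le> 1 - 2*\<alpha>"
    using \<alpha> by (simp add: \<beta>_def power_divide field_simps)
  have \<alpha>': "0 \<le> \<alpha>" "\<alpha> < 1/2" using \<alpha> by auto
  note w = weight_bounds[OF G(2,1) \<alpha>']
  have "ip d (\<beta> *\<^sub>R drop_i x) (\<beta> *\<^sub>R drop_i x) = \<beta>\<^sup>2 * (ip d x x - C\<^sup>2)"
    unfolding drop_i(4)[of x, folded C_def, symmetric] by (simp add: power2_eq_square)
  also have "\<dots> \<le> (1 - \<alpha> * (1 + C))\<^sup>2"
    using inner_inequality[OF G(2,1) \<alpha>' \<beta>] zero_le_power2[of "C - \<alpha> * (1 + C)"] by linarith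
  finally have "c + \<alpha> *\<^sub>R app d A (\<beta> *\<^sub>R drop_i x) + (\<alpha> * (1 + C)) *\<^sub>R u \<in> K"
    using w assms by (intro combination_in_K) (auto simp: unit_ball_ip drop_i)
  moreover have "\<alpha> *\<^sub>R app d A (\<beta> *\<^sub>R drop_i x) + (\<alpha> * (1 + C)) *\<^sub>R u
      = \<alpha> *\<^sub>R u + (\<alpha> / (1 + 2*\<alpha>)) *\<^sub>R app d A' x"
  proof -
    have "\<alpha> / (1 + 2*\<alpha>) * ((1 + 2*\<alpha>) * C) = \<alpha> * C" using \<alpha> by simp
    then show ?thesis
      unfolding A' C_def[symmetric] using assms
      by (simp only: app_linear drop_i unit_ball_ip mem_Collect_eq \<beta>_def scaleR_add_right scaleR_scaleR)
        (simp add: algebra_simps)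
  qed
  ultimately show ?thesis
    by (simp add: add.assoc)
qed

end

section \<open>Coordinates\<close>

definition coords :: "nat set \<Rightarrow> point set" where
  "coords J = {x. \<forall>i. i \<notin> J \<longrightarrow> co x i = 0}"

definition proj :: "nat \<Rightarrow> nat set \<Rightarrow> point \<Rightarrow> point" where
  "proj d J x = vec_of d (\<lambda>i. if i \<in> J then co x i else 0)"

text \<open>The last clause makes \<open>N\<close> injective on \<open>Rd d\<close>, since
  \<open>N x = 0\<close> forces \<open>x = 0\<close>. So \<open>N\<close> is invertible and carries
  the range of \<open>A\<close> onto \<open>coords J\<close>, and membership of \<open>u\<close> in
  the range can be read off the coordinates of \<open>N u\<close>.\<close>

definition frame :: "nat \<Rightarrow> (nat \<Rightarrow> nat \<Rightarrow> real) \<Rightarrow> (nat \<Rightarrow> nat \<Rightarrow> real) \<Rightarrow> nat set \<Rightarrow> bool" where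
  "frame d A N J \<longleftrightarrow> J \<subseteq> {..<d} \<and> (\<forall>j<d. j \<notin> J \<longrightarrow> app d A (unit_vec d j) = 0) \<and>
     (\<forall>x\<in>coords J. app d N (app d A x) = x) \<and>
     (\<forall>x\<in>Rd d. app d N x \<in> coords J \<longrightarrow> app d A (app d N x) = x)"

lemma frameD:
  assumes "frame d A N J"
  shows "J \<subseteq> {..<d}" "\<And>j. j < d \<Longrightarrow> j \<notin> J \<Longrightarrow> app d A (unit_vec d j) = 0"
    "\<And>x. x \<in> coords J \<Longrightarrow> app d N (app d A x) = x"
    "\<And>x. x \<in> Rd d \<Longrightarrow> app d N x \<in> coords J \<Longrightarrow> app d A (app d N x) = x"
  using assms by (auto simp: frame_def)

lemma subspace_coords: "subspace (coords J)"
  by (auto simp: subspace_def coords_def)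

lemma coords_Rd: "J \<subseteq> {..<d} \<Longrightarrow> x \<in> coords J \<Longrightarrow> x \<in> Rd d"
  by (auto simp: coords_def Rd_iff subset_iff)

lemma proj_coords: "proj d J x \<in> coords J"
  by (auto simp: proj_def coords_def)

lemma ip_proj: "y \<in> coords J \<Longrightarrow> ip d (proj d J x) y = ip d x y"
  by (auto simp: ip_def proj_def coords_def intro!: sum.cong)

lemma app_proj:
  assumes "frame d A N J"
  shows "app d A (proj d J x) = app d A x"
  unfolding app_expand
proof (rule sum.cong)
  fix j assume "j \<in> {..<d}"
  then show "co (proj d J x) j *\<^sub>R vec_of d (\<lambda>i. A i j) = co x j *\<^sub>R vec_of d (\<lambda>i. A i j)"
    using frameD(2)[OF assms, of j] by (cases "j \<in> J") (auto simp: proj_def app_unit_vec)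
qed simp

text \<open>The adjoint of \<open>N A = proj d J\<close>. It provides \<open>n\<close> with
  \<open>A^T n = y\<close>, by which \<open>u = A y\<close> becomes \<open>A A^T n\<close>.\<close>

lemma frame_solve_transp:
  assumes F: "frame d A N J" and y: "y \<in> coords J"
  shows "app d (transp A) (app d (transp N) y) = y"
proof (rule ip_extensional[of _ d])
  show "ip d v (app d (transp A) (app d (transp N) y)) = ip d v y" for v
    unfolding ip_app[symmetric]
    by (subst app_proj[OF F, symmetric]) (simp add: frameD(3)[OF F] proj_coords ip_proj y)
qed (use coords_Rd[OF frameD(1)[OF F] y] in auto)

text \<open>Sherman-Morrison: \<open>A' = A (b I + \<kappa> y y^T)\<close>, and \<open>N'\<close>
  composes \<open>N\<close> with the inverse \<open>(I - (\<kappa> / a) y y^T) / b\<close> of the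
  second factor.\<close>

lemma frame_stretch:
  assumes F: "frame d A N J" and y: "y \<in> coords J" "u = app d A y"
    and b: "0 < b" and a: "a = b + \<kappa> * ip d y y" "0 < a"
    and A': "\<And>x. app d A' x = b *\<^sub>R app d A x + (\<kappa> * ip d y x) *\<^sub>R u"
    and N': "\<And>x. app d N' x = (1/b) *\<^sub>R (app d N x - (\<kappa> / a * ip d y (app d N x)) *\<^sub>R y)"
  shows "frame d A' N' J"
  unfolding frame_def
proof (intro conjI ballI allI impI)
  show "J \<subseteq> {..<d}" by (rule frameD[OF F])
  show "app d A' (unit_vec d j) = 0" if "j < d" "j \<notin> J" for j
    using that frameD(2)[OF F] y(1) by (auto simp: A' coords_def)
next
  fix x assume x: "x \<in> coords J"
  have 1: "app d N (app d A' x) = b *\<^sub>R x + (\<kappa> * ip d y x) *\<^sub>R y"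
    unfolding A' y(2) using x y(1) by (simp add: app_linear frameD(3)[OF F])
  have "ip d y (app d N (app d A' x)) = a * ip d y x"
    unfolding 1 a by (simp add: algebra_simps)
  then have "app d N' (app d A' x) = (1/b) *\<^sub>R (b *\<^sub>R x + (\<kappa> * ip d y x) *\<^sub>R y - (\<kappa> / a * (a * ip d y x)) *\<^sub>R y)"
    unfolding N' 1 by (simp only:)
  also have "\<kappa> / a * (a * ip d y x) = \<kappa> * ip d y x"
    using a(2) by simp
  finally show "app d N' (app d A' x) = x"
    using b by simp
next
  fix x assume x: "x \<in> Rd d" and c: "app d N' x \<in> coords J"
  define s where "s = ip d y (app d N x)"
  have "app d N x = b *\<^sub>R app d N' x + (\<kappa> / a * s) *\<^sub>R y"
    unfolding N' s_def using b by simp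
  then have "app d N x \<in> coords J"
    using c y(1) subspace_coords by (metis subspace_add subspace_scale)
  then have AN: "app d A (app d N x) = x" by (rule frameD(4)[OF F x])
  have "app d A' (app d N' x) = x + (- (\<kappa> / a * s) + \<kappa> * (1/b) * (s - \<kappa> / a * s * ip d y y)) *\<^sub>R u"
    unfolding A' N' s_def[symmetric] using b
    by (simp add: app_linear AN y(2)[symmetric] s_def[symmetric] algebra_simps)
  also have "- (\<kappa> / a * s) + \<kappa> * (1/b) * (s - \<kappa> / a * s * ip d y y) = \<kappa> * s * (a - b - \<kappa> * ip d y y) / (a * b)"
    using b a(2) by (simp add: field_simps)
  also have "\<dots> = 0" unfolding a(1) by simp
  finally show "app d A' (app d N' x) = x" by simp
qed

text \<open>A pivot step \<open>N' = (I - g e_i^T) N / b\<close>, where \<open>g\<close> is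
  determined by \<open>N' u = e_i / \<beta>\<close>, as \<open>A' e_i = \<beta> u\<close> requires.
  Vectors whose image under \<open>N\<close> has coordinate \<open>i\<close> zero are only divided
  by \<open>b\<close>.\<close>

lemma frame_extend:
  assumes F: "frame d A N J" and i: "i < d" "i \<notin> J" and u: "u \<in> Rd d" and y: "y = app d N u" "co y i \<noteq> 0"
    and b: "0 < b" and \<beta>: "0 < \<beta>"
    and A': "\<And>x. app d A' x = b *\<^sub>R app d A x + (\<beta> * co x i) *\<^sub>R u"
    and N': "\<And>x. app d N' x = (1/b) *\<^sub>R (app d N x - co (app d N x) i *\<^sub>R
        ((1 / co y i) *\<^sub>R y - (b / (\<beta> * co y i)) *\<^sub>R unit_vec d i))"
  shows "frame d A' N' (insert i J)"
  unfolding frame_def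
proof (intro conjI ballI allI impI)
  show "insert i J \<subseteq> {..<d}" using frameD(1)[OF F] i by auto
  show "app d A' (unit_vec d j) = 0" if "j < d" "j \<notin> insert i J" for j
    using that frameD(2)[OF F] i by (auto simp: A' co_unit_vec)
next
  define g where "g = (1 / co y i) *\<^sub>R y - (b / (\<beta> * co y i)) *\<^sub>R unit_vec d i"
  note N'' = N'[folded g_def]
  have gy: "co y i *\<^sub>R g = y - (b / \<beta>) *\<^sub>R unit_vec d i"
    using y(2) by (simp add: g_def scaleR_diff_right)
  {
    fix x assume x: "x \<in> coords (insert i J)"
    define x0 where "x0 = x - co x i *\<^sub>R unit_vec d i"
    have x0: "x0 \<in> coords J"
      using x i by (auto simp: x0_def coords_def unit_vec_def)
    have "app d A x = app d A x0"
      using frameD(2)[OF F i] by (simp add: x0_def app_linear)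
    then have 1: "app d N (app d A' x) = b *\<^sub>R x0 + (\<beta> * co x i) *\<^sub>R y"
      unfolding A' y(1) by (simp add: app_linear frameD(3)[OF F x0])
    have 2: "co (app d N (app d A' x)) i = (\<beta> * co x i) * co y i"
      unfolding 1 using x0 i by (simp add: coords_def)
    have "app d N' (app d A' x) = (1/b) *\<^sub>R (b *\<^sub>R x0 + (\<beta> * co x i) *\<^sub>R (y - co y i *\<^sub>R g))"
      unfolding N'' 2 unfolding 1 by (simp add: algebra_simps)
    also have "\<dots> = x0 + co x i *\<^sub>R unit_vec d i"
      unfolding gy using b \<beta> by (simp add: scaleR_add_right)
    finally show "app d N' (app d A' x) = x"
      by (simp add: x0_def)
  }
  fix x assume x: "x \<in> Rd d" and c: "app d N' x \<in> coords (insert i J)"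
  define \<xi> where "\<xi> = co (app d N x) i"
  \<comment> \<open>Subtracting a multiple of \<open>u\<close> clears coordinate \<open>i\<close> of
    \<open>N x\<close>, which reduces the range test for the new matrix to that for the old
    one.\<close>
  define x' where "x' = x - (\<xi> / co y i) *\<^sub>R u"
  have N'x: "app d N' x = (1/b) *\<^sub>R (app d N x - \<xi> *\<^sub>R g)"
    unfolding N'' \<xi>_def ..
  have Nx': "app d N x' = app d N x - (\<xi> / co y i) *\<^sub>R y"
    by (simp add: x'_def app_linear y(1))
  have "app d N x' \<in> coords J"
    unfolding coords_def
  proof (intro CollectI allI impI)
    fix l assume l: "l \<notin> J"
    show "co (app d N x') l = 0"
    proof (cases "l = i")
      case False
      then have "co (app d N' x) l = 0" using c l by (auto simp: coords_def)
      then show ?thesis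
        using False b unfolding N'x Nx' by (simp add: g_def unit_vec_def)
    qed (use y(2) in \<open>simp add: Nx' \<xi>_def\<close>)
  qed
  moreover have "x' \<in> Rd d" using x u by (simp add: x'_def)
  ultimately have AN: "app d A (app d N x') = x'" by (simp add: frameD(4)[OF F])
  have "app d A' (app d N' x) = app d A (app d N x - \<xi> *\<^sub>R g) + (\<beta> / b * (\<xi> - \<xi> * co g i)) *\<^sub>R u"
    unfolding A' N'x using b by (simp add: app_linear \<xi>_def[symmetric])
  also have "app d A (app d N x - \<xi> *\<^sub>R g) = app d A (app d N x')"
    unfolding Nx' g_def using frameD(2)[OF F i] by (simp add: app_linear)
  also have "\<beta> / b * (\<xi> - \<xi> * co g i) = \<xi> / co y i"
    using b \<beta> y(2) i by (simp add: g_def co_unit_vec field_simps)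
  finally show "app d A' (app d N' x) = x"
    unfolding AN by (simp add: x'_def)
qed

section \<open>The volume potential\<close>

text \<open>
  A list \<open>L\<close> of triples \<open>(q, m, \<eta>)\<close>, latest first, is a triangular factorization of the ellipsoid:
  the \<open>m\<close> span the same ellipsoid as the columns of the matrix, and each unit vector \<open>q\<close> is orthogonal
  to all earlier \<open>m\<close>, so that the product of the \<open>\<langle>q, m\<rangle>\<close> is the volume. The number \<open>\<eta>\<close> is the height
  of the point that opened the dimension.
\<close>

type_synonym factorization = "(point \<times> point \<times> real) list"

fun triangular :: "nat \<Rightarrow> factorization \<Rightarrow> bool" where
  "triangular d [] = True"
| "triangular d ((q, m, \<eta>) # L) = (q \<in> Rd d \<and> m \<in> Rd d \<and> ip d q q = 1 \<and> 0 < ip d q m \<and> 0 < \<eta> \<and>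
     (\<forall>(q', m', \<eta>')\<in>set L. ip d q m' = 0) \<and> triangular d L)"

fun gram :: "nat \<Rightarrow> factorization \<Rightarrow> point \<Rightarrow> point \<Rightarrow> real" where
  "gram d [] x y = 0"
| "gram d ((q, m, \<eta>) # L) x y = ip d x m * ip d y m + gram d L x y"

fun vol :: "nat \<Rightarrow> factorization \<Rightarrow> real" where
  "vol d [] = 1"
| "vol d ((q, m, \<eta>) # L) = ip d q m * vol d L"

fun heights :: "factorization \<Rightarrow> real" where
  "heights [] = 1"
| "heights ((q, m, \<eta>) # L) = \<eta> * heights L"

fun comb :: "factorization \<Rightarrow> real list \<Rightarrow> point" where
  "comb ((q, m, \<eta>) # L) (w # ws) = w *\<^sub>R m + comb L ws"
| "comb _ _ = 0"

text \<open>The part of the list that stretching leaves alone: only the vectors \<open>m\<close>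
  move, so the heights and the radius bounds attached to them persist.\<close>

abbreviation labels :: "factorization \<Rightarrow> (point \<times> real) list" where
  "labels L \<equiv> map (\<lambda>(q, m, \<eta>). (q, \<eta>)) L"

lemma comb_Rd: "triangular d L \<Longrightarrow> comb L ws \<in> Rd d"
  by (induction L ws rule: comb.induct) auto

lemma comb_orthogonal: "(\<forall>(q', m', \<eta>')\<in>set L. ip d q m' = 0) \<Longrightarrow> ip d q (comb L ws) = 0"
  by (induction L ws rule: comb.induct) auto

lemma vol_pos: "triangular d L \<Longrightarrow> 0 < vol d L"
  by (induction L rule: heights.induct) auto

lemma heights_pos: "triangular d L \<Longrightarrow> 0 < heights L"
  by (induction L rule: heights.induct) auto

lemma gram_nonneg: "0 \<le> gram d L x x"
  by (induction L rule: heights.induct) auto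

lemma gram_ge: "(q, m, \<eta>) \<in> set L \<Longrightarrow> (ip d x m)\<^sup>2 \<le> gram d L x x"
proof (induction L)
  case (Cons e L)
  obtain q' m' \<eta>' where e: "e = (q', m', \<eta>')" by (cases e)
  show ?case
  proof (cases "e = (q, m, \<eta>)")
    case True
    then show ?thesis using e gram_nonneg[of d L x] by (simp add: power2_eq_square)
  next
    case False
    then have "(ip d x m)\<^sup>2 \<le> gram d L x x" using Cons by auto
    then show ?thesis unfolding e gram.simps using zero_le_square[of "ip d x m'"] by linarith
  qed
qed simp

lemma heights_eq: "heights L = prod_list (map snd (labels L))"
  by (induction L rule: heights.induct) auto

lemma heights_labels: "labels L = labels L' \<Longrightarrow> heights L = heights L'"
  by (simp only: heights_eq)

lemma triangular_entry: "triangular d L \<Longrightarrow> (q, m, \<eta>) \<in> set L \<Longrightarrow> q \<in> Rd d \<and> ip d q q = 1 \<and> 0 < ip d q m \<and> 0 < \<eta>"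
  by (induction L rule: heights.induct) auto

text \<open>
  The rank one update of a triangular factorization: completing the square in the last coordinate
  leaves a rank one update of the remaining factorization by the smaller multiple
  \<open>\<sigma> / (1 + \<sigma> w\<^sup>2)\<close>.
\<close>

lemma triangular_rank_one:
  assumes "triangular d L" "0 \<le> \<sigma>" "length ws = length L"
  shows "\<exists>L'. triangular d L' \<and> labels L' = labels L \<and>
    (\<forall>x y. gram d L' x y = gram d L x y + \<sigma> * ip d x (comb L ws) * ip d y (comb L ws)) \<and>
    vol d L' = sqrt (1 + \<sigma> * (\<Sum>w\<leftarrow>ws. w\<^sup>2)) * vol d L \<and>
    (\<forall>x. (\<forall>(q, m, \<eta>)\<in>set L. ip d x m = 0) \<longrightarrow> (\<forall>(q, m, \<eta>)\<in>set L'. ip d x m = 0))"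
  using assms
proof (induction L arbitrary: \<sigma> ws rule: heights.induct)
  case 1
  then show ?case by (intro exI[of _ "[]"]) auto
next
  case (2 q m \<eta> L)
  obtain w ws' where ws: "ws = w # ws'" "length ws' = length L"
    using 2(4) by (cases ws) auto
  define v where "v = comb L ws'"
  define p where "p = 1 + \<sigma> * w\<^sup>2"
  have p: "0 < p" using 2(3) by (simp add: p_def add_pos_nonneg)
  have "\<exists>L'. triangular d L' \<and> labels L' = labels L \<and>
    (\<forall>x y. gram d L' x y = gram d L x y + \<sigma> / p * ip d x v * ip d y v) \<and>
    vol d L' = sqrt (1 + \<sigma> / p * (\<Sum>w\<leftarrow>ws'. w\<^sup>2)) * vol d L \<and>
    (\<forall>x. (\<forall>(q, m, \<eta>)\<in>set L. ip d x m = 0) \<longrightarrow> (\<forall>(q, m, \<eta>)\<in>set L'. ip d x m = 0))"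
    unfolding v_def using 2 ws p by (intro "2.IH") auto
  then obtain L' where L': "triangular d L'" "labels L' = labels L"
    "\<And>x y. gram d L' x y = gram d L x y + \<sigma> / p * ip d x v * ip d y v"
    "vol d L' = sqrt (1 + \<sigma> / p * (\<Sum>w\<leftarrow>ws'. w\<^sup>2)) * vol d L"
    "\<And>x. (\<forall>(q, m, \<eta>)\<in>set L. ip d x m = 0) \<Longrightarrow> (\<forall>(q, m, \<eta>)\<in>set L'. ip d x m = 0)"
    by blast
  \<comment> \<open>Chosen so that \<open>m' m'^T + (\<sigma> / p) v v^T = m m^T + \<sigma> (w m +
    v) (w m + v)^T\<close>. As \<open>q\<close> is orthogonal to \<open>v\<close>, the diagonal
    entry gains the factor \<open>sqrt p\<close>; multiplied over the list these factors give the
    matrix determinant lemma.\<close>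
  define m' where "m' = sqrt p *\<^sub>R (m + (\<sigma> * w / p) *\<^sub>R v)"
  have v: "v \<in> Rd d" unfolding v_def using 2(2) by (intro comb_Rd) auto
  have qv: "ip d q v = 0" unfolding v_def using 2(2) by (intro comb_orthogonal) auto
  show ?case
  proof (intro exI[of _ "(q, m', \<eta>) # L'"] conjI allI impI)
    show "triangular d ((q, m', \<eta>) # L')"
      using 2(2) L'(1) L'(5)[of q] v qv p by (auto simp: m'_def)
    show "labels ((q, m', \<eta>) # L') = labels ((q, m, \<eta>) # L)"
      using L'(2) by simp
    show "gram d ((q, m', \<eta>) # L') x y = gram d ((q, m, \<eta>) # L) x y +
        \<sigma> * ip d x (comb ((q, m, \<eta>) # L) ws) * ip d y (comb ((q, m, \<eta>) # L) ws)" for x y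
    proof -
      have "ip d x m' * ip d y m' = (sqrt p * sqrt p) * ((ip d x m + \<sigma> * w / p * ip d x v) * (ip d y m + \<sigma> * w / p * ip d y v))"
        by (simp add: m'_def)
      also have "sqrt p * sqrt p = p" using p by simp
      also have "p * ((ip d x m + \<sigma> * w / p * ip d x v) * (ip d y m + \<sigma> * w / p * ip d y v)) + \<sigma> / p * ip d x v * ip d y v
          = p * ip d x m * ip d y m + \<sigma> * w * (ip d x m * ip d y v + ip d x v * ip d y m) + (\<sigma> * (1 + \<sigma> * w\<^sup>2)) / p * ip d x v * ip d y v"
        using p by (simp add: field_simps power2_eq_square)
      also have "(\<sigma> * (1 + \<sigma> * w\<^sup>2)) / p = \<sigma>"
        using p by (simp add: p_def)
      finally show ?thesis
        using ws L'(3) by (simp add: v_def[symmetric]) (simp add: p_def power2_eq_square algebra_simps)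
    qed
    show "vol d ((q, m', \<eta>) # L') = sqrt (1 + \<sigma> * (\<Sum>w\<leftarrow>ws. w\<^sup>2)) * vol d ((q, m, \<eta>) # L)"
    proof -
      have "vol d ((q, m', \<eta>) # L') = sqrt (p * (1 + \<sigma> / p * (\<Sum>w\<leftarrow>ws'. w\<^sup>2))) * vol d ((q, m, \<eta>) # L)"
        using L'(4) qv by (simp add: m'_def real_sqrt_mult)
      also have "p * (1 + \<sigma> / p * (\<Sum>w\<leftarrow>ws'. w\<^sup>2)) = 1 + \<sigma> * (\<Sum>w\<leftarrow>ws. w\<^sup>2)"
        using p ws by (simp add: field_simps p_def)
      finally show ?thesis .
    qed
    \<comment> \<open>Needed by the induction itself: a \<open>q\<close> further out must stay
      orthogonal to the updated vectors.\<close>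
    show "\<forall>(q', m'', \<eta>')\<in>set ((q, m', \<eta>) # L'). ip d x m'' = 0"
      if "\<forall>(q', m'', \<eta>')\<in>set ((q, m, \<eta>) # L). ip d x m'' = 0" for x
      using that L'(5)[of x] comb_orthogonal[of L d x ws'] by (auto simp: m'_def v_def)
  qed
qed

abbreviation scale_factors :: "real \<Rightarrow> factorization \<Rightarrow> factorization" where
  "scale_factors b L \<equiv> map (\<lambda>(q, m, \<eta>). (q, b *\<^sub>R m, \<eta>)) L"

lemma scale_factors:
  assumes "0 < b"
  shows "triangular d L \<Longrightarrow> triangular d (scale_factors b L)"
    "gram d (scale_factors b L) x y = b\<^sup>2 * gram d L x y"
    "vol d (scale_factors b L) = b ^ length L * vol d L"
    "heights (scale_factors b L) = heights L"
    "labels (scale_factors b L) = labels L"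
  by (induction L rule: heights.induct) (use assms in \<open>auto simp: power2_eq_square algebra_simps\<close>)

text \<open>For the weights \<open>\<langle>n, m\<rangle>\<close> the combination is
  \<open>M M^T n\<close>, and the sum of squares is \<open>n^T M M^T n\<close>.\<close>

lemma gram_map_weights:
  "ip d x (comb L (map (\<lambda>(q, m, \<eta>). ip d n m) L)) = gram d L x n"
  "(\<Sum>w\<leftarrow>map (\<lambda>(q, m, \<eta>). ip d n m) L. w\<^sup>2) = gram d L n n"
  by (induction L rule: heights.induct) (auto simp: power2_eq_square)

definition factors :: "nat \<Rightarrow> (nat \<Rightarrow> nat \<Rightarrow> real) \<Rightarrow> factorization \<Rightarrow> bool" where
  "factors d A L \<longleftrightarrow> triangular d L \<and>
     (\<forall>x y. gram d L x y = ip d (app d (transp A) x) (app d (transp A) y))"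

text \<open>\<open>A' A'^T = b^2 (A A^T + \<sigma> u u^T)\<close> and
  \<open>1 + \<sigma> |y|^2 = (a / b)^2\<close>. So \<open>triangular_rank_one\<close> multiplies
  the volume by \<open>a / b\<close>, which is at least 2, and the scaling by \<open>b\<close>
  cannot decrease it.\<close>

lemma factors_stretch:
  assumes F: "frame d A N J" and L: "factors d A L" and y: "y \<in> coords J" "u = app d A y" "0 < ip d y y"
    and b: "1 \<le> b" and a: "a = b + \<kappa> * ip d y y" "2 * b \<le> a"
    and A': "\<And>x. app d (transp A') x = b *\<^sub>R app d (transp A) x + (\<kappa> * ip d u x) *\<^sub>R y"
  shows "\<exists>L'. factors d A' L' \<and> labels L' = labels L \<and> 2 * vol d L \<le> vol d L'"
proof -
  define n where "n = app d (transp N) y"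
  define ws where "ws = map (\<lambda>(q, m, \<eta>). ip d n m) L"
  define \<sigma> where "\<sigma> = (a\<^sup>2 - b\<^sup>2) / (b\<^sup>2 * ip d y y)"
  have tri: "triangular d L" and gram: "gram d L x y = ip d (app d (transp A) x) (app d (transp A) y)" for x y
    using L by (auto simp: factors_def)
  have n: "app d (transp A) n = y"
    unfolding n_def by (rule frame_solve_transp[OF F y(1)])
  \<comment> \<open>\<open>u = A y = A A^T n = M M^T n\<close>, which is where the weights come
    from.\<close>
  have u: "comb L ws = u"
  proof (rule ip_extensional[of _ d])
    show "comb L ws \<in> Rd d" using comb_Rd[OF tri] .
    show "u \<in> Rd d" using y by simp
    show "ip d v (comb L ws) = ip d v u" for v
      unfolding ws_def gram_map_weights gram n y(2) by (rule ip_app'[symmetric])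
  qed
  have sq: "(\<Sum>w\<leftarrow>ws. w\<^sup>2) = ip d y y"
    unfolding ws_def gram_map_weights gram n ..
  have ab: "b\<^sup>2 \<le> a\<^sup>2" using a b by (intro power_mono) auto
  then have \<sigma>: "0 \<le> \<sigma>" using b y by (simp add: \<sigma>_def)
  obtain L' where L': "triangular d L'" "labels L' = labels L"
    "\<And>x y. gram d L' x y = gram d L x y + \<sigma> * ip d x u * ip d y u"
    "vol d L' = sqrt (1 + \<sigma> * ip d y y) * vol d L"
    using triangular_rank_one[OF tri \<sigma>, of ws] unfolding u sq by (auto simp: ws_def)
  have "1 + \<sigma> * ip d y y = (a / b)\<^sup>2"
    using b y by (simp add: \<sigma>_def field_simps)
  then have vol: "vol d L' = a / b * vol d L"
    using L'(4) a b by simp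
  have b0: "0 < b" using b by simp
  have sig: "b\<^sup>2 * \<sigma> = \<kappa> * (2 * b + \<kappa> * ip d y y)"
    unfolding \<sigma>_def a using b y by (simp add: field_simps power2_eq_square)
  have "factors d A' (scale_factors b L')"
    unfolding factors_def
  proof (intro conjI allI)
    show "triangular d (scale_factors b L')" by (rule scale_factors(1)[OF b0 L'(1)])
    fix x x' :: point
    have yA: "ip d (app d (transp A) x) y = ip d u x" for x
      unfolding y(2) by (metis ip_app ip_commute)
    have yA': "ip d y (app d (transp A) x) = ip d u x" for x
      using yA ip_commute by metis
    have "ip d (app d (transp A') x) (app d (transp A') x') =
        b\<^sup>2 * ip d (app d (transp A) x) (app d (transp A) x') + (\<kappa> * (2 * b + \<kappa> * ip d y y)) * (ip d u x * ip d u x')"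
      unfolding A' by (simp add: yA yA' power2_eq_square algebra_simps)
    also have "\<dots> = gram d (scale_factors b L') x x'"
      unfolding scale_factors(2)[OF b0] L'(3) gram sig[symmetric]
      by (simp add: algebra_simps ip_commute[of d _ u])
    finally show "gram d (scale_factors b L') x x' = ip d (app d (transp A') x) (app d (transp A') x')" ..
  qed
  moreover have "2 * vol d L \<le> vol d (scale_factors b L')"
  proof -
    have "1 * (2 * vol d L) \<le> b ^ length L' * (a / b * vol d L)"
      using a(2) b vol_pos[OF tri] by (intro mult_mono mult_right_mono) (auto simp: field_simps)
    then show ?thesis
      unfolding scale_factors(3)[OF b0] vol by simp
  qed
  moreover have "labels (scale_factors b L') = labels L"
    using L'(2) by (simp only: scale_factors(5)[OF b0])
  ultimately show ?thesis by blast
qed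

text \<open>\<open>q\<close> is orthogonal to the range of \<open>A\<close>, hence to all entries of
  \<open>L\<close>, so \<open>\<beta> u\<close> is a legitimate next column with diagonal entry
  \<open>\<beta> \<langle>q, u\<rangle>\<close>; the height recorded is
  \<open>\<langle>q, u\<rangle>\<close> itself.\<close>

lemma factors_extend:
  assumes L: "factors d A L" and i: "i < d" "app d A (unit_vec d i) = 0"
    and u: "u \<in> Rd d" and q: "q \<in> Rd d" "ip d q q = 1" "app d (transp A) q = 0" "0 < ip d q u"
    and b: "1 \<le> b" and \<beta>: "1 \<le> \<beta>"
    and A': "\<And>x. app d (transp A') x = b *\<^sub>R app d (transp A) x + (\<beta> * ip d u x) *\<^sub>R unit_vec d i"
  defines "L' \<equiv> (q, \<beta> *\<^sub>R u, ip d q u) # scale_factors b L"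
  shows "factors d A' L'" "ip d q u * vol d L \<le> vol d L'"
proof -
  have tri: "triangular d L" and gram: "gram d L x y = ip d (app d (transp A) x) (app d (transp A) y)" for x y
    using L by (auto simp: factors_def)
  have b0: "0 < b" using b by simp
  \<comment> \<open>\<open>gram d L q q\<close> is the norm square of \<open>A^T q = 0\<close>, and
    it dominates each single square.\<close>
  have "ip d q m = 0" if "(q', m, \<eta>) \<in> set L" for q' m \<eta>
    using gram_ge[OF that, of d q] unfolding gram q(3) by simp
  then have "triangular d L'"
    using scale_factors(1)[OF b0 tri] u q \<beta> by (auto simp: L'_def)
  moreover have "gram d L' x y = ip d (app d (transp A') x) (app d (transp A') y)" for x y
  proof -
    \<comment> \<open>Column \<open>i\<close> of \<open>A\<close> is zero, so the cross terms with
      the new axis vanish.\<close>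
    have 0: "co (app d (transp A) x) i = 0" for x
      unfolding ip_unit_vec(2)[OF i(1), symmetric] ip_app'[symmetric] i(2) by simp
    show ?thesis
      using i(1) by (simp add: L'_def scale_factors(2)[OF b0] gram A' 0 co_unit_vec power2_eq_square ip_commute[of d _ u])
  qed
  ultimately show "factors d A' L'" by (simp add: factors_def)
  have "1 * (1 * (ip d q u * vol d L)) \<le> b ^ length L * (\<beta> * (ip d q u * vol d L))"
    using b \<beta> q(4) vol_pos[OF tri] by (intro mult_mono) auto
  then show "ip d q u * vol d L \<le> vol d L'"
    by (simp add: L'_def scale_factors(3)[OF b0] mult_ac)
qed

section \<open>Radii and affine dimension\<close>

text \<open>The direction space of the affine hull, generated by differences so that it does not
  depend on a center.\<close>

definition directions :: "point set \<Rightarrow> point set" where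
  "directions X = span {x - y | x y. x \<in> X \<and> y \<in> X}"

lemma subspace_directions: "subspace (directions X)"
  by (simp add: directions_def)

lemma affine_hull_diff:
  assumes "x \<in> affine hull X" "y \<in> affine hull X"
  shows "x - y \<in> directions X"
proof -
  obtain x0 where x0: "x0 \<in> X" using assms(1) by (cases "X = {}") auto
  have "affine hull X \<subseteq> {x. x - x0 \<in> directions X}"
  proof (rule hull_minimal)
    show "X \<subseteq> {x. x - x0 \<in> directions X}"
      using x0 by (auto simp: directions_def intro!: span_base)
    show "affine {x. x - x0 \<in> directions X}"
      unfolding affine_def
    proof (intro ballI allI impI CollectI)
      fix x y :: point and u v :: real
      assume "x \<in> {x. x - x0 \<in> directions X}" "y \<in> {x. x - x0 \<in> directions X}" and uv: "u + v = 1"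
      then have "u *\<^sub>R (x - x0) + v *\<^sub>R (y - x0) \<in> directions X"
        using subspace_directions by (auto intro!: subspace_add subspace_scale)
      also have "u *\<^sub>R (x - x0) + v *\<^sub>R (y - x0) = u *\<^sub>R x + v *\<^sub>R y - (u + v) *\<^sub>R x0"
        by (simp add: algebra_simps)
      finally show "u *\<^sub>R x + v *\<^sub>R y - x0 \<in> directions X" using uv by simp
    qed
  qed
  then have "x - x0 \<in> directions X" "y - x0 \<in> directions X"
    using assms by auto
  then have "(x - x0) - (y - x0) \<in> directions X"
    by (rule subspace_diff[OF subspace_directions])
  then show ?thesis by simp
qed

lemma convex_hull_diff:
  "x \<in> convex hull X \<Longrightarrow> y \<in> convex hull X \<Longrightarrow> x - y \<in> directions X"
  using affine_hull_diff convex_hull_subset_affine_hull by blast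

text \<open>The span on the right can be larger, when \<open>c\<close> lies off the affine hull.
  This inclusion is what gives access to the inner ball of a competitor with arbitrary
  center.\<close>

lemma directions_subset: "directions X \<subseteq> span ((\<lambda>x. x - c) ` X)"
  unfolding directions_def
proof (intro span_minimal subspace_span subsetI)
  fix v assume "v \<in> {x - y |x y. x \<in> X \<and> y \<in> X}"
  then obtain x y where v: "v = (x - c) - (y - c)" "x \<in> X" "y \<in> X" by auto
  then show "v \<in> span ((\<lambda>x. x - c) ` X)" unfolding v(1) by (intro span_diff span_base imageI)
qed

lemma unit_ball_ip_le:
  assumes "q \<in> unit_ball d" "x \<in> unit_ball d"
  shows "ip d q x \<le> 1"
proof -
  have "ip d q q * ip d x x \<le> 1 * 1"
    using assms by (intro mult_mono) (auto simp: unit_ball_ip)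
  then have "(ip d q x)\<^sup>2 \<le> 1\<^sup>2" using ip_Cauchy[of d q x] by simp
  then show ?thesis by (rule power2_le_imp_le) simp
qed

lemma sandwiched_chord:
  assumes "sandwiched d X c r R" "q \<in> unit_ball d" "q \<in> directions X"
  shows "\<exists>x\<in>convex hull X. \<exists>y\<in>convex hull X. x - y = (2 * r) *\<^sub>R q"
proof -
  have "q \<in> span ((\<lambda>x. x - c) ` X)" "- q \<in> span ((\<lambda>x. x - c) ` X)"
    using assms(3) directions_subset[of X c] by (auto intro: span_neg)
  then have "q \<in> unit_ball d \<inter> span ((\<lambda>x. x - c) ` X)" "- q \<in> unit_ball d \<inter> span ((\<lambda>x. x - c) ` X)"
    using assms(2) uminus_unit_ball by auto
  moreover have "\<And>x. x \<in> unit_ball d \<inter> span ((\<lambda>x. x - c) ` X) \<Longrightarrow> c + r *\<^sub>R x \<in> convex hull X"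
    using assms(1) unfolding sandwiched_def image_subset_iff by meson
  ultimately have "c + r *\<^sub>R q \<in> convex hull X" "c + r *\<^sub>R (- q) \<in> convex hull X"
    by blast+
  moreover have "(c + r *\<^sub>R q) - (c + r *\<^sub>R (- q)) = (2 * r) *\<^sub>R q"
    by (simp flip: scaleR_add_left)
  ultimately show ?thesis by blast
qed

lemma sandwiched_width:
  assumes "sandwiched d X c r R" "q \<in> unit_ball d" "x \<in> convex hull X" "y \<in> convex hull X"
  shows "ip d q (x - y) \<le> 2 * R"
proof -
  have R: "0 \<le> R" and sub: "convex hull X \<subseteq> (\<lambda>x. c + R *\<^sub>R x) ` unit_ball d"
    using assms(1) by (simp_all add: sandwiched_def)
  obtain x' y' where x': "x = c + R *\<^sub>R x'" "x' \<in> unit_ball d" and y': "y = c + R *\<^sub>R y'" "y' \<in> unit_ball d"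
    using subsetD[OF sub assms(3)] subsetD[OF sub assms(4)] by auto
  have "ip d q x' + ip d q (- y') \<le> 1 + 1"
    using unit_ball_ip_le[OF assms(2) x'(2)] unit_ball_ip_le[OF assms(2) uminus_unit_ball[OF y'(2)]]
    by (rule add_mono)
  then have "R * (ip d q x' + ip d q (- y')) \<le> R * 2"
    using R by (intro mult_left_mono) auto
  then show ?thesis by (simp add: x' y' algebra_simps)
qed

text \<open>An inner ball of radius \<open>r\<close> yields a chord of length \<open>2 r\<close> in
  direction \<open>q\<close>, which has to fit into a slab of width \<open>\<eta>\<close>. This
  converts the height of a new point into a bound on the inner radius.\<close>

lemma inner_par_le:
  assumes q: "q \<in> Rd d" "ip d q q = 1" "q \<in> directions X"
    and w: "\<And>x. x \<in> X \<Longrightarrow> l \<le> ip d q x \<and> ip d q x \<le> l + \<eta>"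
  shows "inner_par d X \<le> ereal (\<eta> / 2)"
  unfolding inner_par_def
proof (rule Sup_least)
  fix e assume "e \<in> {ereal r | r. \<exists>c R. sandwiched d X c r R}"
  then obtain r c R where e: "e = ereal r" "sandwiched d X c r R" by blast
  have qb: "q \<in> unit_ball d" using q by (simp add: unit_ball_ip)
  obtain x y where xy: "x \<in> convex hull X" "y \<in> convex hull X" "x - y = (2 * r) *\<^sub>R q"
    using sandwiched_chord[OF e(2) qb q(3)] by blast
  have "convex hull X \<subseteq> {x. l \<le> ip d q x \<and> ip d q x \<le> l + \<eta>}"
  proof (rule hull_minimal)
    show "convex {x. l \<le> ip d q x \<and> ip d q x \<le> l + \<eta>}"
    proof (rule convexI, intro CollectI conjI)
      fix x y :: point and u v :: real
      assume x: "x \<in> {x. l \<le> ip d q x \<and> ip d q x \<le> l + \<eta>}" and y: "y \<in> {x. l \<le> ip d q x \<and> ip d q x \<le> l + \<eta>}"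
        and uv: "0 \<le> u" "0 \<le> v" "u + v = 1"
      have "u * l + v * l \<le> u * ip d q x + v * ip d q y"
        using x y uv by (intro add_mono mult_left_mono) auto
      then show "l \<le> ip d q (u *\<^sub>R x + v *\<^sub>R y)"
        using uv(3) by (simp only: ip_simps mult_1_left flip: distrib_right)
      have "u * ip d q x + v * ip d q y \<le> u * (l + \<eta>) + v * (l + \<eta>)"
        using x y uv by (intro add_mono mult_left_mono) auto
      also have "\<dots> = l + \<eta>" using uv(3) by (simp only: mult_1_left flip: distrib_right)
      finally show "ip d q (u *\<^sub>R x + v *\<^sub>R y) \<le> l + \<eta>" by simp
    qed
  qed (use w in auto)
  then have "l \<le> ip d q y" "ip d q x \<le> l + \<eta>" using xy(1,2) by auto
  then have "ip d q (x - y) \<le> \<eta>" by simp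
  then show "e \<le> ereal (\<eta> / 2)"
    unfolding xy(3) e using q by simp
qed

lemma outer_par_ge:
  assumes "q \<in> unit_ball d" "x \<in> convex hull X" "y \<in> convex hull X"
  shows "ereal (ip d q (x - y) / 2) \<le> outer_par d X"
  unfolding outer_par_def
proof (rule Inf_greatest)
  fix e assume "e \<in> {ereal R | R. \<exists>c r. sandwiched d X c r R}"
  then obtain R c r where e: "e = ereal R" "sandwiched d X c r R" by blast
  show "ereal (ip d q (x - y) / 2) \<le> e"
    using sandwiched_width[OF e(2) assms] by (simp add: e(1))
qed

text \<open>The unit direction \<open>q\<close> excludes the one-point case, where the inner
  parameter is infinite. The purpose is that the ratio of the radii is at least 1.\<close>

lemma inner_par_le_outer_par:
  assumes q: "q \<in> Rd d" "ip d q q = 1" "q \<in> directions X"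
  shows "inner_par d X \<le> outer_par d X"
  unfolding inner_par_def
proof (rule Sup_least)
  fix e assume "e \<in> {ereal r | r. \<exists>c R. sandwiched d X c r R}"
  then obtain r c R where e: "e = ereal r" "sandwiched d X c r R" by blast
  have qb: "q \<in> unit_ball d" using q by (simp add: unit_ball_ip)
  obtain x y where xy: "x \<in> convex hull X" "y \<in> convex hull X" "x - y = (2 * r) *\<^sub>R q"
    using sandwiched_chord[OF e(2) qb q(3)] by blast
  show "e \<le> outer_par d X"
    using outer_par_ge[OF qb xy(1,2)] unfolding xy(3) e using q by simp
qed

text \<open>\<open>F\<close> is the squared Frobenius norm, by Cauchy-Schwarz in each row.\<close>

lemma app_bounded:
  "\<exists>F\<ge>0. \<forall>x. ip d (app d A x) (app d A x) \<le> F * ip d x x"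
proof (intro exI[of _ "\<Sum>i<d. \<Sum>j<d. (A i j)\<^sup>2"] conjI allI)
  show "0 \<le> (\<Sum>i<d. \<Sum>j<d. (A i j)\<^sup>2)" by (intro sum_nonneg) auto
  fix x
  have "ip d (app d A x) (app d A x) = (\<Sum>i<d. (\<Sum>j<d. A i j * co x j)\<^sup>2)"
    unfolding ip_def app_def by (intro sum.cong) (auto simp: power2_eq_square)
  also have "\<dots> \<le> (\<Sum>i<d. (\<Sum>j<d. (A i j)\<^sup>2) * (\<Sum>j<d. (co x j)\<^sup>2))"
    by (intro sum_mono Cauchy_Schwarz_ineq_sum)
  also have "\<dots> = (\<Sum>i<d. \<Sum>j<d. (A i j)\<^sup>2) * ip d x x"
    by (simp add: sum_distrib_right ip_def power2_eq_square)
  finally show "ip d (app d A x) (app d A x) \<le> (\<Sum>i<d. \<Sum>j<d. (A i j)\<^sup>2) * ip d x x" .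
qed

lemma app_scaled_unit_ball:
  obtains F :: real where "0 < F" "\<And>x. x \<in> unit_ball d \<Longrightarrow> (1 / F) *\<^sub>R app d A x \<in> unit_ball d"
proof -
  obtain G where G: "0 \<le> G" "\<And>x. ip d (app d A x) (app d A x) \<le> G * ip d x x"
    using app_bounded[of d A] by blast
  \<comment> \<open>\<open>G + 1\<close> avoids both a square root and a zero divisor, since
    \<open>G \<le> (G + 1)^2\<close>.\<close>
  have "(1 / (G + 1)) *\<^sub>R app d A x \<in> unit_ball d" if "x \<in> unit_ball d" for x
  proof -
    have "ip d (app d A x) (app d A x) \<le> G * 1"
      using that G(1) by (intro order_trans[OF G(2)] mult_left_mono) (auto simp: unit_ball_ip)
    also have "\<dots> \<le> (G + 1) * (G + 1)" using G(1) by (simp add: algebra_simps)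
    finally have "ip d (app d A x) (app d A x) \<le> (G + 1) * (G + 1)" .
    moreover have "0 < (G + 1) * (G + 1)" using G(1) by simp
    ultimately show ?thesis by (simp add: unit_ball_ip)
  qed
  then show thesis using that[of "G + 1"] G(1) by auto
qed

section \<open>The invariant\<close>

text \<open>
  \<open>U\<close> counts the enlargements within the affine hull; the number of dimension jumps is \<open>card J\<close>.
\<close>

definition rounding :: "nat \<Rightarrow> (nat \<Rightarrow> point) \<Rightarrow> nat \<Rightarrow> point \<Rightarrow> real \<Rightarrow> (nat \<Rightarrow> nat \<Rightarrow> real) \<Rightarrow>
    (nat \<Rightarrow> nat \<Rightarrow> real) \<Rightarrow> nat set \<Rightarrow> nat \<Rightarrow> factorization \<Rightarrow> bool" where
  "rounding d z t c \<alpha> A N J U L \<longleftrightarrow> frame d A N J \<and> c \<in> Rd d \<and> 0 < \<alpha> \<and>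
     1 / \<alpha> = 8 + 2 * (real U + real (card J)) \<and>
     (\<forall>x\<in>unit_ball d. c + \<alpha> *\<^sub>R app d A x \<in> convex hull (z ` {1..t})) \<and>
     (\<forall>k\<in>{1..t}. \<exists>x\<in>unit_ball d. z k = c + app d A x) \<and>
     factors d A L \<and> length L = card J \<and> 2 ^ U * heights L \<le> vol d L \<and>
     (\<forall>(q, m, \<eta>)\<in>set L. \<exists>t'\<in>{1..t}. inner_par d (z ` {1..t'}) \<le> ereal (\<eta> / 2))"

lemma roundingD:
  assumes "rounding d z t c \<alpha> A N J U L"
  shows "frame d A N J" "c \<in> Rd d" "0 < \<alpha>" "1 / \<alpha> = 8 + 2 * (real U + real (card J))"
    "\<And>x. x \<in> unit_ball d \<Longrightarrow> c + \<alpha> *\<^sub>R app d A x \<in> convex hull (z ` {1..t})"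
    "\<And>k. k \<in> {1..t} \<Longrightarrow> \<exists>x\<in>unit_ball d. z k = c + app d A x"
    "factors d A L" "length L = card J" "2 ^ U * heights L \<le> vol d L"
    "\<And>q m \<eta>. (q, m, \<eta>) \<in> set L \<Longrightarrow> \<exists>t'\<in>{1..t}. inner_par d (z ` {1..t'}) \<le> ereal (\<eta> / 2)"
  using assms unfolding rounding_def by auto

lemma rounding_\<alpha>_le:
  assumes "rounding d z t c \<alpha> A N J U L"
  shows "\<alpha> \<le> 1/8"
proof -
  have "8 \<le> 1 / \<alpha>" using roundingD(4)[OF assms] by simp
  then show ?thesis using roundingD(3)[OF assms] by (simp add: field_simps)
qed

lemma \<alpha>_step:
  fixes \<alpha> :: real
  assumes "0 < \<alpha>"
  shows "1 / (\<alpha> / (1 + 2*\<alpha>)) = 1 / \<alpha> + 2"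
  using assms by (simp add: field_simps)

text \<open>One point and the degenerate ellipsoid \<open>{0}\<close>. With \<open>N\<close> the
  identity and \<open>J\<close> empty, any nonzero displacement counts as leaving the range.\<close>

lemma rounding_init:
  assumes z: "z 1 \<in> Rd d" and A: "\<And>i j. i < d \<Longrightarrow> j < d \<Longrightarrow> A i j = 0"
    and N: "\<And>i j. i < d \<Longrightarrow> j < d \<Longrightarrow> N i j = (if i = j then 1 else 0)"
  shows "rounding d z 1 (z 1) (1/8) A N {} 0 []"
proof -
  have A0: "app d A x = 0" "app d (transp A) x = 0" for x
    using A by (auto intro!: Rd_eqI[of _ d] simp: app_def)
  have N1: "app d N x = x" if "x \<in> Rd d" for x
    using that N by (intro Rd_eqI[of _ d]) (auto simp: app_def if_distrib[where f = "\<lambda>v. v * _"] sum.delta cong: if_cong)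
  have "coords {} = {0}" by (auto simp: coords_def intro: poly_mapping_eqI)
  then have "frame d A N {}" by (auto simp: frame_def A0 N1)
  moreover have "(0::point) \<in> unit_ball d" by (simp add: unit_ball_ip)
  ultimately show ?thesis
    unfolding rounding_def factors_def using z by (auto simp: A0)
qed

lemma rounding_skip:
  assumes R: "rounding d z t c \<alpha> A N J U L" and u: "z (Suc t) = c + u" "u \<in> Rd d"
    and y: "app d N u \<in> coords J" "ip d (app d N u) (app d N u) \<le> 1"
  shows "rounding d z (Suc t) c \<alpha> A N J U L"
proof -
  note R' = roundingD[OF R]
  have sub: "convex hull (z ` {1..t}) \<subseteq> convex hull (z ` {1..Suc t})"
    by (intro hull_mono image_mono) auto
  have "u = app d A (app d N u)" using frameD(4)[OF R'(1) u(2) y(1)] by simp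
  then have new: "\<exists>x\<in>unit_ball d. z (Suc t) = c + app d A x"
    using u(1) y(2) by (intro bexI[of _ "app d N u"]) (auto simp: unit_ball_ip)
  have "\<exists>x\<in>unit_ball d. z k = c + app d A x" if "k \<in> {1..Suc t}" for k
    using that R'(6)[of k] new by (cases "k = Suc t") auto
  moreover have "\<exists>t'\<in>{1..Suc t}. inner_par d (z ` {1..t'}) \<le> ereal (\<eta> / 2)" if "(q, m, \<eta>) \<in> set L" for q m \<eta>
    using R'(10)[OF that] by (meson atLeastAtMost_iff le_SucI)
  ultimately show ?thesis
    unfolding rounding_def using R' sub by blast
qed

lemma app_directions:
  assumes "\<And>x. x \<in> unit_ball d \<Longrightarrow> c + \<alpha> *\<^sub>R app d A x \<in> convex hull X" "0 < \<alpha>"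
  shows "app d A x \<in> directions X"
  unfolding directions_def
proof (rule in_span_columns)
  fix j assume j: "j < d"
  have "(0::point) \<in> unit_ball d" "unit_vec d j \<in> unit_ball d"
    using j by (auto simp: unit_ball_ip co_unit_vec)
  then have "(c + \<alpha> *\<^sub>R app d A (unit_vec d j)) - (c + \<alpha> *\<^sub>R app d A 0) \<in> directions X"
    using assms(1) by (intro convex_hull_diff) auto
  then have "\<alpha> *\<^sub>R app d A (unit_vec d j) \<in> directions X"
    by (simp add: app_linear)
  then have "(1 / \<alpha>) *\<^sub>R (\<alpha> *\<^sub>R app d A (unit_vec d j)) \<in> directions X"
    by (rule subspace_scale[OF subspace_directions])
  then show "vec_of d (\<lambda>i. A i j) \<in> span {x - y |x y. x \<in> X \<and> y \<in> X}"
    using assms(2) j by (simp add: directions_def app_unit_vec)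
qed

lemma rounding_center:
  assumes "rounding d z t c \<alpha> A N J U L"
  shows "c \<in> convex hull (z ` {1..t})"
  using roundingD(5)[OF assms, of 0] by (simp add: unit_ball_ip app_linear)

lemma hull_prefix_mono: "convex hull (z ` {1..t}) \<subseteq> convex hull (z ` {1..Suc t})"
  by (intro hull_mono image_mono) auto

text \<open>The counters enter \<open>1 / \<alpha>\<close> only through their sum, which grows by
  one in either kind of enlargement.\<close>

lemma rounding_step:
  assumes R: "rounding d z t c \<alpha> A N J U L"
    and F: "frame d A' N' J'" "c' \<in> Rd d" "U' + card J' = Suc (U + card J)"
    and inner: "\<And>x. x \<in> unit_ball d \<Longrightarrow>
        c' + (\<alpha> / (1 + 2*\<alpha>)) *\<^sub>R app d A' x \<in> convex hull (z ` {1..Suc t})"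
    and old: "\<And>x. x \<in> unit_ball d \<Longrightarrow> \<exists>x'\<in>unit_ball d. c + app d A x = c' + app d A' x'"
    and new: "\<exists>x'\<in>unit_ball d. z (Suc t) = c' + app d A' x'"
    and L': "factors d A' L'" "length L' = card J'" "2 ^ U' * heights L' \<le> vol d L'"
      "\<And>q m \<eta>. (q, m, \<eta>) \<in> set L' \<Longrightarrow> \<exists>t'\<in>{1..Suc t}. inner_par d (z ` {1..t'}) \<le> ereal (\<eta> / 2)"
  shows "rounding d z (Suc t) c' (\<alpha> / (1 + 2*\<alpha>)) A' N' J' U' L'"
proof -
  note R' = roundingD[OF R]
  have "1 / (\<alpha> / (1 + 2*\<alpha>)) = 8 + 2 * (real U' + real (card J'))"
    unfolding \<alpha>_step[OF R'(3)] R'(4) of_nat_add[symmetric] F(3) by simp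
  moreover have "0 < \<alpha> / (1 + 2*\<alpha>)" using R'(3) by simp
  moreover have "\<exists>x\<in>unit_ball d. z k = c' + app d A' x" if "k \<in> {1..Suc t}" for k
  proof (cases "k = Suc t")
    case False
    then have "k \<in> {1..t}" using that by auto
    then obtain x where "x \<in> unit_ball d" "z k = c + app d A x"
      using R'(6) by blast
    then show ?thesis using old by metis
  qed (use new in simp)
  ultimately show ?thesis
    unfolding rounding_def using F inner L' by auto
qed

text \<open>\<open>N' = (I - g h^T) N / b\<close> covers both inverse updates. With the row
  \<open>h^T N\<close> formed first it takes \<open>O(d^2)\<close> operations.\<close>

lemma app_inverse_update:
  assumes g: "g \<in> Rd d" and b: "b \<noteq> 0"
    and N': "\<And>i j. i < d \<Longrightarrow> j < d \<Longrightarrow> N' i j = (N i j - co g i * (\<Sum>r<d. co h r * N r j)) / b"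
  shows "app d N' x = (1/b) *\<^sub>R (app d N x - ip d h (app d N x) *\<^sub>R g)"
proof -
  have "app d N' x = (1/b) *\<^sub>R app d N x + ip d (app d (transp N) h) x *\<^sub>R ((-1/b) *\<^sub>R g)"
  proof (rule app_rank_one)
    fix i j assume "i < d" "j < d"
    then show "N' i j = 1/b * N i j + co ((-1/b) *\<^sub>R g) i * co (app d (transp N) h) j"
      using b by (simp add: N' app_def mult.commute field_simps)
  qed (use g in auto)
  also have "ip d (app d (transp N) h) x = ip d h (app d N x)"
    using ip_app'[of d h N x] by simp
  finally show ?thesis by (simp add: algebra_simps)
qed

lemma rounding_stretch:
  assumes R: "rounding d z t c \<alpha> A N J U L" and u: "z (Suc t) = c + u" "u \<in> Rd d"
    and y: "y = app d N u" "y \<in> coords J" "1 < ip d y y"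
    and b: "b = 1 + \<alpha>/4" and a: "a = (1 + 2*\<alpha>) * (sqrt (ip d y y) + 1)" and \<kappa>: "\<kappa> = (a - b) / ip d y y"
    and A': "\<And>i j. i < d \<Longrightarrow> j < d \<Longrightarrow> A' i j = b * A i j + co u i * (\<kappa> * co y j)"
    and N': "\<And>i j. i < d \<Longrightarrow> j < d \<Longrightarrow> N' i j = (N i j - \<kappa> / a * co y i * (\<Sum>r<d. co y r * N r j)) / b"
  shows "\<exists>L'. rounding d z (Suc t) (c + \<alpha> *\<^sub>R u) (\<alpha> / (1 + 2*\<alpha>)) A' N' J (Suc U) L'"
proof -
  note R' = roundingD[OF R]
  have \<alpha>: "0 < \<alpha>" "\<alpha> \<le> 1/8" using R'(3) rounding_\<alpha>_le[OF R] by auto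
  have yR: "y \<in> Rd d" unfolding y(1) by simp
  have uA: "u = app d A y" using frameD(4)[OF R'(1) u(2)] y by simp
  have app_A': "app d A' x = b *\<^sub>R app d A x + (\<kappa> * ip d y x) *\<^sub>R u" for x
    using app_rank_one[OF u(2), of A' b A "\<kappa> *\<^sub>R y" x] A' by simp
  have app_A'T: "app d (transp A') x = b *\<^sub>R app d (transp A) x + (\<kappa> * ip d u x) *\<^sub>R y" for x
    using app_rank_one_transp[of "\<kappa> *\<^sub>R y" d A' b A u x] A' yR by (simp add: mult.commute)
  have b0: "0 < b" "1 \<le> b" using \<alpha> by (auto simp: b)
  have app_N': "app d N' x = (1/b) *\<^sub>R (app d N x - (\<kappa> / a * ip d y (app d N x)) *\<^sub>R y)" for x
    using app_inverse_update[of "(\<kappa> / a) *\<^sub>R y" d b N' N y x] N' yR b0 by (simp add: mult.commute)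
  interpret E: stretch d A A' c u \<alpha> b "convex hull (z ` {1..Suc t})" y "sqrt (ip d y y)" a \<kappa>
  proof
    show "c + \<alpha> *\<^sub>R app d A x \<in> convex hull (z ` {1..Suc t})" if "x \<in> unit_ball d" for x
      using R'(5)[OF that] hull_prefix_mono by blast
    show "c + u \<in> convex hull (z ` {1..Suc t})"
      unfolding u(1)[symmetric] by (intro hull_inc) auto
  qed (use \<alpha> y yR uA b a \<kappa> app_A' in auto)
  have ab: "a = b + \<kappa> * ip d y y" using E.a_eq by simp
  have a0: "0 < a" using E.a_ge b0 by simp
  obtain L' where L': "factors d A' L'" "labels L' = labels L" "2 * vol d L \<le> vol d L'"
    using factors_stretch[OF R'(1,7) y(2) uA _ b0(2) ab E.a_ge app_A'T] y(3) by auto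
  have "rounding d z (Suc t) (c + \<alpha> *\<^sub>R u) (\<alpha> / (1 + 2*\<alpha>)) A' N' J (Suc U) L'"
  proof (rule rounding_step[OF R])
    show "frame d A' N' J"
      by (rule frame_stretch[OF R'(1) y(2) uA b0(1) ab a0 app_A' app_N'])
    show "length L' = card J" using map_eq_imp_length_eq[OF L'(2)] R'(8) by simp
    show "2 ^ Suc U * heights L' \<le> vol d L'"
      using heights_labels[OF L'(2)] L'(3) R'(9) by simp
    show "\<exists>t'\<in>{1..Suc t}. inner_par d (z ` {1..t'}) \<le> ereal (\<eta> / 2)" if m: "(q, m, \<eta>) \<in> set L'" for q m \<eta>
    proof -
      have "(q, \<eta>) \<in> set (labels L')" using m by force
      then obtain m' where "(q, m', \<eta>) \<in> set L" unfolding L'(2) by auto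
      then show ?thesis using R'(10) by (meson atLeastAtMost_iff le_SucI)
    qed
  qed (use E.outer_old E.outer_new E.inner L' R'(2) u in auto)
  then show ?thesis ..
qed

text \<open>\<open>q\<close> is the normalized residual of \<open>u\<close> after projection onto
  the columns of \<open>A\<close>, so \<open>\<langle>q, u\<rangle>\<close> is the distance of
  \<open>u\<close> from the range. The residual is nonzero because otherwise \<open>N u\<close>
  would be supported on \<open>J\<close>. The last property will place \<open>q\<close> in the
  direction space of the points.\<close>

lemma opening_direction:
  assumes F: "frame d A N J" and u: "u \<in> Rd d" and i: "i \<notin> J" "co (app d N u) i \<noteq> 0"
  obtains q x where "q \<in> Rd d" "ip d q q = 1" "app d (transp A) q = 0" "0 < ip d q u"
    "q \<in> span {u, app d A x}"
proof -
  define B where "B = map (\<lambda>j. app d A (unit_vec d j)) [0..<d]"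
  obtain p where p: "p \<in> span (set B)" "\<And>v. v \<in> set B \<Longrightarrow> ip d (u - p) v = 0"
    using orthogonal_projection_exists[of B d u] u by (auto simp: B_def)
  have "subspace (range (app d A))"
    by (auto simp: subspace_def simp flip: app_linear) (metis app_linear(4) rangeI)
  then have "span (set B) \<subseteq> range (app d A)"
    by (intro span_minimal) (auto simp: B_def)
  then obtain x where x: "p = app d A x" using p(1) by auto
  define v where "v = u - p"
  have vR: "v \<in> Rd d" using u x by (simp add: v_def)
  have Av: "app d (transp A) v = 0"
  proof (rule Rd_eqI[of _ d])
    fix j assume j: "j < d"
    have "co (app d (transp A) v) j = ip d v (app d A (unit_vec d j))"
      using j by (simp add: ip_app')
    also have "\<dots> = 0" unfolding v_def using j by (intro p(2)) (auto simp: B_def)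
    finally show "co (app d (transp A) v) j = co 0 j" by simp
  qed auto
  have "v \<noteq> 0"
  proof
    assume "v = 0"
    then have "u = app d A (proj d J x)" using x app_proj[OF F] by (simp add: v_def)
    then have "app d N u = proj d J x" using frameD(3)[OF F] proj_coords by simp
    then show False using proj_coords[of d J x] i by (simp add: coords_def)
  qed
  then have n: "0 < ip d v v" using ip_pos vR by blast
  define q where "q = (1 / sqrt (ip d v v)) *\<^sub>R v"
  have vu: "ip d v u = ip d v v"
  proof -
    have "ip d v p = 0" unfolding x ip_app' Av by simp
    moreover have "u = v + p" by (simp add: v_def)
    ultimately show ?thesis by (metis ip_simps(2) add.right_neutral)
  qed
  have s: "sqrt (ip d v v) * sqrt (ip d v v) = ip d v v" using n by simp
  show thesis
  proof (rule that[of q x])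
    show "ip d q q = 1" using n s by (simp add: q_def field_simps)
    show "0 < ip d q u" using n by (simp add: q_def vu)
    show "q \<in> span {u, app d A x}"
      unfolding q_def v_def x by (intro span_scale span_diff span_base) auto
  qed (use vR Av in \<open>auto simp: q_def app_linear\<close>)
qed

lemma rounding_extend:
  assumes R: "rounding d z t c \<alpha> A N J U L" and u: "z (Suc t) = c + u" "u \<in> Rd d"
    and y: "y = app d N u" and i: "i < d" "i \<notin> J" "co y i \<noteq> 0"
    and b: "b = 1 + \<alpha>/4"
    and A': "\<And>r j. r < d \<Longrightarrow> j < d \<Longrightarrow> A' r j = b * A r j + co u r * (if j = i then 1 + 2*\<alpha> else 0)"
    and N': "\<And>r j. r < d \<Longrightarrow> j < d \<Longrightarrow> N' r j =
        (N r j - (co y r - (if r = i then b / (1 + 2*\<alpha>) else 0)) / co y i * (\<Sum>k<d. (if k = i then 1 else 0) * N k j)) / b"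
  shows "\<exists>L'. rounding d z (Suc t) (c + \<alpha> *\<^sub>R u) (\<alpha> / (1 + 2*\<alpha>)) A' N' (insert i J) U L'"
proof -
  note R' = roundingD[OF R]
  have \<alpha>: "0 < \<alpha>" "\<alpha> \<le> 1/8" using R'(3) rounding_\<alpha>_le[OF R] by auto
  have yR: "y \<in> Rd d" unfolding y(1) by simp
  have b0: "0 < b" "1 \<le> b" using \<alpha> by (auto simp: b)
  have app_A': "app d A' x = b *\<^sub>R app d A x + ((1 + 2*\<alpha>) * co x i) *\<^sub>R u" for x
    using app_rank_one[OF u(2), of A' b A "(1 + 2*\<alpha>) *\<^sub>R unit_vec d i" x] A' i(1) by (simp add: co_unit_vec)
  have app_A'T: "app d (transp A') x = b *\<^sub>R app d (transp A) x + ((1 + 2*\<alpha>) * ip d u x) *\<^sub>R unit_vec d i" for x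
    using app_rank_one_transp[of "(1 + 2*\<alpha>) *\<^sub>R unit_vec d i" d A' b A u x] A' i(1)
    by (simp add: co_unit_vec mult.commute)
  define g where "g = (1 / co y i) *\<^sub>R y - (b / ((1 + 2*\<alpha>) * co y i)) *\<^sub>R unit_vec d i"
  have g: "co g r = (co y r - (if r = i then b / (1 + 2*\<alpha>) else 0)) / co y i" if "r < d" for r
    using that by (simp add: g_def co_unit_vec diff_divide_distrib)
  have app_N': "app d N' x = (1/b) *\<^sub>R (app d N x - co (app d N x) i *\<^sub>R g)" for x
    using app_inverse_update[of g d b N' N "unit_vec d i" x] N' yR b0 i(1) g
    by (simp add: g_def[symmetric] co_unit_vec) (simp add: g_def)
  interpret E: extend d A A' c u \<alpha> b "convex hull (z ` {1..Suc t})" i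
  proof
    show "c + \<alpha> *\<^sub>R app d A x \<in> convex hull (z ` {1..Suc t})" if "x \<in> unit_ball d" for x
      using R'(5)[OF that] hull_prefix_mono by blast
    show "c + u \<in> convex hull (z ` {1..Suc t})"
      unfolding u(1)[symmetric] by (intro hull_inc) auto
  qed (use \<alpha> b i frameD(2)[OF R'(1)] app_A' in auto)
  obtain q x where q: "q \<in> Rd d" "ip d q q = 1" "app d (transp A) q = 0" "0 < ip d q u"
    "q \<in> span {u, app d A x}"
    using opening_direction[OF R'(1) u(2) i(2)] i(3) y by metis
  define L' where "L' = (q, (1 + 2*\<alpha>) *\<^sub>R u, ip d q u) # scale_factors b L"
  have L': "factors d A' L'" "ip d q u * vol d L \<le> vol d L'"
    using factors_extend[OF R'(7) i(1) frameD(2)[OF R'(1) i(1,2)] u(2) q(1-4) b0(2) _ app_A'T] \<alpha>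
    by (simp_all add: L'_def)
  have finJ: "finite J" using frameD(1)[OF R'(1)] finite_subset by blast
  \<comment> \<open>All earlier points lie in \<open>c\<close> plus the range of \<open>A\<close>,
    where \<open>q\<close> is constant; only the new point is higher, by
    \<open>\<langle>q, u\<rangle>\<close>.\<close>
  have inner_q: "inner_par d (z ` {1..Suc t}) \<le> ereal (ip d q u / 2)"
  proof (rule inner_par_le[OF q(1,2), where l = "ip d q c"])
    have "c \<in> convex hull (z ` {1..Suc t})"
      using rounding_center[OF R] hull_prefix_mono by blast
    then have "(c + u) - c \<in> directions (z ` {1..Suc t})"
      by (intro convex_hull_diff E.K(3))
    moreover have "app d A x \<in> directions (z ` {1..Suc t})"
      using E.K(2) \<alpha>(1) by (rule app_directions)
    ultimately have "span {u, app d A x} \<subseteq> directions (z ` {1..Suc t})"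
      by (intro span_minimal subspace_directions) auto
    then show "q \<in> directions (z ` {1..Suc t})" using q(5) by blast
  next
    fix v assume "v \<in> z ` {1..Suc t}"
    then obtain k where k: "v = z k" "k \<in> {1..Suc t}" by auto
    show "ip d q c \<le> ip d q v \<and> ip d q v \<le> ip d q c + ip d q u"
    proof (cases "k = Suc t")
      case True
      then show ?thesis using k u q(4) by simp
    next
      case False
      then have "k \<in> {1..t}" using k(2) by auto
      then obtain x' where "z k = c + app d A x'" using R'(6) by blast
      then have "ip d q v = ip d q c" unfolding k(1) by (simp add: ip_app' q(3))
      then show ?thesis using q(4) by simp
    qed
  qed
  have "rounding d z (Suc t) (c + \<alpha> *\<^sub>R u) (\<alpha> / (1 + 2*\<alpha>)) A' N' (insert i J) U L'"
  proof (rule rounding_step[OF R])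
    show "frame d A' N' (insert i J)"
      using frame_extend[OF R'(1) i(1,2) u(2) y(1) i(3) b0(1) _ app_A' app_N'[unfolded g_def]] \<alpha> by simp
    show "U + card (insert i J) = Suc (U + card J)" "length L' = card (insert i J)"
      using i(2) finJ R'(8) by (simp_all add: L'_def)
    have "2 ^ U * heights L' = ip d q u * (2 ^ U * heights L)"
      by (simp add: L'_def scale_factors(4)[OF b0(1)])
    also have "\<dots> \<le> ip d q u * vol d L"
      using q(4) R'(9) by (intro mult_left_mono) auto
    finally show "2 ^ U * heights L' \<le> vol d L'" using L'(2) by simp
    show "\<exists>t'\<in>{1..Suc t}. inner_par d (z ` {1..t'}) \<le> ereal (\<eta> / 2)" if m: "(q', m, \<eta>) \<in> set L'" for q' m \<eta>
    proof (cases "(q', m, \<eta>) = (q, (1 + 2*\<alpha>) *\<^sub>R u, ip d q u)")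
      case True
      then show ?thesis using inner_q by (intro bexI[of _ "Suc t"]) auto
    next
      case False
      then obtain m' where "(q', m', \<eta>) \<in> set L" using m by (auto simp: L'_def)
      then show ?thesis using R'(10) by (meson atLeastAtMost_iff le_SucI)
    qed
  qed (use E.outer_old E.outer_new E.inner L' R'(2) u in auto)
  then show ?thesis ..
qed

section \<open>The approximation factor\<close>

lemma rounding_outer_hull:
  assumes "rounding d z t c \<alpha> A N J U L"
  shows "convex hull (z ` {1..t}) \<subseteq> (\<lambda>x. c + app d A x) ` unit_ball d"
proof (rule hull_minimal)
  have "linear (app d A)" by (intro linearI app_linear)
  then have "convex ((\<lambda>v. c + v) ` (app d A ` unit_ball d))"
    by (intro convex_translation convex_linear_image convex_unit_ball)
  then show "convex ((\<lambda>x. c + app d A x) ` unit_ball d)" by (simp add: image_image)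
  show "z ` {1..t} \<subseteq> (\<lambda>x. c + app d A x) ` unit_ball d"
    using roundingD(6)[OF assms] by blast
qed

text \<open>The columns in \<open>J\<close> form a basis of the difference space: \<open>N\<close>
  recovers their coefficients, and differences of points lie in the range of
  \<open>A\<close>.\<close>

lemma rounding_affine_dim:
  assumes R: "rounding d z t c \<alpha> A N J U L"
  shows "affine_dim (z ` {1..t}) = card J"
proof -
  note R' = roundingD[OF R]
  define X where "X = z ` {1..t}"
  define D where "D = {x - y | x y. x \<in> affine hull X \<and> y \<in> affine hull X}"
  define f where "f j = app d A (unit_vec d j)" for j
  have J: "J \<subseteq> {..<d}" "finite J" using frameD(1)[OF R'(1)] finite_subset by auto
  have Nf: "app d N (f j) = unit_vec d j" if "j \<in> J" for j
    unfolding f_def by (rule frameD(3)[OF R'(1)]) (use that in \<open>auto simp: coords_def unit_vec_def\<close>)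
  have inj: "inj_on f J"
  proof (rule inj_onI)
    fix i j assume ij: "i \<in> J" "j \<in> J" "f i = f j"
    then have "unit_vec d i = unit_vec d j" using Nf by metis
    then have "co (unit_vec d i) i = co (unit_vec d j) i" by simp
    then show "i = j" using ij J by (auto simp: co_unit_vec split: if_splits)
  qed
  have comb: "app d A x = (\<Sum>j\<in>J. co x j *\<^sub>R f j)" for x
  proof -
    have "app d A x = (\<Sum>j<d. co x j *\<^sub>R f j)"
      unfolding app_expand[of d A x] f_def by (intro sum.cong) (auto simp: app_unit_vec)
    also have "\<dots> = (\<Sum>j\<in>J. co x j *\<^sub>R f j)"
      using J frameD(2)[OF R'(1)] by (intro sum.mono_neutral_right) (auto simp: f_def)
    finally show ?thesis .
  qed
  have indep: "independent (f ` J)"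
  proof (rule independent_if_scalars_zero)
    fix h v assume h: "(\<Sum>x\<in>f ` J. h x *\<^sub>R x) = 0" and v: "v \<in> f ` J"
    define w where "w = vec_of d (\<lambda>j. if j \<in> J then h (f j) else 0)"
    have w: "w \<in> coords J" by (auto simp: w_def coords_def)
    have cow: "co w j = h (f j)" if "j \<in> J" for j using that J(1) by (auto simp: w_def)
    have "app d A w = (\<Sum>j\<in>J. h (f j) *\<^sub>R f j)"
      unfolding comb using cow by (intro sum.cong) auto
    also have "\<dots> = 0" using h inj by (simp add: sum.reindex)
    finally have "w = 0" using frameD(3)[OF R'(1) w] by (simp add: app_linear)
    then show "h v = 0" using v cow by auto
  qed (use J in auto)
  have fD: "f ` J \<subseteq> D"
  proof
    fix v assume "v \<in> f ` J"
    then obtain j where j: "j \<in> J" "v = f j" by auto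
    have c: "c \<in> affine hull X"
      using rounding_center[OF R] convex_hull_subset_affine_hull unfolding X_def by blast
    have "unit_vec d j \<in> unit_ball d" using j J by (auto simp: unit_ball_ip co_unit_vec)
    then have "c + \<alpha> *\<^sub>R f j \<in> affine hull X"
      using R'(5) convex_hull_subset_affine_hull unfolding X_def f_def by blast
    \<comment> \<open>An affine combination with a negative weight undoes the shrinking by
      \<open>\<alpha>\<close> without leaving the affine hull.\<close>
    then have "(1 - 1/\<alpha>) *\<^sub>R c + (1/\<alpha>) *\<^sub>R (c + \<alpha> *\<^sub>R f j) \<in> affine hull X"
      using c affine_affine_hull[of X] by (simp add: affine_def)
    also have "(1 - 1/\<alpha>) *\<^sub>R c + (1/\<alpha>) *\<^sub>R (c + \<alpha> *\<^sub>R f j) = c + f j"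
      using R'(3) by (simp add: algebra_simps)
    finally have "\<exists>x y. f j = x - y \<and> x \<in> affine hull X \<and> y \<in> affine hull X"
      using c by (intro exI[of _ "c + f j"] exI[of _ c]) auto
    then show "v \<in> D" unfolding D_def j(2) by simp
  qed
  have "directions X \<subseteq> span (f ` J)"
    unfolding directions_def
  proof (intro span_minimal subspace_span subsetI)
    fix v assume "v \<in> {x - y |x y. x \<in> X \<and> y \<in> X}"
    then obtain k l where kl: "v = z k - z l" "k \<in> {1..t}" "l \<in> {1..t}" by (auto simp: X_def)
    obtain x y where xy: "z k = c + app d A x" "z l = c + app d A y"
      using R'(6)[OF kl(2)] R'(6)[OF kl(3)] by blast
    have "v = app d A (x - y)" by (simp add: kl xy app_linear)
    then show "v \<in> span (f ` J)"
      unfolding comb by (simp only:) (intro span_sum span_scale span_base imageI)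
  qed
  then have "D \<subseteq> span (f ` J)" using affine_hull_diff by (fastforce simp: D_def)
  then have "span (f ` J) = span D"
    using fD by (meson span_mono span_minimal subspace_span subset_antisym)
  then have "dim D = card (f ` J)" using indep by (rule dim_eq_card)
  then show ?thesis
    using inj by (simp add: card_image affine_dim_def D_def X_def)
qed

text \<open>The maintained center is itself a competitor: \<open>F\<close> bounds \<open>A\<close>
  and \<open>G\<close> bounds \<open>N\<close>, so the ball of radius \<open>\<alpha> / G\<close> in
  the span lies in the inner ellipsoid. It makes the inner parameter positive and the outer one
  finite.\<close>

lemma rounding_sandwiched:
  assumes R: "rounding d z t c \<alpha> A N J U L" and z: "z ` {1..t} \<subseteq> Rd d"
  shows "\<exists>r R. 0 < r \<and> sandwiched d (z ` {1..t}) c r R"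
proof -
  note R' = roundingD[OF R]
  obtain F where F: "0 < F" "\<And>x. x \<in> unit_ball d \<Longrightarrow> (1 / F) *\<^sub>R app d A x \<in> unit_ball d"
    using app_scaled_unit_ball by blast
  obtain G where G: "0 < G" "\<And>x. x \<in> unit_ball d \<Longrightarrow> (1 / G) *\<^sub>R app d N x \<in> unit_ball d"
    using app_scaled_unit_ball by blast
  have "sandwiched d (z ` {1..t}) c (\<alpha> / G) F"
    unfolding sandwiched_def
  proof (intro conjI)
    show "c \<in> Rd d" by (rule R')
    show "0 \<le> \<alpha> / G" "0 \<le> F" using F G R'(3) by auto
    show "(\<lambda>x. c + (\<alpha> / G) *\<^sub>R x) ` (unit_ball d \<inter> span ((\<lambda>x. x - c) ` z ` {1..t})) \<subseteq> convex hull z ` {1..t}"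
    proof (rule image_subsetI)
      fix v assume v: "v \<in> unit_ball d \<inter> span ((\<lambda>x. x - c) ` z ` {1..t})"
      have "(\<lambda>x. x - c) ` z ` {1..t} \<subseteq> app d A ` coords J"
      proof (rule image_subsetI)
        fix w assume "w \<in> z ` {1..t}"
        then obtain x where "w = c + app d A x" using R'(6) by blast
        then have "w - c = app d A (proj d J x)" by (simp add: app_proj[OF R'(1)])
        then show "w - c \<in> app d A ` coords J" using proj_coords by blast
      qed
      moreover have "linear (app d A)" by (intro linearI app_linear)
      then have "subspace (app d A ` coords J)"
        using subspace_coords by (rule linear_subspace_image)
      ultimately have "v \<in> app d A ` coords J" using v span_minimal by blast
      then obtain x where x: "x \<in> coords J" "v = app d A x" by auto
      then have "v = app d A (app d N v)" using frameD(3)[OF R'(1) x(1)] by simp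
      moreover have "c + \<alpha> *\<^sub>R app d A ((1 / G) *\<^sub>R app d N v) \<in> convex hull z ` {1..t}"
        using v G(2) by (intro R'(5)) auto
      ultimately show "c + (\<alpha> / G) *\<^sub>R v \<in> convex hull z ` {1..t}"
        by (simp add: app_linear)
    qed
    show "convex hull z ` {1..t} \<subseteq> (\<lambda>x. c + F *\<^sub>R x) ` unit_ball d"
    proof
      fix v assume "v \<in> convex hull z ` {1..t}"
      then obtain x where x: "x \<in> unit_ball d" "v = c + app d A x"
        using rounding_outer_hull[OF R] by blast
      show "v \<in> (\<lambda>x. c + F *\<^sub>R x) ` unit_ball d"
        by (rule image_eqI[OF _ F(2)[OF x(1)]]) (use F(1) x(2) in simp)
    qed
  qed
  moreover have "0 < \<alpha> / G" using G(1) R'(3) by simp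
  ultimately show ?thesis by blast
qed

section \<open>The radii as extended reals and their ratio\<close>

lemma rounding_inner_par_pos:
  assumes "rounding d z t c \<alpha> A N J U L" "z ` {1..t} \<subseteq> Rd d"
  shows "0 < inner_par d (z ` {1..t})"
proof -
  obtain r R where r: "0 < r" "sandwiched d (z ` {1..t}) c r R"
    using rounding_sandwiched[OF assms] by blast
  then have "ereal r \<le> inner_par d (z ` {1..t})"
    unfolding inner_par_def by (intro Sup_upper) blast
  moreover have "0 < ereal r" using r by simp
  ultimately show ?thesis by (rule less_le_trans[rotated])
qed

lemma rounding_outer_par:
  assumes "rounding d z t c \<alpha> A N J U L" "z ` {1..t} \<subseteq> Rd d"
  obtains p where "outer_par d (z ` {1..t}) = ereal p" "0 \<le> p"
proof -
  obtain r R where r: "0 < r" "sandwiched d (z ` {1..t}) c r R"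
    using rounding_sandwiched[OF assms] by blast
  then have 1: "outer_par d (z ` {1..t}) \<le> ereal R"
    unfolding outer_par_def by (intro Inf_lower) blast
  have 0: "0 \<le> outer_par d (z ` {1..t})"
    unfolding outer_par_def by (rule Inf_greatest) (auto simp: sandwiched_def)
  show thesis
    using 0 1 that by (cases "outer_par d (z ` {1..t})") auto
qed

text \<open>All quotients are finite and nonnegative, an infinite inner parameter giving 0. So
  \<open>Max\<close> is a real number and \<open>real_of_ereal\<close> loses nothing.\<close>

lemma max_ratio_bound:
  assumes pos: "\<And>s. s \<in> {1..t} \<Longrightarrow> 0 < inner_par d (z ` {1..s})" and t: "t' \<in> {1..t}"
    and p: "outer_par d (z ` {1..t}) = ereal p" "0 \<le> p" and h: "inner_par d (z ` {1..t'}) \<le> ereal h"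
  shows "p \<le> max_ratio d z t * h" "0 \<le> max_ratio d z t"
proof -
  define f where "f = (\<lambda>s. outer_par d (z ` {1..t}) / inner_par d (z ` {1..s}))"
  have f: "\<exists>v\<ge>0. f s = ereal v" if "s \<in> {1..t}" for s
    using pos[OF that] p by (cases "inner_par d (z ` {1..s})") (auto simp: f_def)
  have fin: "finite (f ` {1..t})" by simp
  have "Max (f ` {1..t}) \<in> f ` {1..t}" using t by (intro Max_in) auto
  then obtain s where s: "s \<in> {1..t}" "Max (f ` {1..t}) = f s" by blast
  then obtain v where v: "0 \<le> v" "Max (f ` {1..t}) = ereal v" using f by metis
  have mr: "max_ratio d z t = v"
    unfolding max_ratio_def f_def[symmetric] v(2) by simp
  then show "0 \<le> max_ratio d z t" using v by simp
  obtain i where i: "inner_par d (z ` {1..t'}) = ereal i" "0 < i" "i \<le> h"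
    using pos[OF t] h by (cases "inner_par d (z ` {1..t'})") auto
  have "f t' \<le> Max (f ` {1..t})" using t by (intro Max_ge[OF fin]) auto
  then have "p / i \<le> v" using i v p by (simp add: f_def)
  then have "p \<le> v * i" using i by (simp add: field_simps)
  also have "\<dots> \<le> v * h" using i v by (intro mult_left_mono) auto
  finally show "p \<le> max_ratio d z t * h" by (simp add: mr)
qed

text \<open>With \<open>v = A^T q\<close>, the chord of the inner ellipsoid given by
  \<open>v / |v|\<close> and its negative has width \<open>2 \<alpha> |v|\<close> along
  \<open>q\<close>. Moreover \<open>|v|\<close> is at least \<open>\<langle>q, m\<rangle>\<close>,
  since \<open>|v|^2\<close> is the sum of the squares of these products over the list.\<close>

lemma rounding_width:
  assumes R: "rounding d z t c \<alpha> A N J U L" and L: "(q, m, \<eta>) \<in> set L"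
    and p: "outer_par d (z ` {1..t}) = ereal p"
  shows "\<alpha> * ip d q m \<le> p"
proof -
  note R' = roundingD[OF R]
  have tri: "triangular d L" using R'(7) by (simp add: factors_def)
  have q: "q \<in> Rd d" "ip d q q = 1" "0 < ip d q m" using triangular_entry[OF tri L] by auto
  define v where "v = app d (transp A) q"
  have m: "(ip d q m)\<^sup>2 \<le> ip d v v"
    using gram_ge[OF L, of d q] R'(7) by (simp add: factors_def v_def)
  then have n: "0 < ip d v v" using q(3) by (smt (verit) zero_less_power)
  define s where "s = sqrt (ip d v v)"
  have s: "0 < s" "s * s = ip d v v" "ip d q m \<le> s"
    using n m q(3) by (auto simp: s_def real_le_rsqrt)
  have x: "(1/s) *\<^sub>R v \<in> unit_ball d"
    using s by (simp add: unit_ball_ip v_def[symmetric]) (simp add: v_def)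
  have "c + \<alpha> *\<^sub>R app d A ((1/s) *\<^sub>R v) \<in> convex hull (z ` {1..t})"
    "c + \<alpha> *\<^sub>R app d A (- ((1/s) *\<^sub>R v)) \<in> convex hull (z ` {1..t})"
    using R'(5) x uminus_unit_ball[OF x] by auto
  then have "ereal (ip d q ((c + \<alpha> *\<^sub>R app d A ((1/s) *\<^sub>R v)) - (c + \<alpha> *\<^sub>R app d A (- ((1/s) *\<^sub>R v)))) / 2) \<le> ereal p"
    unfolding p[symmetric] using q by (intro outer_par_ge) (auto simp: unit_ball_ip)
  moreover have "ip d q (app d A v) = s * s"
    unfolding s(2) ip_app' by (simp add: v_def)
  then have "ip d q ((c + \<alpha> *\<^sub>R app d A ((1/s) *\<^sub>R v)) - (c + \<alpha> *\<^sub>R app d A (- ((1/s) *\<^sub>R v)))) = 2 * (\<alpha> * s)"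
    unfolding app_linear ip_simps using s(1) by simp
  ultimately have "\<alpha> * s \<le> p" by simp
  moreover have "\<alpha> * ip d q m \<le> \<alpha> * s" using s(3) R'(3) by simp
  ultimately show ?thesis by simp
qed

lemma vol_heights_bound:
  assumes "triangular d L" "0 \<le> r" "\<And>q m \<eta>. (q, m, \<eta>) \<in> set L \<Longrightarrow> ip d q m \<le> r * \<eta>"
  shows "vol d L \<le> r ^ length L * heights L"
  using assms
proof (induction L rule: heights.induct)
  case (2 q m \<eta> L)
  have "vol d L \<le> r ^ length L * heights L" using 2 by auto
  moreover have "ip d q m \<le> r * \<eta>" using 2(4) by simp
  ultimately have "ip d q m * vol d L \<le> (r * \<eta>) * (r ^ length L * heights L)"
    using 2 vol_pos[of d L] by (intro mult_mono) auto
  then show ?case by (simp add: mult_ac)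
qed simp

lemma factor_bound:
  fixes x \<kappa> :: real and k U :: nat
  assumes x: "x = 8 + 2 * (real U + real k)" and vol: "2 ^ U \<le> (\<kappa> * x / 2) ^ k" and \<kappa>: "1 \<le> k \<Longrightarrow> 1 \<le> \<kappa>"
  shows "x \<le> 40 * max 1 (real k * ln (real k * \<kappa>))"
proof (cases "k = 0")
  case True
  \<comment> \<open>Without a dimension the power is 1, which leaves no room for an enlargement, and
    \<open>x = 8\<close>.\<close>
  have "U = 0"
  proof (rule ccontr)
    assume "U \<noteq> 0"
    then have "(2::real) ^ 1 \<le> 2 ^ U" by (intro power_increasing) auto
    then show False using vol True by simp
  qed
  then show ?thesis using x True by simp
next
  case False
  define M where "M = max 1 (real k * ln (real k * \<kappa>))"
  have k: "1 \<le> real k" and \<kappa>1: "1 \<le> \<kappa>" using False \<kappa> by auto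
  have x8: "8 \<le> x" using x by simp
  \<comment> \<open>\<open>x\<close> occurs on both sides of the inequality to be solved. The
    tangent to \<open>ln\<close> at \<open>6 k\<close> makes it linear; this point is chosen so that
    \<open>x\<close> returns with coefficient \<open>1/4\<close>, to be absorbed on the
    left.\<close>
  have lnx: "ln (x / 2) \<le> x / (12 * real k) - 1 + ln (6 * real k)"
  proof -
    have "ln (x / (12 * real k)) \<le> x / (12 * real k) - 1"
      using x8 k by (intro ln_le_minus_one) auto
    moreover have e: "x / 2 = x / (12 * real k) * (6 * real k)" using k by (simp add: field_simps)
    have "ln (x / 2) = ln (x / (12 * real k)) + ln (6 * real k)"
      unfolding e using x8 k by (intro ln_mult_pos) auto
    ultimately show ?thesis by simp
  qed
  have "real U * ln 2 = ln (2 ^ U)" by (simp add: ln_realpow)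
  also have "\<dots> \<le> ln ((\<kappa> * x / 2) ^ k)" using vol x8 \<kappa>1 by (subst ln_le_cancel_iff) auto
  also have "\<dots> = real k * (ln \<kappa> + ln (x / 2))"
    using x8 \<kappa>1 by (simp add: ln_realpow ln_mult flip: times_divide_eq_right)
  finally have 1: "real U * ln 2 \<le> real k * (ln \<kappa> + ln (x / 2))" .
  have "real U * (2/3) \<le> real U * ln 2"
    using ln2_ge_two_thirds by (intro mult_left_mono) auto
  then have "2 * real U \<le> 3 * (real k * (ln \<kappa> + ln (x / 2)))" using 1 by simp
  also have "real k * (ln \<kappa> + ln (x / 2)) \<le> real k * (ln \<kappa> + (x / (12 * real k) - 1 + ln (6 * real k)))"
    using lnx k by (intro mult_left_mono) auto
  also have "\<dots> = real k * ln (real k * \<kappa>) + x / 12 - real k + real k * ln 6"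
    using k \<kappa>1 by (simp add: ln_mult field_simps)
  finally have "2 * real U \<le> 3 * (real k * ln (real k * \<kappa>)) + x / 4 - 3 * real k + 3 * (real k * ln 6)" by simp
  moreover have "real k * ln 6 \<le> real k * 2"
  proof -
    have "6 \<le> exp (2::real)"
    proof -
      have "2.5 \<le> exp (1::real)" using exp_ge_one_plus_x_over_n_power_n[of 2 1] exp_lower_Taylor_quadratic[of 1] by simp
      then have "2.5 * 2.5 \<le> exp (1::real) * exp 1" by (intro mult_mono) auto
      then show ?thesis by (simp flip: exp_add)
    qed
    then have "ln 6 \<le> ln (exp (2::real))" by (intro ln_mono) auto
    then have "ln 6 \<le> (2::real)" by simp
    then show ?thesis by (intro mult_left_mono) auto
  qed
  \<comment> \<open>For \<open>k = 1\<close> the logarithm may vanish, which is what the summand 1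
    is for; for larger \<open>k\<close> it is at least \<open>ln 2\<close>.\<close>
  moreover have "real k \<le> 1 + 3/2 * (real k * ln (real k * \<kappa>))"
  proof (cases "k = 1")
    case True
    then show ?thesis using \<kappa>1 by simp
  next
    case False
    then have "2 \<le> real k" using k by simp
    then have "2 * 1 \<le> real k * \<kappa>" using \<kappa>1 by (intro mult_mono) auto
    then have "ln 2 \<le> ln (real k * \<kappa>)" by simp
    then have "2/3 \<le> ln (real k * \<kappa>)" using ln2_ge_two_thirds by linarith
    then have "real k * (2/3) \<le> real k * ln (real k * \<kappa>)" by (intro mult_left_mono) auto
    then show ?thesis by simp
  qed
  moreover have "real k * ln (real k * \<kappa>) \<le> M" "1 \<le> M" by (auto simp: M_def)
  \<comment> \<open>What remains is linear, with \<open>u\<close>, \<open>v\<close>,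
    \<open>w\<close>, \<open>l\<close> for \<open>U\<close>, \<open>k\<close>,
    \<open>k ln (k \<kappa>)\<close>, \<open>k ln 6\<close>; the constant 40 leaves some
    room.\<close>
  moreover have "40 * T \<ge> x" if "2 * u \<le> 3 * w + x / 4 - 3 * v + 3 * l" "l \<le> v * 2" "v \<le> 1 + 3/2 * w" "w \<le> T" "1 \<le> T"
    "x = 8 + 2 * (u + v)" for T u v w l :: real
  proof -
    have "8 * u \<le> 12 * w + x + 12 * v" using that(1,2) by argo
    moreover have "2 * v \<le> 2 + 3 * w" using that(3) by argo
    ultimately show ?thesis using that(4-6) by argo
  qed
  ultimately have "x \<le> 40 * M" using x by blast
  then show ?thesis by (simp add: M_def)
qed

lemma rounding_factor:
  assumes R: "\<And>s. s \<in> {1..t} \<Longrightarrow> \<exists>c \<alpha> A N J U L. rounding d z s c \<alpha> A N J U L"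
    and Rt: "rounding d z t c \<alpha> A N J U L" and t: "1 \<le> t" and z: "z ` {1..t} \<subseteq> Rd d"
  shows "1 / \<alpha> \<le> 40 * max 1 (real (affine_dim (z ` {1..t})) *
           ln (real (affine_dim (z ` {1..t})) * max_ratio d z t))"
proof -
  note R' = roundingD[OF Rt]
  have tri: "triangular d L" using R'(7) by (simp add: factors_def)
  define \<kappa> where "\<kappa> = max_ratio d z t"
  have pos: "0 < inner_par d (z ` {1..s})" if s: "s \<in> {1..t}" for s
  proof -
    have "z ` {1..s} \<subseteq> z ` {1..t}" using s by (intro image_mono) auto
    then have "z ` {1..s} \<subseteq> Rd d" using z by blast
    moreover obtain c \<alpha> A N J U L where "rounding d z s c \<alpha> A N J U L"
      using R[OF s] by (elim exE)
    ultimately show ?thesis by (intro rounding_inner_par_pos)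
  qed
  obtain p where p: "outer_par d (z ` {1..t}) = ereal p" "0 \<le> p"
    by (rule rounding_outer_par[OF Rt z])
  have bound: "ip d q m \<le> \<kappa> / (2 * \<alpha>) * \<eta>" and \<kappa>0: "0 \<le> \<kappa>" if m: "(q, m, \<eta>) \<in> set L" for q m \<eta>
  proof -
    obtain s where s: "s \<in> {1..t}" "inner_par d (z ` {1..s}) \<le> ereal (\<eta> / 2)"
      using R'(10)[OF m] by (elim bexE)
    have "\<alpha> * ip d q m \<le> \<kappa> * (\<eta> / 2)"
      using rounding_width[OF Rt m p(1)] max_ratio_bound(1)[OF pos s(1) p s(2)] by (simp add: \<kappa>_def)
    then show "ip d q m \<le> \<kappa> / (2 * \<alpha>) * \<eta>" using R'(3) by (simp add: field_simps)
    show "0 \<le> \<kappa>" unfolding \<kappa>_def by (rule max_ratio_bound(2)[OF pos s(1) p s(2)])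
  qed
  have "2 ^ U * heights L \<le> (\<kappa> / (2 * \<alpha>)) ^ card J * heights L"
  \<comment> \<open>The sign of \<open>\<kappa>\<close> is derived from an entry of the list, so the
    empty list is treated apart.\<close>
  proof (cases L)
    case Nil
    then show ?thesis using R'(8,9) by simp
  next
    case (Cons e L')
    then obtain q m \<eta> where "(q, m, \<eta>) \<in> set L" by (cases e) auto
    then have "0 \<le> \<kappa> / (2 * \<alpha>)" using \<kappa>0 R'(3) by simp
    then have "vol d L \<le> (\<kappa> / (2 * \<alpha>)) ^ length L * heights L"
      by (rule vol_heights_bound[OF tri _ bound])
    then show ?thesis using R'(8,9) by simp
  qed
  then have vol: "2 ^ U \<le> (\<kappa> * (1 / \<alpha>) / 2) ^ card J"
    using heights_pos[OF tri] by (simp add: mult.commute)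
  have "1 \<le> \<kappa>" if k: "1 \<le> card J"
  proof -
    have "J \<noteq> {}" using k by auto
    then obtain j where j: "j \<in> J" by blast
    have jd: "j < d" using j frameD(1)[OF R'(1)] by auto
    define v where "v = app d A (unit_vec d j)"
    have "app d N v = unit_vec d j"
      unfolding v_def by (rule frameD(3)[OF R'(1)]) (use j in \<open>auto simp: coords_def unit_vec_def\<close>)
    then have "co (app d N v) j = 1" using jd by (simp add: co_unit_vec)
    moreover have "co (app d N 0) j = 0" by (simp add: app_linear)
    ultimately have "v \<noteq> 0" by (intro notI) (simp only: zero_neq_one)
    then have n: "0 < ip d v v" by (intro ip_pos) (auto simp: v_def)
    define q where "q = (1 / sqrt (ip d v v)) *\<^sub>R v"
    have qR: "q \<in> Rd d" by (simp add: q_def v_def)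
    have "sqrt (ip d v v) * sqrt (ip d v v) = ip d v v" using n by simp
    then have qq: "ip d q q = 1" using n by (simp add: q_def field_simps)
    have "v \<in> directions (z ` {1..t})"
      unfolding v_def by (rule app_directions[OF R'(5,3)])
    then have qD: "q \<in> directions (z ` {1..t})"
      unfolding q_def by (rule subspace_scale[OF subspace_directions])
    have io: "inner_par d (z ` {1..t}) \<le> ereal p"
      unfolding p(1)[symmetric] by (rule inner_par_le_outer_par[OF qR qq qD])
    have "0 < inner_par d (z ` {1..t})" using t by (intro pos) simp
    also note io
    finally have "0 < p" by simp
    \<comment> \<open>The time \<open>t' = t\<close> enters the maximum, and there the inner
      parameter is at most \<open>p\<close>.\<close>
    moreover have "p \<le> \<kappa> * p"
      unfolding \<kappa>_def using t by (intro max_ratio_bound(1)[OF pos _ p io]) auto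
    ultimately show ?thesis by simp
  qed
  then show ?thesis
    using factor_bound[OF R'(4) vol] unfolding rounding_affine_dim[OF Rt] \<kappa>_def by simp
qed

section \<open>Running programs\<close>

text \<open>Total correctness with a cost budget. As execution is deterministic, the existence of a
  run speaks about the only run; the budget is an upper bound, so constants may be generous.\<close>

definition wp :: "nat \<Rightarrow> nat \<Rightarrow> com \<Rightarrow> nat \<Rightarrow> (state \<Rightarrow> bool) \<Rightarrow> state \<Rightarrow> bool" where
  "wp S d P K Q s \<longleftrightarrow> (\<exists>k s'. exec S d P s k s' \<and> k \<le> K \<and> Q s')"

text \<open>The layout occupies \<open>2 d + 1 + (2 d + 7) d = 2 d^2 + 9 d + 1\<close> cells, which
  is at most \<open>12 d^2\<close>, with equality for \<open>d = 1\<close>.\<close>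

abbreviation bounded_run :: "nat \<Rightarrow> com \<Rightarrow> nat \<Rightarrow> (state \<Rightarrow> bool) \<Rightarrow> state \<Rightarrow> bool" where
  "bounded_run d \<equiv> wp (12 * d\<^sup>2) d"

lemma wp_mono: "wp S d P K Q s \<Longrightarrow> K \<le> K' \<Longrightarrow> (\<And>s'. Q s' \<Longrightarrow> Q' s') \<Longrightarrow> wp S d P K' Q' s"
  unfolding wp_def by (meson order_trans)

lemma wp_Skip: "Q s \<Longrightarrow> 1 \<le> K \<Longrightarrow> wp S d Skip K Q s"
  unfolding wp_def using exec.Skip by blast

lemma wp_SetReg:
  "ival d s a \<le> S \<Longrightarrow> icost a + 1 \<le> K \<Longrightarrow> Q ((fst s)(x := ival d s a), snd s) \<Longrightarrow> wp S d (SetReg x a) K Q s"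
  unfolding wp_def using exec.SetReg by blast

lemma wp_SetCell:
  "ival d s a < S \<Longrightarrow> rsafe S d s e \<Longrightarrow> icost a + rcost e + 1 \<le> K \<Longrightarrow>
    Q (fst s, (snd s)(ival d s a := rval d s e)) \<Longrightarrow> wp S d (SetCell a e) K Q s"
  unfolding wp_def using exec.SetCell by blast

lemma wp_Then:
  assumes "wp S d P K R s" "\<And>s'. R s' \<Longrightarrow> wp S d P' K' Q s'" "K + K' \<le> K''"
  shows "wp S d (Then P P') K'' Q s"
proof -
  obtain k s' where s': "exec S d P s k s'" "k \<le> K" "R s'" using assms(1) unfolding wp_def by blast
  obtain l s'' where s'': "exec S d P' s' l s''" "l \<le> K'" "Q s''"
    using assms(2)[OF s'(3)] unfolding wp_def by blast
  have "exec S d (Then P P') s (k + l) s''" using s'(1) s''(1) by (rule exec.Then)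
  moreover have "k + l \<le> K''" using s'(2) s''(2) assms(3) by simp
  ultimately show ?thesis using s''(3) unfolding wp_def by blast
qed

lemma wp_Cond:
  assumes "bsafe S d s p" "bval d s p \<Longrightarrow> wp S d P K Q s" "\<not> bval d s p \<Longrightarrow> wp S d P' K Q s"
    "bcost p + 1 + K \<le> K'"
  shows "wp S d (Cond p P P') K' Q s"
proof (cases "bval d s p")
  case True
  then obtain k s' where s': "exec S d P s k s'" "k \<le> K" "Q s'" using assms(2) unfolding wp_def by blast
  have "exec S d (Cond p P P') s (bcost p + 1 + k) s'" using assms(1) True s'(1) by (rule exec.CondTrue)
  moreover have "bcost p + 1 + k \<le> K'" using s'(2) assms(4) by simp
  ultimately show ?thesis using s'(3) unfolding wp_def by blast
next
  case False
  then obtain k s' where s': "exec S d P' s k s'" "k \<le> K" "Q s'" using assms(3) unfolding wp_def by blast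
  have "exec S d (Cond p P P') s (bcost p + 1 + k) s'" using assms(1) False s'(1) by (rule exec.CondFalse)
  moreover have "bcost p + 1 + k \<le> K'" using s'(2) assms(4) by simp
  ultimately show ?thesis using s'(3) unfolding wp_def by blast
qed

definition For :: "nat \<Rightarrow> com \<Rightarrow> com" where
  "For x P = Then (SetReg x (INum 0))
     (Loop (ILess (Reg x) Dimension) (Then P (SetReg x (IPlus (Reg x) (INum 1)))))"

text \<open>Beyond the body each round costs 4 for the test and 4 for the increment; 6 pays for the
  initialization and the last test. The counter ends at \<open>d\<close>, which must be assignable,
  hence \<open>d \<le> S\<close>.\<close>

lemma wp_For:
  assumes dS: "d \<le> S"
    and body: "\<And>i s. i < d \<Longrightarrow> fst s x = i \<Longrightarrow> I i (fst s) (snd s) \<Longrightarrow>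
      wp S d P K (\<lambda>s'. fst s' x = i \<and> I (Suc i) (fst s') (snd s')) s"
    and irrelevant: "\<And>i r m v. I i r m \<Longrightarrow> I i (r(x := v)) m"
    and init: "I 0 (fst s) (snd s)" and K': "d * (K + 8) + 6 \<le> K'"
    and post: "\<And>s'. I d (fst s') (snd s') \<Longrightarrow> Q s'"
  shows "wp S d (For x P) K' Q s"
proof -
  define B where "B = Then P (SetReg x (IPlus (Reg x) (INum 1)))"
  have loop: "wp S d (Loop (ILess (Reg x) Dimension) B) ((d - i) * (K + 8) + 4) (\<lambda>s'. I d (fst s') (snd s')) s"
    if "i \<le> d" "fst s x = i" "I i (fst s) (snd s)" for i s
    using that
  proof (induction "d - i" arbitrary: i s)
    case 0
    then have "exec S d (Loop (ILess (Reg x) Dimension) B) s (bcost (ILess (Reg x) Dimension) + 1) s"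
      by (intro exec.LoopFalse) auto
    moreover have "i = d" using 0 by simp
    ultimately show ?case using 0 unfolding wp_def by (intro exI[of _ "bcost (ILess (Reg x) Dimension) + 1"] exI[of _ s]) auto
  next
    case (Suc n)
    have i: "i < d" using Suc.hyps(2) by simp
    obtain k s' where s': "exec S d P s k s'" "k \<le> K" "fst s' x = i" "I (Suc i) (fst s') (snd s')"
      using body[OF i Suc.prems(2,3)] unfolding wp_def by blast
    define s1 where "s1 = ((fst s')(x := Suc i), snd s')"
    have "exec S d (SetReg x (IPlus (Reg x) (INum 1))) s' (icost (IPlus (Reg x) (INum 1)) + 1)
        ((fst s')(x := ival d s' (IPlus (Reg x) (INum 1))), snd s')"
      using i dS s'(3) by (intro exec.SetReg) simp
    then have "exec S d (SetReg x (IPlus (Reg x) (INum 1))) s' 4 s1"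
      using s'(3) by (simp add: s1_def eval_nat_numeral)
    with s'(1) have B: "exec S d B s (k + 4) s1" unfolding B_def by (rule exec.Then)
    have "wp S d (Loop (ILess (Reg x) Dimension) B) ((d - Suc i) * (K + 8) + 4) (\<lambda>s'. I d (fst s') (snd s')) s1"
      using Suc.hyps(2) i irrelevant[OF s'(4)] by (intro Suc.hyps(1)) (auto simp: s1_def)
    then obtain l s2 where s2: "exec S d (Loop (ILess (Reg x) Dimension) B) s1 l s2"
      "l \<le> (d - Suc i) * (K + 8) + 4" "I d (fst s2) (snd s2)"
      unfolding wp_def by blast
    have "exec S d (Loop (ILess (Reg x) Dimension) B) s (bcost (ILess (Reg x) Dimension) + 1 + (k + 4) + l) s2"
      using i Suc.prems(2) by (intro exec.LoopTrue[OF _ _ B s2(1)]) auto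
    moreover have "d - i = Suc (d - Suc i)" using i by simp
    then have "bcost (ILess (Reg x) Dimension) + 1 + (k + 4) + l \<le> (d - i) * (K + 8) + 4"
      using s2(2) s'(2) by simp
    ultimately show ?case using s2(3) unfolding wp_def by blast
  qed
  have "wp S d (SetReg x (INum 0)) 2 (\<lambda>s'. fst s' x = 0 \<and> I 0 (fst s') (snd s')) s"
    using irrelevant[OF init] by (intro wp_SetReg) auto
  then have "wp S d (For x P) (d * (K + 8) + 6) (\<lambda>s'. I d (fst s') (snd s')) s"
    unfolding For_def B_def[symmetric] by (rule wp_Then[where K' = "d * (K + 8) + 4"]) (use loop[of 0] in auto)
  then show ?thesis by (rule wp_mono) (use K' post in auto)
qed

text \<open>
  Memory layout: the arriving point \<open>z\<close>, overwritten by \<open>u = z - c\<close>, the center, the factor, and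
  then a table with rows of length \<open>d\<close>: the matrix, its inverse on the span, the flags of the active
  columns, the coordinates \<open>y\<close> of \<open>u\<close>, the vectors \<open>f\<close>, \<open>g\<close>, \<open>h\<close> of the rank one updates, \<open>h\<^sup>T N\<close>,
  and a row whose first cell holds \<open>\<langle>y, y\<rangle>\<close>. Register 0 is set once the first point has arrived,
  registers 1 and 2 are loop counters, and register 3 holds the pivot, or \<open>d\<close> if there is none.
\<close>

definition adr :: "nat \<Rightarrow> nat \<Rightarrow> nat \<Rightarrow> nat" where
  "adr d r j = 2 * d + 1 + r * d + j"

text \<open>Memory as two functions, so that the effect of a program becomes a function update and
  disjointness of addresses is settled once. Address \<open>2 d\<close>, the factor, belongs to
  \<open>lo\<close>.\<close>

definition mem_view :: "nat \<Rightarrow> (nat \<Rightarrow> real) \<Rightarrow> (nat \<Rightarrow> real) \<Rightarrow> (nat \<Rightarrow> nat \<Rightarrow> real) \<Rightarrow> bool" where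
  "mem_view d m lo tab \<longleftrightarrow> (\<forall>p\<le>2*d. m p = lo p) \<and> (\<forall>r<2*d+7. \<forall>j<d. m (adr d r j) = tab r j)"

abbreviation view :: "nat \<Rightarrow> state \<Rightarrow> (nat \<Rightarrow> real) \<Rightarrow> (nat \<Rightarrow> nat \<Rightarrow> real) \<Rightarrow> bool" where
  "view d s \<equiv> mem_view d (snd s)"

lemma adr_inj: "j < d \<Longrightarrow> j' < d \<Longrightarrow> adr d r j = adr d r' j' \<longleftrightarrow> r = r' \<and> j = j'"
proof -
  assume j: "j < d" "j' < d"
  have "adr d r j = adr d r' j' \<longleftrightarrow> r * d + j = r' * d + j'" by (simp add: adr_def)
  also have "\<dots> \<longleftrightarrow> r = r' \<and> j = j'"
  proof
    assume e: "r * d + j = r' * d + j'"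
    then have "(r * d + j) div d = (r' * d + j') div d" by simp
    then have "r = r'" using j by simp
    then show "r = r' \<and> j = j'" using e by simp
  qed simp
  finally show ?thesis .
qed

lemma adr_less:
  assumes "r < 2 * d + 7" "j < d"
  shows "adr d r j < 12 * d\<^sup>2"
proof -
  have "r * d \<le> (2 * d + 6) * d" using assms by (intro mult_right_mono) auto
  also have "\<dots> = 2 * d\<^sup>2 + 6 * d" by (simp add: power2_eq_square algebra_simps)
  finally have "r * d \<le> 2 * d\<^sup>2 + 6 * d" .
  moreover have "d \<le> d\<^sup>2" using assms by (simp add: power2_eq_square)
  ultimately show ?thesis using assms(2) unfolding adr_def by linarith
qed

lemma low_less:
  fixes d p :: nat
  assumes "0 < d" "p \<le> 2 * d"
  shows "p < 12 * d\<^sup>2"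
proof -
  have "d \<le> d\<^sup>2" using assms by (simp add: power2_eq_square)
  then show ?thesis using assms by linarith
qed

lemma mem_view_low: "mem_view d m lo tab \<Longrightarrow> p \<le> 2 * d \<Longrightarrow> m p = lo p"
  and mem_view_adr: "mem_view d m lo tab \<Longrightarrow> r < 2 * d + 7 \<Longrightarrow> j < d \<Longrightarrow> m (adr d r j) = tab r j"
  by (auto simp: mem_view_def)

lemma mem_view_set_low:
  "mem_view d m lo tab \<Longrightarrow> p \<le> 2 * d \<Longrightarrow> mem_view d (m(p := x)) (lo(p := x)) tab"
  by (auto simp: mem_view_def adr_def)

lemma mem_view_set_adr:
  "mem_view d m lo tab \<Longrightarrow> j < d \<Longrightarrow> mem_view d (m(adr d r j := x)) lo (tab(r := (tab r)(j := x)))"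
  by (auto simp: mem_view_def adr_inj) (auto simp: adr_def)

lemma mem_view_cong:
  "mem_view d m lo tab \<Longrightarrow> (\<And>p. p \<le> 2 * d \<Longrightarrow> lo p = lo' p) \<Longrightarrow>
    (\<And>r j. r < 2 * d + 7 \<Longrightarrow> j < d \<Longrightarrow> tab r j = tab' r j) \<Longrightarrow> mem_view d m lo' tab'"
  by (auto simp: mem_view_def)

definition Tab :: "iexp \<Rightarrow> iexp \<Rightarrow> iexp" where
  "Tab r j = IPlus (IPlus (IPlus (ITimes (INum 2) Dimension) (INum 1)) (ITimes r Dimension)) j"

definition Extra :: "nat \<Rightarrow> iexp" where
  "Extra k = IPlus (ITimes (INum 2) Dimension) (INum k)"

definition Center :: "iexp \<Rightarrow> iexp" where
  "Center j = IPlus Dimension j"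

definition Factor :: rexp where
  "Factor = Cell (ITimes (INum 2) Dimension)"

abbreviation Inverse :: "iexp \<Rightarrow> iexp \<Rightarrow> iexp" where
  "Inverse r j \<equiv> Tab (IPlus Dimension r) j"

lemma ival_layout [simp]:
  "ival d s (Tab r j) = adr d (ival d s r) (ival d s j)" "ival d s (Extra k) = 2 * d + k"
  "ival d s (Center j) = d + ival d s j" "rval d s Factor = snd s (2 * d)"
  "rsafe S d s Factor = (2 * d < S)"
  by (simp_all add: Tab_def Extra_def Center_def Factor_def adr_def)

lemma icost_layout [simp]:
  "icost (Tab r j) = icost r + icost j + 9" "icost (Extra k) = 5" "icost (Center j) = icost j + 2"
  "rcost Factor = 4"
  by (simp_all add: Tab_def Extra_def Center_def Factor_def)

definition Scale :: rexp where
  "Scale = RPlus (RNum 1) (RDivide Factor (RNum 4))"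

definition Two_factor :: rexp where
  "Two_factor = RPlus (RNum 1) (RTimes (RNum 2) Factor)"

lemma rval_scale [simp]:
  "rval d s Scale = 1 + snd s (2 * d) / 4" "rval d s Two_factor = 1 + 2 * snd s (2 * d)"
  "rsafe S d s Scale = (2 * d < S)" "rsafe S d s Two_factor = (2 * d < S)"
  "rcost Scale = 8" "rcost Two_factor = 8"
  by (simp_all add: Scale_def Two_factor_def)

section \<open>Subroutines: residual, matrix-vector product, pivot search, rank one update\<close>

definition residual_prog :: com where
  "residual_prog = For 1 (SetCell (Reg 1) (RMinus (Cell (Reg 1)) (Cell (Center (Reg 1)))))"

lemma quadratic_costs:
  fixes d :: nat
  assumes "0 < d"
  shows "d * K + K' \<le> (K + K') * d\<^sup>2"
proof -
  have "d * K \<le> d * d * K" "1 * K' \<le> d * d * K'"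
    using assms by (intro mult_right_mono; simp)+
  then have "d * K + K' \<le> d * d * K + d * d * K'" by linarith
  then show ?thesis by (simp add: power2_eq_square algebra_simps)
qed

lemma wp_residual:
  assumes d: "0 < d" and m: "view d s lo tab" "fst s 0 = r0"
  shows "bounded_run d residual_prog (100 * d\<^sup>2)
    (\<lambda>s'. fst s' 0 = r0 \<and> view d s' (\<lambda>p. if p < d then lo p - lo (d + p) else lo p) tab) s"
  unfolding residual_prog_def
proof (rule wp_For[where K = 20 and I = "\<lambda>i r m. r 0 = r0 \<and>
    mem_view d m (\<lambda>p. if p < i then lo p - lo (d + p) else lo p) tab"])
  fix i and s :: state
  assume i: "i < d" and s: "fst s 1 = i" "fst s 0 = r0 \<and>
    view d s (\<lambda>p. if p < i then lo p - lo (d + p) else lo p) tab"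
  note v = conjunct2[OF s(2)]
  have "mem_view d ((snd s)(i := lo i - lo (d + i))) (\<lambda>p. if p < Suc i then lo p - lo (d + p) else lo p) tab"
    by (rule mem_view_cong[OF mem_view_set_low[OF v]]) (use i in auto)
  then show "bounded_run d (SetCell (Reg 1) (RMinus (Cell (Reg 1)) (Cell (Center (Reg 1))))) 20
    (\<lambda>s'. fst s' 1 = i \<and> fst s' 0 = r0 \<and>
      view d s' (\<lambda>p. if p < Suc i then lo p - lo (d + p) else lo p) tab) s"
    using i s low_less[OF d] by (intro wp_SetCell) (auto simp: mem_view_low[OF v])
qed (use d m quadratic_costs[OF d, of 28 6] low_less[OF d, of d] in auto)

text \<open>\<open>e\<close> reads the row index from register 1 and the summation index from
  register 2. It is used for \<open>y = N u\<close> and for \<open>h^T N\<close>.\<close>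

definition dot_prog :: "nat \<Rightarrow> rexp \<Rightarrow> com" where
  "dot_prog k e = For 1 (Then (SetCell (Tab (Extra k) (Reg 1)) (RNum 0))
     (For 2 (SetCell (Tab (Extra k) (Reg 1)) (RPlus (Cell (Tab (Extra k) (Reg 1))) e))))"

text \<open>\<open>e\<close> is evaluated while row \<open>2 d + k\<close> is being overwritten, so
  its value must be the same for all tables that agree with \<open>tab\<close> elsewhere.\<close>

lemma wp_dot:
  assumes d: "0 < d" and k: "k < 7" and m: "view d s lo tab" "fst s 0 = r0" "fst s 3 = r3"
    and e: "rcost e \<le> 40"
      "\<And>s' tab'. fst s' 1 < d \<Longrightarrow> fst s' 2 < d \<Longrightarrow> view d s' lo tab' \<Longrightarrow>
        (\<And>r. r \<noteq> 2 * d + k \<Longrightarrow> tab' r = tab r) \<Longrightarrow>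
        rsafe (12 * d\<^sup>2) d s' e \<and> rval d s' e = w (fst s' 1) (fst s' 2)"
  shows "bounded_run d (dot_prog k e) (300 * d\<^sup>2)
    (\<lambda>s'. fst s' 0 = r0 \<and> fst s' 3 = r3 \<and>
      view d s' lo (tab(2 * d + k := \<lambda>i. \<Sum>j<d. w i j))) s"
  unfolding dot_prog_def
proof (rule wp_For[where K = "d * 88 + 30" and I = "\<lambda>i r m. r 0 = r0 \<and> r 3 = r3 \<and>
    mem_view d m lo (tab(2 * d + k := \<lambda>l. if l < i then \<Sum>j<d. w l j else tab (2 * d + k) l))"])
  let ?zero = "SetCell (Tab (Extra k) (Reg 1)) (RNum 0)"
  let ?add = "SetCell (Tab (Extra k) (Reg 1)) (RPlus (Cell (Tab (Extra k) (Reg 1))) e)"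
  fix i and s :: state
  define tab1 where "tab1 = tab(2 * d + k := \<lambda>l. if l < i then \<Sum>j<d. w l j else tab (2 * d + k) l)"
  assume i: "i < d" and s: "fst s 1 = i" "fst s 0 = r0 \<and> fst s 3 = r3 \<and>
    view d s lo (tab(2 * d + k := \<lambda>l. if l < i then \<Sum>j<d. w l j else tab (2 * d + k) l))"
  have v: "view d s lo tab1" using s(2) by (simp add: tab1_def)
  define tab2 where "tab2 n = tab1(2 * d + k := (tab1 (2 * d + k))(i := \<Sum>j<n. w i j))" for n
  have kd: "2 * d + k < 2 * d + 7" using k by simp
  have zero: "bounded_run d (?zero) 17
      (\<lambda>s'. fst s' 1 = i \<and> fst s' 0 = r0 \<and> fst s' 3 = r3 \<and> view d s' lo (tab2 0)) s"
    using i s adr_less[OF kd i] mem_view_set_adr[OF v i, of "2 * d + k" 0]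
    by (intro wp_SetCell) (auto simp: tab2_def)
  have inner: "bounded_run d (For 2 (?add))
      (d * 88 + 6) (\<lambda>s'. fst s' 1 = i \<and> fst s' 0 = r0 \<and> fst s' 3 = r3 \<and> view d s' lo (tab2 d)) s'"
    if s': "fst s' 1 = i \<and> fst s' 0 = r0 \<and> fst s' 3 = r3 \<and> view d s' lo (tab2 0)" for s'
  proof (rule wp_For[where K = 80 and I = "\<lambda>n r m. r 1 = i \<and> r 0 = r0 \<and> r 3 = r3 \<and> mem_view d m lo (tab2 n)"])
    fix n and s :: state
    assume n: "n < d" and s: "fst s 2 = n" "fst s 1 = i \<and> fst s 0 = r0 \<and> fst s 3 = r3 \<and> view d s lo (tab2 n)"
    have v: "view d s lo (tab2 n)" using s by simp
    have ev: "rsafe (12 * d\<^sup>2) d s e \<and> rval d s e = w i n"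
      using e(2)[OF _ _ v] n i s by (auto simp: tab2_def tab1_def)
    have "mem_view d ((snd s)(adr d (2 * d + k) i := (\<Sum>j<n. w i j) + w i n)) lo (tab2 (Suc n))"
      using mem_view_set_adr[OF v i, of "2 * d + k" "(\<Sum>j<n. w i j) + w i n"] by (simp add: tab2_def)
    moreover have "snd s (adr d (2 * d + k) i) = (\<Sum>j<n. w i j)"
      using mem_view_adr[OF v kd i] by (simp add: tab2_def)
    ultimately show "bounded_run d (?add) 80
        (\<lambda>s'. fst s' 2 = n \<and> fst s' 1 = i \<and> fst s' 0 = r0 \<and> fst s' 3 = r3 \<and> view d s' lo (tab2 (Suc n))) s"
      using i n s ev e(1) adr_less[OF kd i] by (intro wp_SetCell) auto
  qed (use s' d low_less[OF d, of d] in auto)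
  show "bounded_run d (Then (?zero)
      (For 2 (?add))) (d * 88 + 30)
      (\<lambda>s'. fst s' 1 = i \<and> fst s' 0 = r0 \<and> fst s' 3 = r3 \<and>
        view d s' lo (tab(2 * d + k := \<lambda>l. if l < Suc i then \<Sum>j<d. w l j else tab (2 * d + k) l))) s"
  proof (rule wp_mono[OF wp_Then[OF zero inner]])
    fix s' assume "fst s' 1 = i \<and> fst s' 0 = r0 \<and> fst s' 3 = r3 \<and> view d s' lo (tab2 d)"
    moreover have "view d s' lo (tab(2 * d + k := \<lambda>l. if l < Suc i then \<Sum>j<d. w l j else tab (2 * d + k) l))"
      if "view d s' lo (tab2 d)"
      by (rule mem_view_cong[OF that]) (auto simp: tab2_def tab1_def)
    ultimately show "fst s' 1 = i \<and> fst s' 0 = r0 \<and> fst s' 3 = r3 \<and>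
        view d s' lo (tab(2 * d + k := \<lambda>l. if l < Suc i then \<Sum>j<d. w l j else tab (2 * d + k) l))"
      by simp
  qed auto
next
  have "d * (d * 88 + 30 + 8) + 6 = 88 * d\<^sup>2 + (d * 38 + 6)"
    by (simp add: power2_eq_square algebra_simps)
  then show "d * (d * 88 + 30 + 8) + 6 \<le> 300 * d\<^sup>2"
    using quadratic_costs[OF d, of 38 6] by simp
  fix s' :: state
  assume s': "fst s' 0 = r0 \<and> fst s' 3 = r3 \<and>
    view d s' lo (tab(2 * d + k := \<lambda>l. if l < d then \<Sum>j<d. w l j else tab (2 * d + k) l))"
  then have v: "view d s' lo (tab(2 * d + k := \<lambda>l. if l < d then \<Sum>j<d. w l j else tab (2 * d + k) l))" by simp
  have "view d s' lo (tab(2 * d + k := \<lambda>i. \<Sum>j<d. w i j))"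
    by (rule mem_view_cong[OF v]) auto
  then show "fst s' 0 = r0 \<and> fst s' 3 = r3 \<and> view d s' lo (tab(2 * d + k := \<lambda>i. \<Sum>j<d. w i j))"
    using s' by simp
qed (use d m low_less[OF d, of d] in auto)

text \<open>Being nonzero is tested as \<open>0 < y * y\<close>, because reals can only be compared
  by \<open><\<close>. If several coordinates qualify as pivot, the last one is kept.\<close>

definition scan_prog :: com where
  "scan_prog = Then (SetReg 3 Dimension) (Then (SetCell (Tab (Extra 6) (INum 0)) (RNum 0))
     (For 1 (Then (SetCell (Tab (Extra 6) (INum 0)) (RPlus (Cell (Tab (Extra 6) (INum 0)))
         (RTimes (Cell (Tab (Extra 1) (Reg 1))) (Cell (Tab (Extra 1) (Reg 1))))))
       (Cond (Conj (RLess (Cell (Tab (Extra 0) (Reg 1))) (RNum 1))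
           (RLess (RNum 0) (RTimes (Cell (Tab (Extra 1) (Reg 1))) (Cell (Tab (Extra 1) (Reg 1))))))
         (SetReg 3 (Reg 1)) Skip))))"

lemma wp_scan:
  assumes d: "0 < d" and m: "view d s lo tab" "fst s 0 = r0"
  defines "out \<equiv> \<lambda>i. tab (2 * d) i < 1 \<and> tab (2 * d + 1) i \<noteq> 0"
  shows "bounded_run d scan_prog (300 * d\<^sup>2)
    (\<lambda>s'. fst s' 0 = r0 \<and> ((fst s' 3 = d \<and> (\<forall>i<d. \<not> out i)) \<or> (fst s' 3 < d \<and> out (fst s' 3))) \<and>
      view d s' lo (tab(2 * d + 6 := (tab (2 * d + 6))(0 := \<Sum>i<d. (tab (2 * d + 1) i)\<^sup>2)))) s"
proof -
  let ?acc = "SetCell (Tab (Extra 6) (INum 0)) (RPlus (Cell (Tab (Extra 6) (INum 0))) (RTimes (Cell (Tab (Extra 1) (Reg 1))) (Cell (Tab (Extra 1) (Reg 1)))))"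
  let ?test = "Conj (RLess (Cell (Tab (Extra 0) (Reg 1))) (RNum 1)) (RLess (RNum 0) (RTimes (Cell (Tab (Extra 1) (Reg 1))) (Cell (Tab (Extra 1) (Reg 1)))))"
  define tab1 where "tab1 n = tab(2 * d + 6 := (tab (2 * d + 6))(0 := \<Sum>i<n. (tab (2 * d + 1) i)\<^sup>2))" for n
  define I where "I n r m \<longleftrightarrow> r 0 = r0 \<and> ((r 3 = d \<and> (\<forall>i<n. \<not> out i)) \<or> (r 3 < d \<and> out (r 3))) \<and>
      mem_view d m lo (tab1 n)" for n and r :: "nat \<Rightarrow> nat" and m
  have step1: "bounded_run d (SetReg 3 Dimension) 2
      (\<lambda>s'. fst s' 0 = r0 \<and> fst s' 3 = d \<and> view d s' lo tab) s"
    using m d low_less[OF d, of d] by (intro wp_SetReg) auto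
  have step2: "bounded_run d (SetCell (Tab (Extra 6) (INum 0)) (RNum 0)) 17 (\<lambda>s'. I 0 (fst s') (snd s')) s'"
    if "fst s' 0 = r0 \<and> fst s' 3 = d \<and> view d s' lo tab" for s'
    using that d adr_less[of "2 * d + 6" d 0] mem_view_set_adr[of d "snd s'" lo tab 0 "2 * d + 6" 0]
    by (intro wp_SetCell) (auto simp: I_def tab1_def)
  have body: "bounded_run d (Then (?acc)
       (Cond (?test)
         (SetReg 3 (Reg 1)) Skip)) 200 (\<lambda>s'. fst s' 1 = i \<and> I (Suc i) (fst s') (snd s')) s"
    if i: "i < d" and s: "fst s 1 = i" "I i (fst s) (snd s)" for i s
  proof -
    have v: "view d s lo (tab1 i)" using s by (simp add: I_def)
    have y: "snd s (adr d (2 * d + 1) i) = tab (2 * d + 1) i" "snd s (adr d (2 * d + 6) 0) = (\<Sum>i<i. (tab (2 * d + 1) i)\<^sup>2)"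
      using mem_view_adr[OF v, of "2 * d + 1" i] mem_view_adr[OF v, of "2 * d + 6" 0] i by (auto simp: tab1_def)
    have v': "mem_view d ((snd s)(adr d (2 * d + 6) 0 := (\<Sum>i<Suc i. (tab (2 * d + 1) i)\<^sup>2))) lo (tab1 (Suc i))"
      using mem_view_set_adr[OF v d, of "2 * d + 6" "\<Sum>i<Suc i. (tab (2 * d + 1) i)\<^sup>2"] by (simp add: tab1_def)
    have a: "adr d (2 * d) i < 12 * d\<^sup>2" "adr d (2 * d + 1) i < 12 * d\<^sup>2" "adr d (2 * d + 6) 0 < 12 * d\<^sup>2"
      using i by (auto intro!: adr_less)
    have 1: "bounded_run d (?acc) 80
       (\<lambda>s'. fst s' = fst s \<and> view d s' lo (tab1 (Suc i))) s"
      using s(1) a y v' by (intro wp_SetCell) (auto simp: power2_eq_square)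
    show ?thesis
    proof (rule wp_Then[OF 1])
      fix s' assume s': "fst s' = fst s \<and> view d s' lo (tab1 (Suc i))"
      then have v'': "view d s' lo (tab1 (Suc i))" by simp
      have y': "snd s' (adr d (2 * d + 1) i) = tab (2 * d + 1) i" "snd s' (adr d (2 * d) i) = tab (2 * d) i"
        using mem_view_adr[OF v'', of "2 * d + 1" i] mem_view_adr[OF v'', of "2 * d" i] i by (auto simp: tab1_def)
      have lt: "i < 12 * d\<^sup>2" using low_less[OF d, of i] i by simp
      have pos: "0 < y * y \<longleftrightarrow> y \<noteq> (0::real)" for y
        using zero_le_square[of y] by (auto simp: less_le)
      show "bounded_run d (Cond (?test)
         (SetReg 3 (Reg 1)) Skip) 100 (\<lambda>s'. fst s' 1 = i \<and> I (Suc i) (fst s') (snd s')) s'"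
      proof (rule wp_Cond[where K = 10])
        show "bounded_run d (SetReg 3 (Reg 1)) 10 (\<lambda>s'. fst s' 1 = i \<and> I (Suc i) (fst s') (snd s')) s'"
          if "bval d s' (?test)"
          using that i s s' y' v'' lt by (intro wp_SetReg) (auto simp: I_def out_def pos)
        show "bounded_run d Skip 10 (\<lambda>s'. fst s' 1 = i \<and> I (Suc i) (fst s') (snd s')) s'"
          if "\<not> bval d s' (?test)"
          using that i s s' y' v'' by (intro wp_Skip) (auto simp: I_def out_def pos less_Suc_eq)
      qed (use s s' a in auto)
    qed simp
  qed
  have loop: "bounded_run d (For 1 (Then (?acc)
       (Cond (?test)
         (SetReg 3 (Reg 1)) Skip))) (d * 208 + 6) (\<lambda>s'. I d (fst s') (snd s')) s'"
    if "I 0 (fst s') (snd s')" for s'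
    by (rule wp_For[where K = 200 and I = I]) (use that body low_less[OF d, of d] d in \<open>auto simp: I_def\<close>)
  show ?thesis
    unfolding scan_prog_def
    apply (rule wp_Then[OF step1, where K' = "d * 208 + 23"])
     apply (rule wp_Then[OF step2, where K' = "d * 208 + 6"], assumption)
      apply (rule wp_mono[OF loop], assumption)
    using quadratic_costs[OF d, of 208 25] by (auto simp: I_def tab1_def)
qed

definition set_fgh :: "rexp \<Rightarrow> rexp \<Rightarrow> rexp \<Rightarrow> com" where
  "set_fgh f g h = Then (SetCell (Tab (Extra 2) (Reg 1)) f)
     (Then (SetCell (Tab (Extra 3) (Reg 1)) g) (SetCell (Tab (Extra 4) (Reg 1)) h))"

definition put_fgh :: "nat \<Rightarrow> nat \<Rightarrow> real \<Rightarrow> real \<Rightarrow> real \<Rightarrow> (nat \<Rightarrow> nat \<Rightarrow> real) \<Rightarrow> nat \<Rightarrow> nat \<Rightarrow> real" where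
  "put_fgh d i f g h tab = tab(2 * d + 2 := (tab (2 * d + 2))(i := f),
     2 * d + 3 := (tab (2 * d + 3))(i := g), 2 * d + 4 := (tab (2 * d + 4))(i := h))"

lemma wp_set_fgh:
  assumes v: "view d s lo tab" and i: "i < d" "fst s 1 = i"
    and c: "rcost f \<le> 120" "rcost g \<le> 120" "rcost h \<le> 120"
    and e: "\<And>s' tab'. fst s' = fst s \<Longrightarrow> view d s' lo tab' \<Longrightarrow>
        (\<And>r. r \<notin> {2 * d + 2, 2 * d + 3, 2 * d + 4} \<Longrightarrow> tab' r = tab r) \<Longrightarrow>
        rsafe (12 * d\<^sup>2) d s' f \<and> rval d s' f = f' \<and> rsafe (12 * d\<^sup>2) d s' g \<and> rval d s' g = g' \<and>
        rsafe (12 * d\<^sup>2) d s' h \<and> rval d s' h = h'"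
  shows "bounded_run d (set_fgh f g h) 500
    (\<lambda>s'. fst s' = fst s \<and> view d s' lo (put_fgh d i f' g' h' tab)) s"
proof -
  have a: "adr d (2 * d + k) i < 12 * d\<^sup>2" if "k < 7" for k using that i by (intro adr_less) auto
  define tab1 where "tab1 = tab(2 * d + 2 := (tab (2 * d + 2))(i := f'))"
  define tab2 where "tab2 = tab1(2 * d + 3 := (tab1 (2 * d + 3))(i := g'))"
  have 1: "bounded_run d (SetCell (Tab (Extra 2) (Reg 1)) f) 150
      (\<lambda>s'. fst s' = fst s \<and> view d s' lo tab1) s"
    using e[OF refl v] mem_view_set_adr[OF v i(1), of "2 * d + 2" f'] i a[of 2] c
    by (intro wp_SetCell) (auto simp: tab1_def)
  have 2: "bounded_run d (SetCell (Tab (Extra 3) (Reg 1)) g) 150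
      (\<lambda>s'. fst s' = fst s \<and> view d s' lo tab2) s'"
    if s': "fst s' = fst s \<and> view d s' lo tab1" for s'
    using e[of s' tab1] s' mem_view_set_adr[of d "snd s'" lo tab1 i "2 * d + 3" g'] i a[of 3] c
    by (intro wp_SetCell) (auto simp: tab2_def tab1_def)
  have 3: "bounded_run d (SetCell (Tab (Extra 4) (Reg 1)) h) 150
      (\<lambda>s'. fst s' = fst s \<and> view d s' lo (put_fgh d i f' g' h' tab)) s'"
    if s': "fst s' = fst s \<and> view d s' lo tab2" for s'
    using e[of s' tab2] s' mem_view_set_adr[of d "snd s'" lo tab2 i "2 * d + 4" h'] i a[of 4] c
    by (intro wp_SetCell) (auto simp: tab2_def tab1_def put_fgh_def)
  show ?thesis
    unfolding set_fgh_def
    apply (rule wp_Then[OF 1, where K' = 300])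
     apply (rule wp_Then[OF 2, where K' = 150], assumption)
      apply (rule 3)
    by auto
qed

lemma wp_vectors:
  assumes d: "0 < d" and m: "view d s lo tab" "fst s 0 = r0" "fst s 3 = r3"
    and B: "\<And>s' tab'. fst s' 1 < d \<Longrightarrow> fst s' 3 = r3 \<Longrightarrow> view d s' lo tab' \<Longrightarrow>
        (\<And>r. r \<notin> {2 * d + 2, 2 * d + 3, 2 * d + 4} \<Longrightarrow> tab' r = tab r) \<Longrightarrow>
        bounded_run d B 600 (\<lambda>s''. fst s'' = fst s' \<and>
          view d s'' lo (put_fgh d (fst s' 1) (f (fst s' 1)) (g (fst s' 1)) (h (fst s' 1)) tab')) s'"
  shows "bounded_run d (For 1 B) (700 * d\<^sup>2) (\<lambda>s'. fst s' 0 = r0 \<and> fst s' 3 = r3 \<and>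
    view d s' lo (tab(2 * d + 2 := f, 2 * d + 3 := g, 2 * d + 4 := h))) s"
proof (rule wp_For[where K = 600 and I = "\<lambda>i r m. r 0 = r0 \<and> r 3 = r3 \<and>
    mem_view d m lo (tab(2 * d + 2 := \<lambda>l. if l < i then f l else tab (2 * d + 2) l,
      2 * d + 3 := \<lambda>l. if l < i then g l else tab (2 * d + 3) l,
      2 * d + 4 := \<lambda>l. if l < i then h l else tab (2 * d + 4) l))"])
  fix i and s :: state
  define tab1 where "tab1 i = tab(2 * d + 2 := \<lambda>l. if l < i then f l else tab (2 * d + 2) l,
      2 * d + 3 := \<lambda>l. if l < i then g l else tab (2 * d + 3) l,
      2 * d + 4 := \<lambda>l. if l < i then h l else tab (2 * d + 4) l)" for i
  assume i: "i < d" "fst s 1 = i" and s: "fst s 0 = r0 \<and> fst s 3 = r3 \<and>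
    view d s lo (tab(2 * d + 2 := \<lambda>l. if l < i then f l else tab (2 * d + 2) l,
      2 * d + 3 := \<lambda>l. if l < i then g l else tab (2 * d + 3) l,
      2 * d + 4 := \<lambda>l. if l < i then h l else tab (2 * d + 4) l))"
  then have s: "fst s 0 = r0" "fst s 3 = r3" "view d s lo (tab1 i)" by (simp_all add: tab1_def)
  have cong: "mem_view d m lo (tab1 (Suc i))" if "mem_view d m lo (put_fgh d i (f i) (g i) (h i) (tab1 i))" for m
    by (rule mem_view_cong[OF that]) (auto simp: put_fgh_def tab1_def less_Suc_eq)
  have "bounded_run d B 600 (\<lambda>s''. fst s'' = fst s \<and>
          view d s'' lo (put_fgh d (fst s 1) (f (fst s 1)) (g (fst s 1)) (h (fst s 1)) (tab1 i))) s"
    using i s by (intro B) (auto simp: tab1_def)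
  then show "bounded_run d B 600 (\<lambda>s'. fst s' 1 = i \<and> fst s' 0 = r0 \<and> fst s' 3 = r3 \<and>
    view d s' lo (tab(2 * d + 2 := \<lambda>l. if l < Suc i then f l else tab (2 * d + 2) l,
      2 * d + 3 := \<lambda>l. if l < Suc i then g l else tab (2 * d + 3) l,
      2 * d + 4 := \<lambda>l. if l < Suc i then h l else tab (2 * d + 4) l))) s"
    unfolding tab1_def[of "Suc i", symmetric] by (rule wp_mono) (use i s cong in auto)
next
  fix s' :: state
  assume s': "fst s' 0 = r0 \<and> fst s' 3 = r3 \<and>
    view d s' lo (tab(2 * d + 2 := \<lambda>l. if l < d then f l else tab (2 * d + 2) l,
      2 * d + 3 := \<lambda>l. if l < d then g l else tab (2 * d + 3) l,
      2 * d + 4 := \<lambda>l. if l < d then h l else tab (2 * d + 4) l))"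
  note v = conjunct2[OF conjunct2[OF s']]
  have "view d s' lo (tab(2 * d + 2 := f, 2 * d + 3 := g, 2 * d + 4 := h))"
    by (rule mem_view_cong[OF v]) auto
  then show "fst s' 0 = r0 \<and> fst s' 3 = r3 \<and> view d s' lo (tab(2 * d + 2 := f, 2 * d + 3 := g, 2 * d + 4 := h))"
    using s' by simp
qed (use d m low_less[OF d, of d] quadratic_costs[OF d, of 608 6] in auto)

text \<open>In-place overwriting is safe: apart from the vectors and the precomputed row
  \<open>h^T N\<close>, each entry depends on its own old value only.\<close>

definition matrix_prog :: com where
  "matrix_prog = For 1 (For 2 (Then
     (SetCell (Tab (Reg 1) (Reg 2)) (RPlus (RTimes Scale (Cell (Tab (Reg 1) (Reg 2))))
       (RTimes (Cell (Reg 1)) (Cell (Tab (Extra 2) (Reg 2))))))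
     (SetCell (Inverse (Reg 1) (Reg 2)) (RDivide (RMinus (Cell (Inverse (Reg 1) (Reg 2)))
       (RTimes (Cell (Tab (Extra 3) (Reg 1))) (Cell (Tab (Extra 5) (Reg 2))))) Scale))))"

lemma wp_matrix:
  assumes d: "0 < d" and m: "view d s lo tab" "fst s 0 = r0" "fst s 3 = r3" and \<alpha>: "0 < lo (2 * d)"
  defines "b \<equiv> 1 + lo (2 * d) / 4"
  shows "bounded_run d matrix_prog (500 * d\<^sup>2) (\<lambda>s'. fst s' 0 = r0 \<and> fst s' 3 = r3 \<and>
    view d s' lo (\<lambda>r j. if r < d then b * tab r j + lo r * tab (2 * d + 2) j
      else if r < 2 * d then (tab r j - tab (2 * d + 3) (r - d) * tab (2 * d + 5) j) / b else tab r j)) s"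
proof -
  let ?A = "SetCell (Tab (Reg 1) (Reg 2)) (RPlus (RTimes Scale (Cell (Tab (Reg 1) (Reg 2)))) (RTimes (Cell (Reg 1)) (Cell (Tab (Extra 2) (Reg 2)))))"
  let ?N = "SetCell (Inverse (Reg 1) (Reg 2)) (RDivide (RMinus (Cell (Inverse (Reg 1) (Reg 2))) (RTimes (Cell (Tab (Extra 3) (Reg 1))) (Cell (Tab (Extra 5) (Reg 2))))) Scale)"
  \<comment> \<open>Rows before \<open>i\<close> are finished in both matrices, and row
    \<open>i\<close> up to column \<open>k\<close>.\<close>
  define T where "T i k r j = (if r < i \<or> (r = i \<and> j < k) then b * tab r j + lo r * tab (2 * d + 2) j
    else if d \<le> r \<and> (r < d + i \<or> (r = d + i \<and> j < k)) then (tab r j - tab (2 * d + 3) (r - d) * tab (2 * d + 5) j) / b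
    else tab r j)" for i k r j :: nat
  define I where "I i k r m \<longleftrightarrow> r 0 = r0 \<and> r 3 = r3 \<and> mem_view d m lo (T i k)" for i k and r :: "nat \<Rightarrow> nat" and m
  have b: "b \<noteq> 0" using \<alpha> by (simp add: b_def)
  have body: "bounded_run d (Then
     (?A)
     (?N)) 300
     (\<lambda>s'. fst s' 2 = k \<and> fst s' 1 = i \<and> I i (Suc k) (fst s') (snd s')) s"
    if i: "i < d" and k: "k < d" and s: "fst s 2 = k" "fst s 1 = i" "I i k (fst s) (snd s)" for i k s
  proof -
    have v: "view d s lo (T i k)" using s by (simp add: I_def)
    have a: "adr d i k < 12 * d\<^sup>2" "adr d (d + i) k < 12 * d\<^sup>2" "adr d (2 * d + l) k < 12 * d\<^sup>2" "adr d (2 * d + l) i < 12 * d\<^sup>2"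
      if "l < 7" for l using that i k by (auto intro!: adr_less)
    have lo: "i < 12 * d\<^sup>2" "2 * d < 12 * d\<^sup>2" using low_less[OF d] i by auto
    define T' where "T' = (T i k)(i := (T i k i)(k := b * tab i k + lo i * tab (2 * d + 2) k))"
    have "snd s (2 * d) = lo (2 * d)" "snd s i = lo i" using mem_view_low[OF v] i by auto
    moreover have "snd s (adr d i k) = tab i k" "snd s (adr d (2 * d + 2) k) = tab (2 * d + 2) k"
      using mem_view_adr[OF v, of i k] mem_view_adr[OF v, of "2 * d + 2" k] i k by (auto simp: T_def)
    ultimately have 1: "bounded_run d (?A) 100 (\<lambda>s'. fst s' = fst s \<and> view d s' lo T') s"
      using s a[of 2] lo mem_view_set_adr[OF v k, of i "b * tab i k + lo i * tab (2 * d + 2) k"]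
      by (intro wp_SetCell) (auto simp: T'_def b_def)
    have 2: "bounded_run d (?N) 150
       (\<lambda>s'. fst s' 2 = k \<and> fst s' 1 = i \<and> I i (Suc k) (fst s') (snd s')) s'"
      if s': "fst s' = fst s \<and> view d s' lo T'" for s'
    proof -
      have v': "view d s' lo T'" using s' by simp
      have l: "snd s' (2 * d) = lo (2 * d)" using mem_view_low[OF v'] by auto
      have t: "snd s' (adr d (d + i) k) = tab (d + i) k" "snd s' (adr d (2 * d + 3) i) = tab (2 * d + 3) i"
        "snd s' (adr d (2 * d + 5) k) = tab (2 * d + 5) k"
        using mem_view_adr[OF v', of "d + i" k] mem_view_adr[OF v', of "2 * d + 3" i] mem_view_adr[OF v', of "2 * d + 5" k] i k d
        by (auto simp: T_def T'_def)
      have "mem_view d ((snd s')(adr d (d + i) k := (tab (d + i) k - tab (2 * d + 3) i * tab (2 * d + 5) k) / b)) lo (T i (Suc k))"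
        by (rule mem_view_cong[OF mem_view_set_adr[OF v' k]]) (use i k d in \<open>auto simp: T_def T'_def\<close>)
      then show ?thesis
        using s s' a[of 3] a[of 5] lo l t b by (intro wp_SetCell) (auto simp: I_def b_def)
    qed
    show ?thesis by (rule wp_Then[OF 1 2]) auto
  qed
  have inner: "bounded_run d (For 2 (Then
     (?A)
     (?N))) (d * 308 + 6)
     (\<lambda>s'. fst s' 1 = i \<and> I (Suc i) 0 (fst s') (snd s')) s"
    if i: "i < d" and s: "fst s 1 = i" "I i 0 (fst s) (snd s)" for i s
  proof (rule wp_For[where K = 300 and I = "\<lambda>k r m. r 1 = i \<and> I i k r m"])
    fix s' :: state
    assume s': "fst s' 1 = i \<and> I i d (fst s') (snd s')"
    then have v: "view d s' lo (T i d)" by (simp add: I_def)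
    have "view d s' lo (T (Suc i) 0)"
      by (rule mem_view_cong[OF v]) (use i in \<open>auto simp: T_def less_Suc_eq\<close>)
    then show "fst s' 1 = i \<and> I (Suc i) 0 (fst s') (snd s')" using s' by (simp add: I_def)
  qed (use s body[OF i] d low_less[OF d, of d] in \<open>auto simp: I_def\<close>)
  show ?thesis
    unfolding matrix_prog_def
  proof (rule wp_For[where K = "d * 308 + 6" and I = "\<lambda>i. I i 0"])
    have "view d s lo (T 0 0)"
      by (rule mem_view_cong[OF m(1)]) (auto simp: T_def)
    then show "I 0 0 (fst s) (snd s)" using m by (simp add: I_def)
    fix s' :: state
    assume s': "I d 0 (fst s') (snd s')"
    then have v: "view d s' lo (T d 0)" by (simp add: I_def)
    have "view d s' lo (\<lambda>r j. if r < d then b * tab r j + lo r * tab (2 * d + 2) j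
      else if r < 2 * d then (tab r j - tab (2 * d + 3) (r - d) * tab (2 * d + 5) j) / b else tab r j)"
      by (rule mem_view_cong[OF v]) (auto simp: T_def)
    then show "fst s' 0 = r0 \<and> fst s' 3 = r3 \<and> view d s' lo (\<lambda>r j. if r < d then b * tab r j + lo r * tab (2 * d + 2) j
      else if r < 2 * d then (tab r j - tab (2 * d + 3) (r - d) * tab (2 * d + 5) j) / b else tab r j)"
      using s' by (simp add: I_def)
  next
    have "d * (d * 308 + 6 + 8) + 6 = 308 * d\<^sup>2 + (d * 14 + 6)"
      by (simp add: power2_eq_square algebra_simps)
    then show "d * (d * 308 + 6 + 8) + 6 \<le> 500 * d\<^sup>2"
      using quadratic_costs[OF d, of 14 6] by simp
  qed (use inner low_less[OF d, of d] in \<open>auto simp: I_def\<close>)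
qed

text \<open>The factor is overwritten at the very end, and this program runs after the others,
  because the matrices and the center still need the old \<open>\<alpha>\<close>.\<close>

definition center_prog :: com where
  "center_prog = Then (For 1 (SetCell (Center (Reg 1)) (RPlus (Cell (Center (Reg 1))) (RTimes Factor (Cell (Reg 1))))))
     (SetCell (ITimes (INum 2) Dimension) (RDivide Factor Two_factor))"

lemma wp_center:
  assumes d: "0 < d" and m: "view d s lo tab" "fst s 0 = r0" and \<alpha>: "0 < lo (2 * d)"
  shows "bounded_run d center_prog (200 * d\<^sup>2) (\<lambda>s'. fst s' 0 = r0 \<and>
    view d s' (\<lambda>p. if p < d then lo p else if p < 2 * d then lo p + lo (2 * d) * lo (p - d)
      else lo (2 * d) / (1 + 2 * lo (2 * d))) tab) s"
proof -
  let ?C = "SetCell (Center (Reg 1)) (RPlus (Cell (Center (Reg 1))) (RTimes Factor (Cell (Reg 1))))"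
  define f where "f i p = (if d \<le> p \<and> p < d + i then lo p + lo (2 * d) * lo (p - d) else lo p)" for i p
  have f0: "f 0 = lo" by (auto simp: f_def)
  have loop: "bounded_run d (For 1 (?C))
      (d * 108 + 6) (\<lambda>s'. fst s' 0 = r0 \<and> view d s' (f d) tab) s"
  proof (rule wp_For[where K = 100 and I = "\<lambda>i r m. r 0 = r0 \<and> mem_view d m (f i) tab"])
    fix i and s :: state
    assume i: "i < d" "fst s 1 = i" and s: "fst s 0 = r0 \<and> view d s (f i) tab"
    then have v: "view d s (f i) tab" by simp
    have "snd s i = lo i" "snd s (d + i) = lo (d + i)" "snd s (2 * d) = lo (2 * d)"
      using mem_view_low[OF v, of i] mem_view_low[OF v, of "d + i"] mem_view_low[OF v, of "2 * d"] i by (auto simp: f_def)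
    moreover have "mem_view d ((snd s)(d + i := lo (d + i) + lo (2 * d) * lo i)) (f (Suc i)) tab"
      by (rule mem_view_cong[OF mem_view_set_low[OF v]]) (use i in \<open>auto simp: f_def\<close>)
    ultimately show "bounded_run d (?C) 100
        (\<lambda>s'. fst s' 1 = i \<and> fst s' 0 = r0 \<and> view d s' (f (Suc i)) tab) s"
      using i s low_less[OF d] by (intro wp_SetCell) auto
  qed (use m f0 d low_less[OF d, of d] in auto)
  show ?thesis
    unfolding center_prog_def
  proof (rule wp_Then[OF loop, where K' = 30])
    fix s' :: state
    assume s': "fst s' 0 = r0 \<and> view d s' (f d) tab"
    then have v: "view d s' (f d) tab" by simp
    have "snd s' (2 * d) = lo (2 * d)" using mem_view_low[OF v, of "2 * d"] by (auto simp: f_def)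
    moreover have "mem_view d ((snd s')(2 * d := lo (2 * d) / (1 + 2 * lo (2 * d)))) (\<lambda>p. if p < d then lo p
        else if p < 2 * d then lo p + lo (2 * d) * lo (p - d) else lo (2 * d) / (1 + 2 * lo (2 * d))) tab"
      by (rule mem_view_cong[OF mem_view_set_low[OF v]]) (auto simp: f_def)
    ultimately show "bounded_run d (SetCell (ITimes (INum 2) Dimension) (RDivide Factor Two_factor)) 30
      (\<lambda>s'. fst s' 0 = r0 \<and> view d s' (\<lambda>p. if p < d then lo p
        else if p < 2 * d then lo p + lo (2 * d) * lo (p - d) else lo (2 * d) / (1 + 2 * lo (2 * d))) tab) s'"
      using s' \<alpha> low_less[OF d] by (intro wp_SetCell) auto
  qed (use quadratic_costs[OF d, of 108 36] in auto)
qed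

definition update_prog :: com where
  "update_prog = Then (dot_prog 5 (RTimes (Cell (Tab (Extra 4) (Reg 2))) (Cell (Inverse (Reg 2) (Reg 1)))))
     (Then matrix_prog center_prog)"

text \<open>The cells of the arriving point and the scratch rows are left unspecified, since every
  step writes them anew before reading them.\<close>

definition updated :: "nat \<Rightarrow> (nat \<Rightarrow> real) \<Rightarrow> (nat \<Rightarrow> nat \<Rightarrow> real) \<Rightarrow> (nat \<Rightarrow> real) \<Rightarrow> (nat \<Rightarrow> real) \<Rightarrow> (nat \<Rightarrow> real) \<Rightarrow>
    (nat \<Rightarrow> real) \<Rightarrow> (nat \<Rightarrow> nat \<Rightarrow> real) \<Rightarrow> bool" where
  "updated d lo tab f g h lo' tab' \<longleftrightarrow>
     lo' (2 * d) = lo (2 * d) / (1 + 2 * lo (2 * d)) \<and>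
     (\<forall>i<d. lo' (d + i) = lo (d + i) + lo (2 * d) * lo i) \<and>
     (\<forall>i<d. \<forall>j<d. tab' i j = (1 + lo (2 * d) / 4) * tab i j + lo i * f j) \<and>
     (\<forall>i<d. \<forall>j<d. tab' (d + i) j = (tab (d + i) j - g i * (\<Sum>k<d. h k * tab (d + k) j)) / (1 + lo (2 * d) / 4)) \<and>
     (\<forall>j<d. tab' (2 * d) j = tab (2 * d) j)"

lemma wp_update:
  assumes d: "0 < d" and m: "view d s lo tab" "fst s 0 = r0" and \<alpha>: "0 < lo (2 * d)"
  shows "bounded_run d update_prog (1000 * d\<^sup>2) (\<lambda>s'. fst s' 0 = r0 \<and>
    (\<exists>lo' tab'. view d s' lo' tab' \<and>
      updated d lo tab (tab (2 * d + 2)) (tab (2 * d + 3)) (tab (2 * d + 4)) lo' tab')) s"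
proof -
  define tab1 where "tab1 = tab(2 * d + 5 := \<lambda>i. \<Sum>j<d. tab (2 * d + 4) j * tab (d + j) i)"
  have 1: "bounded_run d (dot_prog 5 (RTimes (Cell (Tab (Extra 4) (Reg 2))) (Cell (Inverse (Reg 2) (Reg 1)))))
      (300 * d\<^sup>2) (\<lambda>s'. fst s' 0 = r0 \<and> fst s' 3 = fst s 3 \<and> view d s' lo tab1) s"
    unfolding tab1_def
  proof (rule wp_dot[OF d _ m refl])
    fix s' :: state and tab' assume i: "fst s' 1 < d" "fst s' 2 < d" and v: "view d s' lo tab'"
      and t: "\<And>r. r \<noteq> 2 * d + 5 \<Longrightarrow> tab' r = tab r"
    show "rsafe (12 * d\<^sup>2) d s' (RTimes (Cell (Tab (Extra 4) (Reg 2))) (Cell (Inverse (Reg 2) (Reg 1)))) \<and>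
        rval d s' (RTimes (Cell (Tab (Extra 4) (Reg 2))) (Cell (Inverse (Reg 2) (Reg 1))))
          = tab (2 * d + 4) (fst s' 2) * tab (d + fst s' 2) (fst s' 1)"
      using i t adr_less[of "2 * d + 4" d "fst s' 2"] adr_less[of "d + fst s' 2" d "fst s' 1"]
        mem_view_adr[OF v, of "2 * d + 4" "fst s' 2"] mem_view_adr[OF v, of "d + fst s' 2" "fst s' 1"]
      by auto
  qed auto
  define tab2 where "tab2 = (\<lambda>r j. if r < d then (1 + lo (2 * d) / 4) * tab1 r j + lo r * tab1 (2 * d + 2) j
      else if r < 2 * d then (tab1 r j - tab1 (2 * d + 3) (r - d) * tab1 (2 * d + 5) j) / (1 + lo (2 * d) / 4) else tab1 r j)"
  have 2: "bounded_run d matrix_prog (500 * d\<^sup>2) (\<lambda>s''. fst s'' 0 = r0 \<and> fst s'' 3 = fst s 3 \<and> view d s'' lo tab2) s'"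
    if "fst s' 0 = r0 \<and> fst s' 3 = fst s 3 \<and> view d s' lo tab1" for s'
    unfolding tab2_def using that \<alpha> by (intro wp_matrix[OF d]) auto
  have 3: "bounded_run d center_prog (200 * d\<^sup>2) (\<lambda>s'. fst s' 0 = r0 \<and>
    (\<exists>lo' tab'. view d s' lo' tab' \<and>
      updated d lo tab (tab (2 * d + 2)) (tab (2 * d + 3)) (tab (2 * d + 4)) lo' tab')) s'"
    if s': "fst s' 0 = r0 \<and> fst s' 3 = fst s 3 \<and> view d s' lo tab2" for s'
  proof (rule wp_mono[OF wp_center[of d s' lo tab2 r0, OF d _ _ \<alpha>]])
    fix s2 :: state
    assume s2: "fst s2 0 = r0 \<and> view d s2 (\<lambda>p. if p < d then lo p else if p < 2 * d then lo p + lo (2 * d) * lo (p - d)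
      else lo (2 * d) / (1 + 2 * lo (2 * d))) tab2"
    have "updated d lo tab (tab (2 * d + 2)) (tab (2 * d + 3)) (tab (2 * d + 4)) (\<lambda>p. if p < d then lo p
      else if p < 2 * d then lo p + lo (2 * d) * lo (p - d) else lo (2 * d) / (1 + 2 * lo (2 * d))) tab2"
      by (auto simp: updated_def tab2_def tab1_def)
    then show "fst s2 0 = r0 \<and> (\<exists>lo' tab'. view d s2 lo' tab' \<and>
      updated d lo tab (tab (2 * d + 2)) (tab (2 * d + 3)) (tab (2 * d + 4)) lo' tab')"
      using s2 by (intro conjI exI) auto
  qed (use s' in auto)
  show ?thesis
    unfolding update_prog_def
    apply (rule wp_Then[OF 1, where K' = "700 * d\<^sup>2"])
     apply (rule wp_Then[OF 2, where K' = "200 * d\<^sup>2"], assumption)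
      apply (rule 3, assumption)
    by auto
qed

section \<open>The two enlargements as programs\<close>

definition Coord :: "nat \<Rightarrow> rexp" where
  "Coord x = Cell (Tab (Extra 1) (Reg x))"

definition Norm_square :: rexp where
  "Norm_square = Cell (Tab (Extra 6) (INum 0))"

definition Axis :: rexp where
  "Axis = RTimes Two_factor (RPlus (RSqrt Norm_square) (RNum 1))"

definition Kappa :: rexp where
  "Kappa = RDivide (RMinus Axis Scale) Norm_square"

definition stretch_prog :: com where
  "stretch_prog = Then (For 1 (set_fgh (RTimes Kappa (Coord 1)) (RTimes (RDivide Kappa Axis) (Coord 1)) (Coord 1)))
     update_prog"

text \<open>Equality of counter and pivot is expressed by two negated comparisons. \<open>h\<close>
  is the unit vector of the pivot, so that the common update extracts row \<open>i\<close> of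
  \<open>N\<close>.\<close>

definition extend_prog :: com where
  "extend_prog = Then (SetCell (Tab (Extra 0) (Reg 3)) (RNum 1))
     (Then (For 1 (Cond (Conj (Neg (ILess (Reg 1) (Reg 3))) (Neg (ILess (Reg 3) (Reg 1))))
         (set_fgh Two_factor (RDivide (RMinus (Coord 1) (RDivide Scale Two_factor)) (Coord 3)) (RNum 1))
         (set_fgh (RNum 0) (RDivide (Coord 1) (Coord 3)) (RNum 0))))
       update_prog)"

lemma wp_stretch:
  assumes d: "0 < d" and m: "view d s lo tab" "fst s 0 = r0" and \<alpha>: "0 < lo (2 * d)"
    and \<rho>: "1 < tab (2 * d + 6) 0"
    and a_def: "a = (1 + 2 * lo (2 * d)) * (sqrt (tab (2 * d + 6) 0) + 1)"
    and \<kappa>_def: "\<kappa> = (a - (1 + lo (2 * d) / 4)) / tab (2 * d + 6) 0"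
  shows "bounded_run d stretch_prog (1800 * d\<^sup>2) (\<lambda>s'. fst s' 0 = r0 \<and>
    (\<exists>lo' tab'. view d s' lo' tab' \<and>
      updated d lo tab (\<lambda>i. \<kappa> * tab (2 * d + 1) i) (\<lambda>i. \<kappa> / a * tab (2 * d + 1) i) (tab (2 * d + 1)) lo' tab')) s"
proof -
  let ?B = "set_fgh (RTimes Kappa (Coord 1)) (RTimes (RDivide Kappa Axis) (Coord 1)) (Coord 1)"
  have a: "a \<noteq> 0" using \<alpha> \<rho> by (simp add: a_def add_pos_pos less_imp_neq[symmetric] real_sqrt_gt_zero add_nonneg_eq_0_iff)
  have 1: "bounded_run d (For 1 (?B))
      (700 * d\<^sup>2) (\<lambda>s'. fst s' 0 = r0 \<and> fst s' 3 = fst s 3 \<and> view d s' lo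
        (tab(2 * d + 2 := \<lambda>i. \<kappa> * tab (2 * d + 1) i, 2 * d + 3 := \<lambda>i. \<kappa> / a * tab (2 * d + 1) i, 2 * d + 4 := tab (2 * d + 1)))) s"
  proof (rule wp_vectors[OF d m refl])
    fix s' :: state and tab' assume i: "fst s' 1 < d" and v: "view d s' lo tab'"
      and t: "\<And>r. r \<notin> {2 * d + 2, 2 * d + 3, 2 * d + 4} \<Longrightarrow> tab' r = tab r"
    show "bounded_run d (?B) 600
        (\<lambda>s''. fst s'' = fst s' \<and> view d s'' lo (put_fgh d (fst s' 1) (\<kappa> * tab (2 * d + 1) (fst s' 1))
          (\<kappa> / a * tab (2 * d + 1) (fst s' 1)) (tab (2 * d + 1) (fst s' 1)) tab')) s'"
    proof (rule wp_mono[OF wp_set_fgh[OF v i refl]])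
      fix s2 :: state and tab2 assume s2: "fst s2 = fst s'" and v2: "view d s2 lo tab2"
        and t2: "\<And>r. r \<notin> {2 * d + 2, 2 * d + 3, 2 * d + 4} \<Longrightarrow> tab2 r = tab' r"
      have "snd s2 (adr d (2 * d + 1) (fst s' 1)) = tab (2 * d + 1) (fst s' 1)"
        using mem_view_adr[OF v2, of "2 * d + 1"] i t t2 by simp
      moreover have n: "snd s2 (adr d (2 * d + 6) 0) = tab (2 * d + 6) 0"
        using mem_view_adr[OF v2, of "2 * d + 6"] d t t2 by simp
      moreover have l: "snd s2 (2 * d) = lo (2 * d)" using mem_view_low[OF v2] by simp
      moreover have "rval d s2 Axis = a" by (simp add: Axis_def Norm_square_def a_def n l)
      ultimately show "rsafe (12 * d\<^sup>2) d s2 (RTimes Kappa (Coord 1)) \<and>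
          rval d s2 (RTimes Kappa (Coord 1)) = \<kappa> * tab (2 * d + 1) (fst s' 1) \<and>
          rsafe (12 * d\<^sup>2) d s2 (RTimes (RDivide Kappa Axis) (Coord 1)) \<and>
          rval d s2 (RTimes (RDivide Kappa Axis) (Coord 1)) = \<kappa> / a * tab (2 * d + 1) (fst s' 1) \<and>
          rsafe (12 * d\<^sup>2) d s2 (Coord 1) \<and> rval d s2 (Coord 1) = tab (2 * d + 1) (fst s' 1)"
        using i s2 \<rho> a d low_less[OF d, of "2 * d"] adr_less[of "2 * d + 1" d "fst s' 1"] adr_less[of "2 * d + 6" d 0]
        by (simp add: Kappa_def Coord_def Norm_square_def \<kappa>_def) (simp add: Axis_def Norm_square_def)
    qed (auto simp: Kappa_def Axis_def Coord_def Norm_square_def)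
  qed
  show ?thesis
    unfolding stretch_prog_def
    apply (rule wp_Then[OF 1, where K' = "1000 * d\<^sup>2"])
     apply (elim conjE)
     apply (rule wp_mono[OF wp_update[OF d]], assumption, assumption, rule \<alpha>, rule order_refl)
     apply (auto simp: updated_def)
    done
qed

lemma wp_extend:
  assumes d: "0 < d" and m: "view d s lo tab" "fst s 0 = r0" and \<alpha>: "0 < lo (2 * d)"
    and i: "fst s 3 = i" "i < d" "tab (2 * d + 1) i \<noteq> 0"
    and f_def: "\<And>j. f j = (if j = i then 1 + 2 * lo (2 * d) else 0)"
    and g_def: "\<And>r. g r = (tab (2 * d + 1) r -
      (if r = i then (1 + lo (2 * d) / 4) / (1 + 2 * lo (2 * d)) else 0)) / tab (2 * d + 1) i"
    and h_def: "\<And>k. h k = (if k = i then 1 else 0)"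
  shows "bounded_run d extend_prog (1900 * d\<^sup>2) (\<lambda>s'. fst s' 0 = r0 \<and>
    (\<exists>lo' tab'. view d s' lo' tab' \<and>
      updated d lo (tab(2 * d := (tab (2 * d))(i := 1))) f g h lo' tab')) s"
proof -
  let ?pivot = "set_fgh Two_factor (RDivide (RMinus (Coord 1) (RDivide Scale Two_factor)) (Coord 3)) (RNum 1)"
  let ?other = "set_fgh (RNum 0) (RDivide (Coord 1) (Coord 3)) (RNum 0)"
  let ?test = "Conj (Neg (ILess (Reg 1) (Reg 3))) (Neg (ILess (Reg 3) (Reg 1)))"
  define tab1 where "tab1 = tab(2 * d := (tab (2 * d))(i := 1))"
  have 1: "bounded_run d (SetCell (Tab (Extra 0) (Reg 3)) (RNum 1)) 20
      (\<lambda>s'. fst s' 0 = r0 \<and> fst s' 3 = i \<and> view d s' lo tab1) s"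
    using m i adr_less[of "2 * d" d i] mem_view_set_adr[OF m(1) i(2), of "2 * d" 1]
    by (intro wp_SetCell) (auto simp: tab1_def)
  have 2: "bounded_run d (For 1 (Cond (?test)
         (?pivot)
         (?other)))
      (700 * d\<^sup>2) (\<lambda>s'. fst s' 0 = r0 \<and> fst s' 3 = i \<and> view d s' lo
        (tab1(2 * d + 2 := f, 2 * d + 3 := g, 2 * d + 4 := h))) s'"
    if s': "fst s' 0 = r0" "fst s' 3 = i" "view d s' lo tab1" for s'
  proof (rule wp_vectors[OF d s'(3,1,2)])
    fix s' :: state and tab' assume j: "fst s' 1 < d" and r3: "fst s' 3 = i" and v: "view d s' lo tab'"
      and t: "\<And>r. r \<notin> {2 * d + 2, 2 * d + 3, 2 * d + 4} \<Longrightarrow> tab' r = tab1 r"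
    have cell: "snd s2 (adr d (2 * d + 1) k) = tab (2 * d + 1) k" "snd s2 (2 * d) = lo (2 * d)"
      if "k < d" "view d s2 lo tab2"
        "\<And>r. r \<notin> {2 * d + 2, 2 * d + 3, 2 * d + 4} \<Longrightarrow> tab2 r = tab' r" for s2 :: state and tab2 k
      using mem_view_adr[OF that(2), of "2 * d + 1" k] mem_view_low[OF that(2), of "2 * d"] that t by (auto simp: tab1_def)
    note bounds = low_less[OF d, of "2 * d"] adr_less[of "2 * d + 1" d "fst s' 1"] adr_less[of "2 * d + 1" d i]
    show "bounded_run d (Cond (?test)
         (?pivot)
         (?other)) 600
        (\<lambda>s''. fst s'' = fst s' \<and> view d s'' lo (put_fgh d (fst s' 1) (f (fst s' 1))
          (g (fst s' 1)) (h (fst s' 1)) tab')) s'"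
    proof (rule wp_Cond[where K = 500])
      assume "bval d s' (?test)"
      then have ji: "fst s' 1 = i" using r3 by simp
      show "bounded_run d (?pivot) 500
        (\<lambda>s''. fst s'' = fst s' \<and> view d s'' lo (put_fgh d (fst s' 1) (f (fst s' 1))
          (g (fst s' 1)) (h (fst s' 1)) tab')) s'"
      proof (rule wp_set_fgh[OF v j refl])
        fix s2 :: state and tab2 assume s2: "fst s2 = fst s'" and v2: "view d s2 lo tab2"
          and t2: "\<And>r. r \<notin> {2 * d + 2, 2 * d + 3, 2 * d + 4} \<Longrightarrow> tab2 r = tab' r"
        show "rsafe (12 * d\<^sup>2) d s2 Two_factor \<and> rval d s2 Two_factor = f (fst s' 1) \<and>
            rsafe (12 * d\<^sup>2) d s2 (RDivide (RMinus (Coord 1) (RDivide Scale Two_factor)) (Coord 3)) \<and>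
            rval d s2 (RDivide (RMinus (Coord 1) (RDivide Scale Two_factor)) (Coord 3)) = g (fst s' 1) \<and>
            rsafe (12 * d\<^sup>2) d s2 (RNum 1) \<and> rval d s2 (RNum 1) = h (fst s' 1)"
          using i j ji s2 r3 \<alpha> bounds cell[OF i(2) v2 t2]
          by (simp add: Coord_def f_def g_def h_def)
      qed (auto simp: Coord_def)
    next
      assume "\<not> bval d s' (?test)"
      then have ji: "fst s' 1 \<noteq> i" using r3 by auto
      show "bounded_run d (?other) 500
        (\<lambda>s''. fst s'' = fst s' \<and> view d s'' lo (put_fgh d (fst s' 1) (f (fst s' 1))
          (g (fst s' 1)) (h (fst s' 1)) tab')) s'"
      proof (rule wp_set_fgh[OF v j refl])
        fix s2 :: state and tab2 assume s2: "fst s2 = fst s'" and v2: "view d s2 lo tab2"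
          and t2: "\<And>r. r \<notin> {2 * d + 2, 2 * d + 3, 2 * d + 4} \<Longrightarrow> tab2 r = tab' r"
        show "rsafe (12 * d\<^sup>2) d s2 (RNum 0) \<and> rval d s2 (RNum 0) = f (fst s' 1) \<and>
            rsafe (12 * d\<^sup>2) d s2 (RDivide (Coord 1) (Coord 3)) \<and>
            rval d s2 (RDivide (Coord 1) (Coord 3)) = g (fst s' 1) \<and>
            rsafe (12 * d\<^sup>2) d s2 (RNum 0) \<and> rval d s2 (RNum 0) = h (fst s' 1)"
          using i j ji s2 r3 bounds cell[OF i(2) v2 t2] cell(1)[OF j v2 t2]
          by (simp add: Coord_def f_def g_def h_def)
      qed (auto simp: Coord_def)
    qed auto
  qed
  have d2: "1 \<le> d\<^sup>2" using d by simp
  show ?thesis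
    unfolding extend_prog_def tab1_def[symmetric]
    apply (rule wp_Then[OF 1, where K' = "1700 * d\<^sup>2"])
     apply (rule wp_Then[where K' = "1000 * d\<^sup>2"])
       apply (rule 2; blast)
      apply (elim conjE)
      apply (rule wp_mono[OF wp_update[OF d]], assumption, assumption, rule \<alpha>, rule order_refl)
      apply (auto simp: updated_def tab1_def)[1]
    using d2 by auto
qed

section \<open>The streaming algorithm\<close>

definition block :: "nat \<Rightarrow> nat \<Rightarrow> (nat \<Rightarrow> nat \<Rightarrow> real) \<Rightarrow> nat \<Rightarrow> nat \<Rightarrow> real" where
  "block d k tab = (\<lambda>i j. if i < d \<and> j < d then tab (k + i) j else 0)"

text \<open>The counter \<open>U\<close> and the list \<open>L\<close> are quantified away, as no
  cell holds them. Flags are exactly 0 or 1, so that the comparison with 1 in the scan decides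
  membership in the set of active columns.\<close>

definition state_ok :: "nat \<Rightarrow> (nat \<Rightarrow> point) \<Rightarrow> nat \<Rightarrow> state \<Rightarrow> bool" where
  "state_ok d z t s \<longleftrightarrow> fst s 0 = 1 \<and> (\<exists>lo tab. view d s lo tab \<and>
     (\<forall>j<d. tab (2 * d) j = 0 \<or> tab (2 * d) j = 1) \<and>
     (\<exists>U L. rounding d z t (vec_of d (\<lambda>i. lo (d + i))) (lo (2 * d)) (block d 0 tab) (block d d tab)
        {j. j < d \<and> tab (2 * d) j = 1} U L))"

text \<open>The matrix, the flags and the off-diagonal entries of the inverse are not written: they
  rely on memory being zero at the start.\<close>

definition init_prog :: com where
  "init_prog = Then (For 1 (Then (SetCell (Center (Reg 1)) (Cell (Reg 1))) (SetCell (Inverse (Reg 1) (Reg 1)) (RNum 1))))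
     (Then (SetCell (ITimes (INum 2) Dimension) (RDivide (RNum 1) (RNum 8))) (SetReg 0 (INum 1)))"

definition main_prog :: com where
  "main_prog = Then residual_prog (Then (dot_prog 1 (RTimes (Cell (Inverse (Reg 1) (Reg 2))) (Cell (Reg 2))))
     (Then scan_prog (Cond (ILess (Reg 3) Dimension) extend_prog
       (Cond (RLess (RNum 1) Norm_square) stretch_prog Skip))))"

definition streaming_prog :: com where
  "streaming_prog = Cond (ILess (Reg 0) (INum 1)) init_prog main_prog"

lemma wp_init:
  assumes d: "0 < d" and m: "view d s lo (\<lambda>_ _. 0)" and z: "z 1 \<in> Rd d" "\<And>p. p < d \<Longrightarrow> lo p = co (z 1) p"
  shows "bounded_run d init_prog (200 * d\<^sup>2) (state_ok d z 1) s"
proof -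
  let ?C = "SetCell (Center (Reg 1)) (Cell (Reg 1))"
  let ?N = "SetCell (Inverse (Reg 1) (Reg 1)) (RNum 1)"
  define L where "L i = (\<lambda>p. if d \<le> p \<and> p < d + i then lo (p - d) else lo p)" for i
  define T where "T i = (\<lambda>r j. if d \<le> r \<and> r < d + i \<and> j = r - d then 1 else 0 :: real)" for i
  have init: "L 0 = lo" "T 0 = (\<lambda>_ _. 0)" by (auto simp: L_def T_def fun_eq_iff)
  have 1: "bounded_run d (For 1 (Then (?C) (?N)))
      (d * 108 + 6) (\<lambda>s'. view d s' (L d) (T d)) s"
  proof (rule wp_For[where K = 100 and I = "\<lambda>i r m. mem_view d m (L i) (T i)"])
    fix i and s :: state
    assume i: "i < d" "fst s 1 = i" and v: "view d s (L i) (T i)"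
    have lt: "i < 12 * d\<^sup>2" "d + i < 12 * d\<^sup>2" "adr d (d + i) i < 12 * d\<^sup>2"
      using i low_less[OF d] by (auto intro!: adr_less)
    have a: "mem_view d ((snd s)(d + i := lo i)) (L (Suc i)) (T i)"
      by (rule mem_view_cong[OF mem_view_set_low[OF v]]) (use i in \<open>auto simp: L_def\<close>)
    have b: "mem_view d (m(adr d (d + i) i := 1)) (L (Suc i)) (T (Suc i))" if "mem_view d m (L (Suc i)) (T i)" for m
      by (rule mem_view_cong[OF mem_view_set_adr[OF that i(1)]]) (use i in \<open>auto simp: T_def\<close>)
    have "snd s i = lo i" using mem_view_low[OF v, of i] i by (auto simp: L_def)
    then have "bounded_run d (?C) 10
        (\<lambda>s'. fst s' 1 = i \<and> view d s' (L (Suc i)) (T i)) s"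
      using i lt a by (intro wp_SetCell) auto
    then show "bounded_run d (Then (?C) (?N)) 100
        (\<lambda>s'. fst s' 1 = i \<and> view d s' (L (Suc i)) (T (Suc i))) s"
      by (rule wp_Then[where K' = 50]) (use i lt b in \<open>auto intro!: wp_SetCell\<close>)
  qed (use m init d low_less[OF d, of d] in auto)
  have ok: "state_ok d z 1 s'" if s': "fst s' 0 = 1" "view d s' ((L d)(2 * d := 1/8)) (T d)" for s'
    unfolding state_ok_def
  proof (intro conjI exI)
    show "view d s' ((L d)(2 * d := 1/8)) (T d)" by (rule s')
    have c: "vec_of d (\<lambda>i. ((L d)(2 * d := 1/8)) (d + i)) = z 1"
      using z by (intro Rd_eqI[of _ d]) (auto simp: L_def)
    have J: "{j. j < d \<and> T d (2 * d) j = 1} = {}" by (auto simp: T_def)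
    have "rounding d z 1 (z 1) (1/8) (block d 0 (T d)) (block d d (T d)) {} 0 []"
      using z(1) by (rule rounding_init) (auto simp: block_def T_def)
    then show "rounding d z 1 (vec_of d (\<lambda>i. ((L d)(2 * d := 1/8)) (d + i))) (((L d)(2 * d := 1/8)) (2 * d))
        (block d 0 (T d)) (block d d (T d)) {j. j < d \<and> T d (2 * d) j = 1} 0 []"
      unfolding c J by simp
  qed (use s' in \<open>auto simp: T_def\<close>)
  have 2: "bounded_run d (SetCell (ITimes (INum 2) Dimension) (RDivide (RNum 1) (RNum 8))) 20
      (\<lambda>s'. view d s' ((L d)(2 * d := 1/8)) (T d)) s'"
    if "view d s' (L d) (T d)" for s'
    using that low_less[OF d, of "2 * d"] mem_view_set_low[OF that, of "2 * d" "1/8"] by (intro wp_SetCell) auto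
  have 3: "bounded_run d (SetReg 0 (INum 1)) 10 (state_ok d z 1) s'"
    if "view d s' ((L d)(2 * d := 1/8)) (T d)" for s'
    using that ok low_less[OF d, of 1] d by (intro wp_SetReg) auto
  show ?thesis
    unfolding init_prog_def
    apply (rule wp_Then[OF 1, where K' = 30])
     apply (rule wp_Then[OF 2, where K' = 10], assumption)
      apply (rule 3, assumption)
    using quadratic_costs[OF d, of 108 36] by auto
qed

lemma wp_main:
  assumes d: "0 < d" and m: "view d s lo tab" "fst s 0 = 1"
    and z: "z (Suc t) \<in> Rd d" "\<And>p. p < d \<Longrightarrow> lo p = co (z (Suc t)) p"
    and flags: "\<And>j. j < d \<Longrightarrow> tab (2 * d) j = 0 \<or> tab (2 * d) j = 1"
    and R: "rounding d z t (vec_of d (\<lambda>i. lo (d + i))) (lo (2 * d)) (block d 0 tab) (block d d tab)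
        {j. j < d \<and> tab (2 * d) j = 1} U L"
  shows "bounded_run d main_prog (3000 * d\<^sup>2) (state_ok d z (Suc t)) s"
proof -
  let ?dot = "dot_prog 1 (RTimes (Cell (Inverse (Reg 1) (Reg 2))) (Cell (Reg 2)))"
  define c where "c = vec_of d (\<lambda>i. lo (d + i))"
  define J where "J = {j. j < d \<and> tab (2 * d) j = 1}"
  define A where "A = block d 0 tab"
  define N where "N = block d d tab"
  define lo1 where "lo1 = (\<lambda>p. if p < d then lo p - lo (d + p) else lo p)"
  define u where "u = vec_of d lo1"
  define y where "y = app d N u"
  define tab1 where "tab1 = tab(2 * d + 1 := \<lambda>i. \<Sum>j<d. tab (d + i) j * lo1 j)"
  define tab2 where "tab2 = tab1(2 * d + 6 := (tab1 (2 * d + 6))(0 := \<Sum>i<d. (tab1 (2 * d + 1) i)\<^sup>2))"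
  define out where "out i \<longleftrightarrow> tab1 (2 * d) i < 1 \<and> tab1 (2 * d + 1) i \<noteq> 0" for i
  note R = R[folded c_def J_def A_def N_def]
  have \<alpha>: "0 < lo (2 * d)" by (rule roundingD(3)[OF R])
  have \<alpha>1: "lo1 (2 * d) = lo (2 * d)" by (simp add: lo1_def)
  have zu: "z (Suc t) = c + u" and uR: "u \<in> Rd d"
    using z by (auto simp: c_def u_def lo1_def intro!: Rd_eqI[of _ d])
  have coy: "co y i = tab2 (2 * d + 1) i" if "i < d" for i
    using that by (simp add: y_def u_def N_def app_def block_def tab2_def tab1_def)
  have yR: "y \<in> Rd d" by (simp add: y_def)
  have yy: "ip d y y = tab2 (2 * d + 6) 0"
  proof -
    have "ip d y y = (\<Sum>i<d. (tab1 (2 * d + 1) i)\<^sup>2)"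
      unfolding ip_def by (intro sum.cong) (auto simp: coy power2_eq_square tab2_def)
    then show ?thesis by (simp add: tab2_def)
  qed
  have t2: "tab2 r = tab r" if "r \<le> 2 * d" for r using that by (simp add: tab2_def tab1_def)
  have 1: "bounded_run d residual_prog (100 * d\<^sup>2) (\<lambda>s'. fst s' 0 = 1 \<and> view d s' lo1 tab) s"
    unfolding lo1_def by (rule wp_residual[OF d m])
  have 2: "bounded_run d (?dot) (300 * d\<^sup>2)
      (\<lambda>s'. fst s' 0 = 1 \<and> view d s' lo1 tab1) s'"
    if s': "fst s' 0 = 1 \<and> view d s' lo1 tab" for s'
  proof -
    have "bounded_run d (?dot) (300 * d\<^sup>2)
      (\<lambda>s''. fst s'' 0 = 1 \<and> fst s'' 3 = fst s' 3 \<and> view d s'' lo1 tab1) s'"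
      unfolding tab1_def
    proof (rule wp_dot[OF d _ conjunct2[OF s'] conjunct1[OF s'] refl])
      fix s2 :: state and tab' assume i: "fst s2 1 < d" "fst s2 2 < d" and v: "view d s2 lo1 tab'"
        and t: "\<And>r. r \<noteq> 2 * d + 1 \<Longrightarrow> tab' r = tab r"
      show "rsafe (12 * d\<^sup>2) d s2 (RTimes (Cell (Inverse (Reg 1) (Reg 2))) (Cell (Reg 2))) \<and>
        rval d s2 (RTimes (Cell (Inverse (Reg 1) (Reg 2))) (Cell (Reg 2))) = tab (d + fst s2 1) (fst s2 2) * lo1 (fst s2 2)"
        using i t adr_less[of "d + fst s2 1" d "fst s2 2"] low_less[OF d, of "fst s2 2"]
          mem_view_adr[OF v, of "d + fst s2 1" "fst s2 2"] mem_view_low[OF v, of "fst s2 2"]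
        by auto
    qed auto
    then show ?thesis by (rule wp_mono) auto
  qed
  have 3: "bounded_run d scan_prog (300 * d\<^sup>2)
    (\<lambda>s'. fst s' 0 = 1 \<and> ((fst s' 3 = d \<and> (\<forall>i<d. \<not> out i)) \<or> (fst s' 3 < d \<and> out (fst s' 3))) \<and>
      view d s' lo1 tab2) s'"
    if s': "fst s' 0 = 1 \<and> view d s' lo1 tab1" for s'
    unfolding out_def tab2_def by (rule wp_scan[OF d conjunct2[OF s'] conjunct1[OF s']])
  \<comment> \<open>The common end of both enlargements: given the memory after a rank one update
    and a geometric lemma \<open>R'\<close> for matrices of that form, it restores the
    invariant.\<close>
  have ok: "state_ok d z (Suc t) s'"
    if s': "fst s' 0 = 1" and v: "view d s' lo' tab'"
      and up: "updated d lo1 (tab2(2 * d := fl)) f g h lo' tab'"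
      and fl: "\<And>j. j < d \<Longrightarrow> fl j = 0 \<or> fl j = 1" and J': "J' = {j. j < d \<and> fl j = 1}"
      and R': "\<And>A' N'. (\<And>i j. i < d \<Longrightarrow> j < d \<Longrightarrow> A' i j = (1 + lo (2 * d) / 4) * A i j + co u i * f j) \<Longrightarrow>
        (\<And>i j. i < d \<Longrightarrow> j < d \<Longrightarrow> N' i j = (N i j - g i * (\<Sum>k<d. h k * N k j)) / (1 + lo (2 * d) / 4)) \<Longrightarrow>
        \<exists>U' L'. rounding d z (Suc t) (c + lo (2 * d) *\<^sub>R u) (lo (2 * d) / (1 + 2 * lo (2 * d))) A' N' J' U' L'"
    for s' lo' tab' f g h fl J'
  proof -
    have c': "vec_of d (\<lambda>i. lo' (d + i)) = c + lo (2 * d) *\<^sub>R u"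
      using up by (intro Rd_eqI[of _ d]) (auto simp: updated_def c_def u_def \<alpha>1 lo1_def)
    have \<alpha>': "lo' (2 * d) = lo (2 * d) / (1 + 2 * lo (2 * d))" using up by (simp add: updated_def \<alpha>1)
    have fl': "tab' (2 * d) j = fl j" if "j < d" for j using up that by (simp add: updated_def)
    then have J'': "{j. j < d \<and> tab' (2 * d) j = 1} = J'" unfolding J' by auto
    have "\<exists>U' L'. rounding d z (Suc t) (c + lo (2 * d) *\<^sub>R u) (lo (2 * d) / (1 + 2 * lo (2 * d)))
        (block d 0 tab') (block d d tab') J' U' L'"
    proof (rule R')
      fix i j assume ij: "i < d" "j < d"
      then show "block d 0 tab' i j = (1 + lo (2 * d) / 4) * A i j + co u i * f j"
        using up by (simp add: updated_def block_def A_def u_def \<alpha>1 t2)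
      have "(\<Sum>k<d. h k * (tab2(2 * d := fl)) (d + k) j) = (\<Sum>k<d. h k * N k j)"
        using ij by (intro sum.cong) (auto simp: N_def block_def t2)
      then show "block d d tab' i j = (N i j - g i * (\<Sum>k<d. h k * N k j)) / (1 + lo (2 * d) / 4)"
        using up ij by (simp add: updated_def block_def N_def \<alpha>1 t2)
    qed
    then obtain U' L' where "rounding d z (Suc t) (vec_of d (\<lambda>i. lo' (d + i))) (lo' (2 * d))
        (block d 0 tab') (block d d tab') {j. j < d \<and> tab' (2 * d) j = 1} U' L'"
      unfolding c' \<alpha>' J'' by (elim exE)
    moreover have "\<forall>j<d. tab' (2 * d) j = 0 \<or> tab' (2 * d) j = 1" using fl fl' by simp
    ultimately show ?thesis
      unfolding state_ok_def using s' v by (intro conjI exI)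
  qed
  have 4: "bounded_run d (Cond (ILess (Reg 3) Dimension) extend_prog
       (Cond (RLess (RNum 1) Norm_square) stretch_prog Skip)) (2000 * d\<^sup>2) (state_ok d z (Suc t)) s'"
    if s': "fst s' 0 = 1 \<and> ((fst s' 3 = d \<and> (\<forall>i<d. \<not> out i)) \<or> (fst s' 3 < d \<and> out (fst s' 3))) \<and>
      view d s' lo1 tab2" for s'
  proof -
    have v: "view d s' lo1 tab2" "fst s' 0 = 1" using s' by auto
    have d2: "1 \<le> d\<^sup>2" using d by simp
    have \<alpha>p: "0 < lo1 (2 * d)" using \<alpha> \<alpha>1 by simp
    have n: "snd s' (adr d (2 * d + 6) 0) = ip d y y"
      using mem_view_adr[OF v(1), of "2 * d + 6" 0] d yy by simp
    show ?thesis
    proof (rule wp_Cond[where K = "1950 * d\<^sup>2"])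
      assume "bval d s' (ILess (Reg 3) Dimension)"
      then have i: "fst s' 3 < d" "out (fst s' 3)" using s' by auto
      define i where "i = fst s' 3"
      have i': "i < d" "tab (2 * d) i < 1" "tab2 (2 * d + 1) i \<noteq> 0"
        using i by (auto simp: i_def[symmetric] out_def tab1_def tab2_def)
      then have iJ: "i \<notin> J" by (auto simp: J_def)
      define f where "f j = (if j = i then 1 + 2 * lo1 (2 * d) else 0)" for j
      define g where "g r = (tab2 (2 * d + 1) r -
        (if r = i then (1 + lo1 (2 * d) / 4) / (1 + 2 * lo1 (2 * d)) else 0)) / tab2 (2 * d + 1) i" for r
      define h where "h k = (if k = i then 1 else 0 :: real)" for k
      show "bounded_run d extend_prog (1950 * d\<^sup>2) (state_ok d z (Suc t)) s'"
      proof (rule wp_mono[OF wp_extend[OF d v \<alpha>p i_def[symmetric] i'(1,3) f_def g_def h_def]])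
        fix s2 :: state assume "fst s2 0 = 1 \<and> (\<exists>lo' tab'. view d s2 lo' tab' \<and>
          updated d lo1 (tab2(2 * d := (tab2 (2 * d))(i := 1))) f g h lo' tab')"
        then obtain lo' tab' where s2: "fst s2 0 = 1" "view d s2 lo' tab'"
          "updated d lo1 (tab2(2 * d := (tab2 (2 * d))(i := 1))) f g h lo' tab'" by blast
        show "state_ok d z (Suc t) s2"
        proof (rule ok[OF s2])
          show "((tab2 (2 * d))(i := 1)) j = 0 \<or> ((tab2 (2 * d))(i := 1)) j = 1" if "j < d" for j
            using flags[OF that] t2 by simp
          show "insert i J = {j. j < d \<and> ((tab2 (2 * d))(i := 1)) j = 1}"
            using i' t2 by (auto simp: J_def)
          fix A' N'
          assume A': "\<And>r j. r < d \<Longrightarrow> j < d \<Longrightarrow> A' r j = (1 + lo (2 * d) / 4) * A r j + co u r * f j"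
            and N': "\<And>r j. r < d \<Longrightarrow> j < d \<Longrightarrow> N' r j = (N r j - g r * (\<Sum>k<d. h k * N k j)) / (1 + lo (2 * d) / 4)"
          have "\<exists>L'. rounding d z (Suc t) (c + lo (2 * d) *\<^sub>R u) (lo (2 * d) / (1 + 2 * lo (2 * d))) A' N' (insert i J) U L'"
            by (rule rounding_extend[OF R zu uR y_def i'(1) iJ _ refl])
              (use i' A' N' in \<open>simp_all add: coy \<alpha>1 f_def g_def h_def\<close>)
          then show "\<exists>U' L'. rounding d z (Suc t) (c + lo (2 * d) *\<^sub>R u) (lo (2 * d) / (1 + 2 * lo (2 * d))) A' N' (insert i J) U' L'"
            by blast
        qed
      qed (use d2 in simp)
    next
      assume "\<not> bval d s' (ILess (Reg 3) Dimension)"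
      then have no: "\<And>i. i < d \<Longrightarrow> \<not> out i" using s' by auto
      \<comment> \<open>Without a pivot \<open>y\<close> is supported on the active columns, which
        by the last clause of \<open>frame\<close> means that \<open>u\<close> is in the range of
        \<open>A\<close>.\<close>
      have yJ: "y \<in> coords J"
        unfolding coords_def
      proof (intro CollectI allI impI)
        fix i assume i: "i \<notin> J"
        show "co y i = 0"
        proof (cases "i < d")
          case True
          then have "tab (2 * d) i = 0" using flags i by (auto simp: J_def)
          then show ?thesis using no[OF True] coy[OF True] by (simp add: out_def tab2_def tab1_def)
        qed (use yR in \<open>simp add: Rd_iff\<close>)
      qed
      have Jt: "J = {j. j < d \<and> tab2 (2 * d) j = 1}" by (simp add: J_def t2)
      show "bounded_run d (Cond (RLess (RNum 1) Norm_square) stretch_prog Skip) (1950 * d\<^sup>2) (state_ok d z (Suc t)) s'"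
      proof (rule wp_Cond[where K = "1800 * d\<^sup>2"])
        assume "bval d s' (RLess (RNum 1) Norm_square)"
        then have \<rho>: "1 < ip d y y" using n by (simp add: Norm_square_def)
        define a where "a = (1 + 2 * lo (2 * d)) * (sqrt (ip d y y) + 1)"
        define \<kappa> where "\<kappa> = (a - (1 + lo (2 * d) / 4)) / ip d y y"
        show "bounded_run d stretch_prog (1800 * d\<^sup>2) (state_ok d z (Suc t)) s'"
        proof (rule wp_mono[OF wp_stretch[OF d v \<alpha>p \<rho>[unfolded yy]
              a_def[unfolded yy, folded \<alpha>1] \<kappa>_def[unfolded yy, folded \<alpha>1]]], rule order_refl)
          fix s2 :: state assume "fst s2 0 = 1 \<and> (\<exists>lo' tab'. view d s2 lo' tab' \<and>
            updated d lo1 tab2 (\<lambda>i. \<kappa> * tab2 (2 * d + 1) i) (\<lambda>i. \<kappa> / a * tab2 (2 * d + 1) i) (tab2 (2 * d + 1)) lo' tab')"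
          \<comment> \<open>Writing the unchanged flag row as an update by itself gives the form
            that \<open>ok\<close> expects.\<close>
          then obtain lo' tab' where s2: "fst s2 0 = 1" "view d s2 lo' tab'"
            "updated d lo1 (tab2(2 * d := tab2 (2 * d))) (\<lambda>i. \<kappa> * tab2 (2 * d + 1) i) (\<lambda>i. \<kappa> / a * tab2 (2 * d + 1) i) (tab2 (2 * d + 1)) lo' tab'"
            by auto
          show "state_ok d z (Suc t) s2"
          proof (rule ok[OF s2 _ Jt])
            show "tab2 (2 * d) j = 0 \<or> tab2 (2 * d) j = 1" if "j < d" for j
              using flags[OF that] t2 by simp
            fix A' N'
            assume A': "\<And>i j. i < d \<Longrightarrow> j < d \<Longrightarrow> A' i j = (1 + lo (2 * d) / 4) * A i j + co u i * (\<kappa> * tab2 (2 * d + 1) j)"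
              and N': "\<And>i j. i < d \<Longrightarrow> j < d \<Longrightarrow> N' i j = (N i j - \<kappa> / a * tab2 (2 * d + 1) i * (\<Sum>k<d. tab2 (2 * d + 1) k * N k j)) / (1 + lo (2 * d) / 4)"
            have "\<exists>L'. rounding d z (Suc t) (c + lo (2 * d) *\<^sub>R u) (lo (2 * d) / (1 + 2 * lo (2 * d))) A' N' J (Suc U) L'"
              by (rule rounding_stretch[OF R zu uR y_def yJ \<rho> refl a_def \<kappa>_def]) (use A' N' in \<open>simp_all add: coy\<close>)
            then show "\<exists>U' L'. rounding d z (Suc t) (c + lo (2 * d) *\<^sub>R u) (lo (2 * d) / (1 + 2 * lo (2 * d))) A' N' J U' L'"
              by blast
          qed
        qed
      next
        assume "\<not> bval d s' (RLess (RNum 1) Norm_square)"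
        then have \<rho>: "ip d y y \<le> 1" using n by (simp add: Norm_square_def)
        have eq: "block d 0 tab2 = A" "block d d tab2 = N" "vec_of d (\<lambda>i. lo1 (d + i)) = c"
          by (simp_all add: block_def A_def N_def t2 c_def lo1_def cong: if_cong)
        have "rounding d z (Suc t) c (lo (2 * d)) A N J U L"
          by (rule rounding_skip[OF R zu uR]) (use yJ \<rho> in \<open>simp_all add: y_def\<close>)
        then have "rounding d z (Suc t) (vec_of d (\<lambda>i. lo1 (d + i))) (lo1 (2 * d)) (block d 0 tab2) (block d d tab2)
            {j. j < d \<and> tab2 (2 * d) j = 1} U L"
          by (simp only: eq \<alpha>1 Jt)
        moreover have "\<forall>j<d. tab2 (2 * d) j = 0 \<or> tab2 (2 * d) j = 1" using flags t2 by simp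
        ultimately have "state_ok d z (Suc t) s'"
          unfolding state_ok_def using v by (intro conjI exI)
        then show "bounded_run d Skip (1800 * d\<^sup>2) (state_ok d z (Suc t)) s'"
          using d2 by (intro wp_Skip) auto
      next
        have "bcost (RLess (RNum 1) Norm_square) = 18" by (simp add: Norm_square_def)
        then show "bcost (RLess (RNum 1) Norm_square) + 1 + 1800 * d\<^sup>2 \<le> 1950 * d\<^sup>2" using d2 by linarith
      qed (use adr_less[of "2 * d + 6" d 0] d in \<open>auto simp: Norm_square_def\<close>)
    next
      show "bcost (ILess (Reg 3) Dimension) + 1 + 1950 * d\<^sup>2 \<le> 2000 * d\<^sup>2" using d2 by simp
    qed auto
  qed
  show ?thesis
    unfolding main_prog_def
    apply (rule wp_Then[OF 1, where K' = "2600 * d\<^sup>2"])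
     apply (rule wp_Then[OF 2, where K' = "2300 * d\<^sup>2"], assumption)
      apply (rule wp_Then[OF 3, where K' = "2000 * d\<^sup>2"], assumption)
       apply (rule 4, assumption)
    by auto
qed

lemma wp_streaming:
  assumes d: "0 < d" and z: "z (Suc t) \<in> Rd d"
    and ok: "if t = 0 then s = (\<lambda>_. 0, \<lambda>_. 0) else state_ok d z t s"
  shows "bounded_run d streaming_prog (3010 * d\<^sup>2) (state_ok d z (Suc t)) (receive d (z (Suc t)) s)"
proof -
  define lo' where "lo' lo = (\<lambda>p. if p < d then co (z (Suc t)) p else lo p)" for lo
  have recv: "mem_view d (snd (receive d (z (Suc t)) s)) (lo' lo) tab" if "view d s lo tab" for lo tab
    using that by (auto simp: mem_view_def receive_def lo'_def adr_def)
  have reg: "fst (receive d (z (Suc t)) s) = fst s" by (simp add: receive_def)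
  have d2: "1 \<le> d\<^sup>2" using d by simp
  show ?thesis
    unfolding streaming_prog_def
  proof (rule wp_Cond[where K = "3000 * d\<^sup>2"])
    assume "bval d (receive d (z (Suc t)) s) (ILess (Reg 0) (INum 1))"
    \<comment> \<open>Receiving a point keeps the registers, and register 0 is 1 under
      \<open>state_ok\<close>, so only the initial state can pass this test.\<close>
    then have "fst s 0 \<noteq> 1" by (simp add: reg)
    then have t: "t = 0" "s = (\<lambda>_. 0, \<lambda>_. 0)" using ok by (auto simp: state_ok_def split: if_splits)
    then have "view d s (\<lambda>_. 0) (\<lambda>_ _. 0)" by (simp add: mem_view_def)
    then have "bounded_run d init_prog (200 * d\<^sup>2) (state_ok d z 1) (receive d (z (Suc t)) s)"
      using z t by (intro wp_init[OF d recv]) (auto simp: lo'_def)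
    then show "bounded_run d init_prog (3000 * d\<^sup>2) (state_ok d z (Suc t)) (receive d (z (Suc t)) s)"
      by (rule wp_mono) (use t in auto)
  next
    assume "\<not> bval d (receive d (z (Suc t)) s) (ILess (Reg 0) (INum 1))"
    then have "t \<noteq> 0" using ok by (cases "t = 0") (auto simp: reg receive_def)
    then have "state_ok d z t s" using ok by simp
    then obtain lo tab U L where s: "fst s 0 = 1" "view d s lo tab"
      "\<forall>j<d. tab (2 * d) j = 0 \<or> tab (2 * d) j = 1"
      "rounding d z t (vec_of d (\<lambda>i. lo (d + i))) (lo (2 * d)) (block d 0 tab) (block d d tab)
        {j. j < d \<and> tab (2 * d) j = 1} U L"
      unfolding state_ok_def by blast
    have eq: "vec_of d (\<lambda>i. lo' lo (d + i)) = vec_of d (\<lambda>i. lo (d + i))" "lo' lo (2 * d) = lo (2 * d)"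
      by (simp_all add: lo'_def)
    show "bounded_run d main_prog (3000 * d\<^sup>2) (state_ok d z (Suc t)) (receive d (z (Suc t)) s)"
      by (rule wp_main[OF d recv[OF s(2)], where U = U and L = L]) (use s z reg in \<open>auto simp: eq\<close>, auto simp: lo'_def)
  next
    have "bcost (ILess (Reg 0) (INum 1)) = 3" by simp
    then show "bcost (ILess (Reg 0) (INum 1)) + 1 + 3000 * d\<^sup>2 \<le> 3010 * d\<^sup>2" using d2 by linarith
  qed simp
qed

lemma run_streaming:
  assumes d: "0 < d" and z: "\<And>i. i \<in> {1..n} \<Longrightarrow> z i \<in> Rd d" and t: "t \<le> n"
  shows "\<exists>s T. run (12 * d\<^sup>2) d streaming_prog z t s T \<and> T \<le> t * (3011 * d\<^sup>2) \<and>
    (if t = 0 then s = (\<lambda>_. 0, \<lambda>_. 0) else state_ok d z t s)"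
  using t
proof (induction t)
  case 0
  then show ?case using run.start by (intro exI conjI) auto
next
  case (Suc t)
  then obtain s T where s: "run (12 * d\<^sup>2) d streaming_prog z t s T" "T \<le> t * (3011 * d\<^sup>2)"
    "if t = 0 then s = (\<lambda>_. 0, \<lambda>_. 0) else state_ok d z t s" by auto
  have "z (Suc t) \<in> Rd d" using Suc.prems by (intro z) simp
  then obtain k s' where s': "exec (12 * d\<^sup>2) d streaming_prog (receive d (z (Suc t)) s) k s'"
    "k \<le> 3010 * d\<^sup>2" "state_ok d z (Suc t) s'"
    using wp_streaming[OF d _ s(3)] unfolding wp_def by blast
  \<comment> \<open>Receiving a point costs \<open>d\<close>, which accounts for the difference
    between 3010 and 3011.\<close>
  have "d \<le> d\<^sup>2" using d by (simp add: power2_eq_square)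
  then have "T + d + k \<le> t * (3011 * d\<^sup>2) + 3011 * d\<^sup>2" using s(2) s'(2) by linarith
  also have "\<dots> = Suc t * (3011 * d\<^sup>2)" by simp
  finally show ?case using run.step[OF s(1) s'(1)] s'(3) by (intro exI conjI) auto
qed

text \<open>The array read off memory and its truncation \<open>block\<close> agree below
  \<open>d\<close>, and \<open>app\<close> inspects nothing else, so the invariant transfers to the
  actual output.\<close>

lemma state_ok_rounding:
  assumes "state_ok d z t s" "0 < d"
  obtains N J U L where "rounding d z t (out_center d s) (out_factor d s) (\<lambda>i j. snd s (2 * d + 1 + i * d + j)) N J U L"
proof -
  obtain lo tab U L where s: "view d s lo tab"
    and R: "rounding d z t (vec_of d (\<lambda>i. lo (d + i))) (lo (2 * d)) (block d 0 tab) (block d d tab)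
        {j. j < d \<and> tab (2 * d) j = 1} U L"
    using assms(1) unfolding state_ok_def by blast
  define A where "A = (\<lambda>i j. snd s (2 * d + 1 + i * d + j))"
  have A: "A i j = block d 0 tab i j" if "i < d" "j < d" for i j
    using mem_view_adr[OF s, of i j] that by (simp add: A_def block_def adr_def)
  have c: "out_center d s = vec_of d (\<lambda>i. lo (d + i))"
    unfolding out_center_def by (rule Rd_eqI[of _ d]) (auto simp: mem_view_low[OF s])
  have \<alpha>: "out_factor d s = lo (2 * d)" by (simp add: out_factor_def mem_view_low[OF s])
  have "app d A = app d (block d 0 tab)" "app d (transp A) = app d (transp (block d 0 tab))"
    by (auto simp: fun_eq_iff app_def A intro!: Rd_eqI[of _ d])
  then have "rounding d z t (out_center d s) (out_factor d s) A (block d d tab) {j. j < d \<and> tab (2 * d) j = 1} U L"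
    using R unfolding c \<alpha> rounding_def frame_def factors_def by simp
  then show thesis unfolding A_def by (rule that)
qed

theorem theorem2:
  shows "\<exists>(P :: com) (C\<^sub>s :: nat) (C\<^sub>t :: real) (k :: nat) (C :: real).
    \<forall>(d :: nat) (n :: nat) (z :: nat \<Rightarrow> point).
      1 \<le> d \<longrightarrow> 1 \<le> n \<longrightarrow> (\<forall>i\<in>{1..n}. z i \<in> Rd d) \<longrightarrow>
      (\<exists>(s :: nat \<Rightarrow> state) (T :: nat \<Rightarrow> nat).
        (\<forall>t\<le>n. run (C\<^sub>s * d\<^sup>2) d P z t (s t) (T t)) \<and>
        real (T n) \<le> C\<^sub>t * (real n * (real d)\<^sup>2) * (1 + ln (real n * (real d)\<^sup>2)) ^ k \<and>
        (\<forall>t\<in>{1..n}.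
          let X = z ` {1..t}; c = out_center d (s t); E = out_ellipsoid d (s t);
              \<alpha> = out_factor d (s t); d\<^sub>t = real (affine_dim X)
          in 0 < \<alpha> \<and> \<alpha> \<le> 1 \<and>
             (\<lambda>x. c + \<alpha> *\<^sub>R x) ` E \<subseteq> convex hull X \<and>
             convex hull X \<subseteq> (\<lambda>x. c + x) ` E \<and>
             1 / \<alpha> \<le> C * max 1 (d\<^sub>t * ln (d\<^sub>t * max_ratio d z t))))"
\<comment> \<open>The exponent of the logarithm is 0: the time is \<open>O(n d^2)\<close> outright.
  The other witnesses are the size of the layout, the cost per point and the constant of
  \<open>factor_bound\<close>.\<close>
proof (rule exI[of _ streaming_prog], rule exI[of _ 12], rule exI[of _ 3011], rule exI[of _ 0], rule exI[of _ 40],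
    intro allI impI)
  fix d n :: nat and z :: "nat \<Rightarrow> point"
  assume d1: "1 \<le> d" and n: "1 \<le> n" and z: "\<forall>i\<in>{1..n}. z i \<in> Rd d"
  have d: "0 < d" using d1 by simp
  have "\<forall>t. \<exists>s T. t \<le> n \<longrightarrow> run (12 * d\<^sup>2) d streaming_prog z t s T \<and> T \<le> t * (3011 * d\<^sup>2) \<and>
      (t \<noteq> 0 \<longrightarrow> state_ok d z t s)"
    using run_streaming[OF d, of n z] z by (metis (full_types))
  then obtain s T where sT: "\<And>t. t \<le> n \<Longrightarrow> run (12 * d\<^sup>2) d streaming_prog z t (s t) (T t)"
    "\<And>t. t \<le> n \<Longrightarrow> T t \<le> t * (3011 * d\<^sup>2)" "\<And>t. t \<le> n \<Longrightarrow> t \<noteq> 0 \<Longrightarrow> state_ok d z t (s t)"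
    by metis
  have "real (T n) \<le> real (n * (3011 * d\<^sup>2))" using sT(2)[of n] by (simp only: of_nat_le_iff)
  then have time: "real (T n) \<le> 3011 * (real n * (real d)\<^sup>2) * (1 + ln (real n * (real d)\<^sup>2)) ^ 0" by simp
  have out: "0 < out_factor d (s t) \<and> out_factor d (s t) \<le> 1 \<and>
      (\<lambda>x. out_center d (s t) + out_factor d (s t) *\<^sub>R x) ` out_ellipsoid d (s t) \<subseteq> convex hull (z ` {1..t}) \<and>
      convex hull (z ` {1..t}) \<subseteq> (\<lambda>x. out_center d (s t) + x) ` out_ellipsoid d (s t) \<and>
      1 / out_factor d (s t) \<le> 40 * max 1 (real (affine_dim (z ` {1..t})) *
        ln (real (affine_dim (z ` {1..t})) * max_ratio d z t))"
    if t: "t \<in> {1..n}" for t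
  proof -
    define A where "A = (\<lambda>i j. snd (s t) (2 * d + 1 + i * d + j))"
    have "state_ok d z t (s t)" using t by (intro sT(3)) auto
    then obtain N J U L where R: "rounding d z t (out_center d (s t)) (out_factor d (s t)) A N J U L"
      unfolding A_def using d by (rule state_ok_rounding)
    have E: "out_ellipsoid d (s t) = app d A ` unit_ball d"
      by (simp add: out_ellipsoid_def app_def[abs_def] A_def)
    \<comment> \<open>The maximum runs over all earlier times, and the invariant at each of them
      makes the inner radius there positive.\<close>
    have "\<exists>c \<alpha> A N J U L. rounding d z r c \<alpha> A N J U L" if "r \<in> {1..t}" for r
    proof -
      have "state_ok d z r (s r)" using that t by (intro sT(3)) auto
      then show ?thesis using d by (rule state_ok_rounding) blast
    qed
    moreover have "z ` {1..t} \<subseteq> Rd d" using z t by auto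
    ultimately have "1 / out_factor d (s t) \<le> 40 * max 1 (real (affine_dim (z ` {1..t})) *
        ln (real (affine_dim (z ` {1..t})) * max_ratio d z t))"
      using R t by (intro rounding_factor) auto
    moreover have "(\<lambda>x. out_center d (s t) + out_factor d (s t) *\<^sub>R x) ` out_ellipsoid d (s t) \<subseteq> convex hull (z ` {1..t})"
      unfolding E image_image by (rule image_subsetI) (rule roundingD(5)[OF R])
    moreover have "convex hull (z ` {1..t}) \<subseteq> (\<lambda>x. out_center d (s t) + x) ` out_ellipsoid d (s t)"
      unfolding E image_image by (rule rounding_outer_hull[OF R])
    moreover have "0 < out_factor d (s t)" "out_factor d (s t) \<le> 1"
      using roundingD(3)[OF R] rounding_\<alpha>_le[OF R] by auto
    ultimately show ?thesis by (intro conjI)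
  qed
  show "\<exists>s T. (\<forall>t\<le>n. run (12 * d\<^sup>2) d streaming_prog z t (s t) (T t)) \<and>
        real (T n) \<le> 3011 * (real n * (real d)\<^sup>2) * (1 + ln (real n * (real d)\<^sup>2)) ^ 0 \<and>
        (\<forall>t\<in>{1..n}.
          let X = z ` {1..t}; c = out_center d (s t); E = out_ellipsoid d (s t);
              \<alpha> = out_factor d (s t); d\<^sub>t = real (affine_dim X)
          in 0 < \<alpha> \<and> \<alpha> \<le> 1 \<and>
             (\<lambda>x. c + \<alpha> *\<^sub>R x) ` E \<subseteq> convex hull X \<and>
             convex hull X \<subseteq> (\<lambda>x. c + x) ` E \<and>
             1 / \<alpha> \<le> 40 * max 1 (d\<^sub>t * ln (d\<^sub>t * max_ratio d z t)))"
    unfolding Let_def using sT(1) time out by (intro exI[of _ s] exI[of _ T] conjI allI ballI impI) blast+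
qed

end
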